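(* (Marchaud inequality.) Let $f\in L_p(\mathbb{R}^d)$, $0<p\le \infty$, $\alpha\in \mathbb{N}\cup((1/p-1)_+,\infty)$, and let $\gamma>0$ be such that $\alpha+\gamma\in \mathbb{N}\cup((1/p-1)_+,\infty)$. Put $\theta=\min(p,2)$ if $p<\infty$ and $\theta=1$ if $p=\infty$. Then, for any $\delta\in(0,1)$, $$\omega_\alpha(f,\delta)_p\lesssim \delta^\alpha \left(\int_\delta^1 \left(\frac{\omega_{\gamma+\alpha}(f,t)_p}{t^{\alpha}}\right)^\theta\frac{dt}{t}+\|f\|_p^\theta\right)^{\frac1\theta}.$$ Equivalently, $$\omega_\alpha(f,\delta)_p\lesssim \delta^\alpha \left(\int_\delta^\infty \left(\frac{\omega_{\gamma+\alpha}(f,t)_p}{t^{\alpha}}\right)^\theta\frac{dt}{t}\right)^{\frac1\theta}.$$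
   Context: Here $d\ge 1$, $\|\cdot\|_p$ is the (quasi-)norm of $L_p(\mathbb{R}^d)$, $a_+=\max\{a,0\}$, and $1/\infty=0$. For $\alpha>0$ and $h\in\mathbb{R}^d$ the (fractional) difference is $\Delta_h^\alpha f(x)=\sum_{\nu=0}^\infty(-1)^\nu\binom{\alpha}{\nu}f(x+(\alpha-\nu)h)$, where $\binom{\alpha}{\nu}=\frac{\alpha(\alpha-1)\cdots(\alpha-\nu+1)}{\nu!}$, $\binom{\alpha}{0}=1$ (for $\alpha\in\mathbb{N}$ this is the usual $\alpha$-th difference), and the modulus of smoothness is $\omega_\alpha(f,\delta)_p=\sup_{|h|\le\delta}\|\Delta_h^\alpha f\|_p$, with $|h|$ the Euclidean norm. $F\lesssim G$ means $F\le CG$ with a constant $C>0$ independent of $f$ and $\delta$ (it may depend on $p,\alpha,\gamma,d$). *)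

theory Defs
  imports "HOL-Probability.Essential_Supremum"
begin

text \<open>Powers of extended nonnegative reals. It is only used with exponents \<open>a > 0\<close>, where the
  convention is \<open>0\<^sup>a = 0\<close> and \<open>\<infinity>\<^sup>a = \<infinity>\<close>.\<close>

definition ennreal_powr :: "ennreal \<Rightarrow> real \<Rightarrow> ennreal" (infixr "epowr" 80) where
  "x epowr a = (if x = \<infinity> then \<infinity> else ennreal (enn2real x powr a))"

definition Lp_norm :: "ennreal \<Rightarrow> (real^'n \<Rightarrow> complex) \<Rightarrow> ennreal" where
  "Lp_norm p f =
     (if p = \<infinity> then esssup lebesgue (\<lambda>x. ennreal (norm (f x)))
      else (\<integral>\<^sup>+x. ennreal (norm (f x) powr enn2real p) \<partial>lebesgue) epowr (1 / enn2real p))"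

definition Lp_space :: "ennreal \<Rightarrow> (real^'n \<Rightarrow> complex) set" where
  "Lp_space p = {f \<in> borel_measurable lebesgue. Lp_norm p f < \<infinity>}"

text \<open>The series is taken pointwise. For \<open>f \<in> Lp_space p\<close> and \<open>\<alpha>\<close> in \<open>smoothness_orders p\<close> below it
  converges absolutely at almost every \<open>x\<close>, so the unspecified value of a divergent series only
  enters on a null set, which \<open>Lp_norm\<close> does not see. For positive integers \<open>\<alpha>\<close> the coefficients with
  \<open>\<nu> > \<alpha>\<close> vanish and the sum is finite.\<close>

definition frac_diff :: "real \<Rightarrow> real^'n \<Rightarrow> (real^'n \<Rightarrow> complex) \<Rightarrow> real^'n \<Rightarrow> complex" where
  "frac_diff \<alpha> h f x =
     (\<Sum>\<nu>. complex_of_real ((-1) ^ \<nu> * (\<alpha> gchoose \<nu>)) * f (x + (\<alpha> - real \<nu>) *\<^sub>R h))"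

definition modulus_smoothness :: "real \<Rightarrow> ennreal \<Rightarrow> (real^'n \<Rightarrow> complex) \<Rightarrow> real \<Rightarrow> ennreal" where
  "modulus_smoothness \<alpha> p f \<delta> = (SUP h\<in>{h. norm h \<le> \<delta>}. Lp_norm p (frac_diff \<alpha> h f))"

text \<open>The set \<open>\<nat> \<union> ((1/p - 1)\<^sub>+, \<infinity>)\<close>, where \<open>\<nat>\<close> stands for the positive integers. The division
  is done in \<^typ>\<open>ennreal\<close>, so that \<open>1/\<infinity> = 0\<close>.\<close>

definition smoothness_orders :: "ennreal \<Rightarrow> real set" where
  "smoothness_orders p = (\<nat> - {0}) \<union> {max (enn2real (1 / p) - 1) 0 <..}"

definition marchaud_exponent :: "ennreal \<Rightarrow> real" where
  "marchaud_exponent p = (if p = \<infinity> then 1 else min (enn2real p) 2)"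

end

theory Submission
  imports Defs
begin

text \<open>Fix \<open>f\<close> and a step \<open>h\<close>, and put \<open>(T f) x = f (x - h)\<close>. Up to a translation the difference of
  order \<open>\<alpha>\<close> with step \<open>m h\<close> is \<open>(1 - T\<^sup>m)\<^sup>\<alpha> f\<close>. Hence the theorem is about the functional
  \<open>N a = \<parallel>a(T) f\<parallel>\<^sub>p\<close> on formal power series \<open>a\<close> with \<open>\<Sum> |a\<^sub>n|\<^sup>q < \<infinity>\<close>, where \<open>q = min 1 p\<close>. This
  functional is homogeneous and invariant under multiplication by \<open>X\<close>, its \<open>q\<close>-th power is subadditive,
  and therefore \<open>N (b a)\<^sup>q \<le> (\<Sum> |b\<^sub>n|\<^sup>q) N(a)\<^sup>q\<close> (\<open>mult_bound\<close>). After that, \<open>f\<close> disappears and the work is algebra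
  of power series.

  The core is to compare the steps \<open>h\<close> and \<open>2 h\<close> without losing a constant factor:
  \<open>N ((1 - X)\<^sup>\<alpha>)\<^sup>\<theta> \<le> 2\<^sup>-\<^sup>\<alpha>\<^sup>\<theta> N ((1 - X\<^sup>2)\<^sup>\<alpha>)\<^sup>\<theta> + C N ((1 - X)\<^sup>\<alpha>\<^sup>+\<^sup>1)\<^sup>\<theta>\<close>, which is then iterated over the dyadic
  scales. If \<open>p \<le> 1\<close> or \<open>p = \<infinity>\<close>, then \<open>\<theta> = q\<close> and this is subadditivity, once it is known that
  \<open>1 - ((1 + X)/2)\<^sup>\<alpha>\<close> is \<open>1 - X\<close> times a series with \<open>q\<close>-summable coefficients (\<open>half_sum_power_factor\<close>).

  If \<open>1 < p < \<infinity>\<close>, then \<open>\<theta> = min p 2 > 1\<close> and the triangle inequality is too weak. What replaces it is the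
  uniform smoothness of \<open>L\<^sub>p\<close>, \<open>\<parallel>x + y\<parallel>\<^sup>\<theta> + \<parallel>x - y\<parallel>\<^sup>\<theta> \<le> 2 \<parallel>x\<parallel>\<^sup>\<theta> + 2 K \<parallel>y\<parallel>\<^sup>\<theta>\<close> (\<open>Lp_smooth\<close>). With
  \<open>x = (1 + T) u / 2\<close> and \<open>y = (1 - T) u / 2\<close> the two vectors \<open>x + y = u\<close> and \<open>x - y = T u\<close> have equal norms, so
  \<open>\<parallel>u\<parallel>\<^sup>\<theta> \<le> \<parallel>(1 + T) u / 2\<parallel>\<^sup>\<theta> + K \<parallel>(1 - T) u / 2\<parallel>\<^sup>\<theta>\<close> (\<open>avg_step\<close>). For integer \<open>\<alpha>\<close> this gives the comparison of
  scales at once. For fractional \<open>\<alpha>\<close> one averages \<open>\<lceil>\<alpha>\<rceil>\<close> times at each scale and has to know that the fractional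
  powers of \<open>(1 + X + \<dots> + X\<^sup>M\<^sup>-\<^sup>1) / M\<close> have \<open>\<ell>\<^sub>1\<close> norms bounded independently of \<open>M\<close>
  (\<open>fractional_average_bounded\<close>).

  The passage from \<open>\<alpha> + 1\<close> to \<open>\<alpha> + \<gamma>\<close> is Hardy's inequality for dyadic sums together with the boundedness of
  \<open>(1 - X)\<^sup>d\<close> (\<open>abstract_marchaud\<close>), and the dyadic sum is compared with the integral because the modulus of
  smoothness is monotone in the step size (\<open>dyadic_sum_le_integral\<close>).\<close>

section \<open>Power series with \<open>q\<close>-summable coefficients\<close>

lemma powr_subadditive:
  fixes x y q :: real
  assumes "0 \<le> x" "0 \<le> y" "0 < q" "q \<le> 1"
  shows "(x + y) powr q \<le> x powr q + y powr q"
proof (cases "x + y = 0")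
  case True
  then show ?thesis by simp
next
  case False
  then have s: "0 < x + y" using assms by simp
  have scaled: "t \<le> t powr q" if "0 \<le> t" "t \<le> 1" for t :: real
    using powr_mono'[of q 1 t] that assms by (cases "t = 0") auto
  have "1 = x / (x + y) + y / (x + y)" using s by (simp flip: add_divide_distrib)
  also have "\<dots> \<le> (x / (x + y)) powr q + (y / (x + y)) powr q"
    by (intro add_mono scaled) (use assms s in auto)
  also have "\<dots> = (x powr q + y powr q) / (x + y) powr q"
    using assms s by (simp add: powr_divide add_divide_distrib)
  finally show ?thesis using s by (simp add: pos_le_divide_eq)
qed

lemma powr_abs_sum_le:
  fixes x :: "'a \<Rightarrow> real"
  assumes "0 < q" "q \<le> 1" "finite S"
  shows "\<bar>sum x S\<bar> powr q \<le> (\<Sum>i\<in>S. \<bar>x i\<bar> powr q)"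
  using \<open>finite S\<close>
proof (induction S rule: finite_induct)
  case (insert a S)
  have "\<bar>sum x (insert a S)\<bar> powr q \<le> (\<bar>x a\<bar> + \<bar>sum x S\<bar>) powr q"
    using insert assms by (intro powr_mono2) (auto simp: abs_triangle_ineq)
  also have "\<dots> \<le> \<bar>x a\<bar> powr q + \<bar>sum x S\<bar> powr q"
    using assms by (intro powr_subadditive) auto
  also have "\<dots> \<le> (\<Sum>i\<in>insert a S. \<bar>x i\<bar> powr q)"
    using insert by simp
  finally show ?case .
qed simp

text \<open>A series \<open>a\<close> in \<open>lq q\<close> will act on a function through \<open>\<Sum> a\<^sub>n f (x - n h)\<close>. With
  \<open>q = min 1 p\<close> the quantity \<open>qsum q a\<close> is what bounds this action on \<open>L\<^sub>p\<close>, because the \<open>q\<close>-th power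
  of the \<open>L\<^sub>p\<close> (quasi-)norm is subadditive.\<close>

definition lq :: "real \<Rightarrow> real fps set" where
  "lq q = {a. summable (\<lambda>n. \<bar>fps_nth a n\<bar> powr q)}"

definition qsum :: "real \<Rightarrow> real fps \<Rightarrow> real" where
  "qsum q a = (\<Sum>n. \<bar>fps_nth a n\<bar> powr q)"

lemma lq_summable: "a \<in> lq q \<Longrightarrow> summable (\<lambda>n. \<bar>fps_nth a n\<bar> powr q)"
  by (simp add: lq_def)

lemma qsum_nonneg: "a \<in> lq q \<Longrightarrow> 0 \<le> qsum q a"
  unfolding qsum_def lq_def by (auto intro: suminf_nonneg)

lemma qsum_mono_bound:
  assumes "summable g" "\<And>n. \<bar>fps_nth a n\<bar> powr q \<le> g n"
  shows "a \<in> lq q" "qsum q a \<le> suminf g"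
proof -
  show "a \<in> lq q"
    unfolding lq_def using assms by (auto intro: summable_comparison_test')
  then show "qsum q a \<le> suminf g"
    unfolding qsum_def using assms by (auto intro!: suminf_le simp: lq_def)
qed

context
  fixes q :: real
  assumes q: "0 < q" "q \<le> 1"
begin

lemma lq_add: 
  assumes "a \<in> lq q" "b \<in> lq q"
  shows "a + b \<in> lq q" "qsum q (a + b) \<le> qsum q a + qsum q b"
proof -
  have *: "\<bar>fps_nth (a + b) n\<bar> powr q \<le> \<bar>fps_nth a n\<bar> powr q + \<bar>fps_nth b n\<bar> powr q" for n
    using powr_abs_sum_le[OF q, of "{False, True}" "\<lambda>c. if c then fps_nth a n else fps_nth b n"] by (simp add: add.commute)
  note s = assms[THEN lq_summable]
  show "a + b \<in> lq q" "qsum q (a + b) \<le> qsum q a + qsum q b"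
    using qsum_mono_bound[OF summable_add[OF s] *] suminf_add[OF s] by (auto simp: qsum_def)
qed

lemma lq_const_mult:
  assumes "a \<in> lq q"
  shows "fps_const c * a \<in> lq q" "qsum q (fps_const c * a) = \<bar>c\<bar> powr q * qsum q a"
  using assms by (auto simp: lq_def qsum_def abs_mult powr_mult suminf_mult intro: summable_mult)

lemma lq_uminus: "a \<in> lq q \<Longrightarrow> - a \<in> lq q" "qsum q (- a) = qsum q a"
  by (auto simp: lq_def qsum_def)

lemma lq_diff: "a \<in> lq q \<Longrightarrow> b \<in> lq q \<Longrightarrow> a - b \<in> lq q"
  using lq_add(1)[of a "- b"] lq_uminus by simp

lemma lq_finite_support:
  assumes "\<And>n. n \<ge> N \<Longrightarrow> fps_nth a n = 0"
  shows "a \<in> lq q" "qsum q a = (\<Sum>n<N. \<bar>fps_nth a n\<bar> powr q)"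
proof -
  have "(\<lambda>n. \<bar>fps_nth a n\<bar> powr q) sums (\<Sum>n<N. \<bar>fps_nth a n\<bar> powr q)"
    by (rule sums_finite) (use assms in auto)
  then show "a \<in> lq q" "qsum q a = (\<Sum>n<N. \<bar>fps_nth a n\<bar> powr q)"
    by (auto simp: lq_def qsum_def sums_iff)
qed

lemma lq_simple [simp]: "0 \<in> lq q" "1 \<in> lq q" "fps_const c \<in> lq q" "fps_X \<in> lq q" "fps_X ^ k \<in> lq q"
  by (rule lq_finite_support(1)[of "Suc (Suc k)"], simp)+

lemma lq_mult:
  assumes a: "a \<in> lq q" and b: "b \<in> lq q"
  shows "a * b \<in> lq q" "qsum q (a * b) \<le> qsum q a * qsum q b"
proof -
  let ?f = "\<lambda>n. \<bar>fps_nth a n\<bar> powr q" and ?g = "\<lambda>n. \<bar>fps_nth b n\<bar> powr q"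
  have *: "\<bar>fps_nth (a * b) n\<bar> powr q \<le> (\<Sum>i\<le>n. ?f i * ?g (n - i))" for n
    using powr_abs_sum_le[OF q, of "{..n}" "\<lambda>i. fps_nth a i * fps_nth b (n - i)"]
    by (simp add: fps_mult_nth atLeast0AtMost abs_mult powr_mult)
  have n: "summable (\<lambda>n. norm (?f n))" "summable (\<lambda>n. norm (?g n))"
    using a b by (auto simp: lq_def)
  show "a * b \<in> lq q" "qsum q (a * b) \<le> qsum q a * qsum q b"
    using qsum_mono_bound[OF summable_Cauchy_product[OF n] *] Cauchy_product[OF n]
    by (auto simp: qsum_def)
qed

lemma lq_tail:
  assumes "a \<in> lq q"
  shows "(\<lambda>M. qsum q (a - fps_cutoff M a)) \<longlonglongrightarrow> 0"
proof -
  have s: "summable (\<lambda>n. \<bar>fps_nth a n\<bar> powr q)" using assms by (rule lq_summable)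
  have "qsum q (a - fps_cutoff M a) = (\<Sum>n. \<bar>fps_nth a (n + M)\<bar> powr q)" for M
  proof -
    have "fps_cutoff M a \<in> lq q" by (rule lq_finite_support(1)[of M]) simp
    with assms have "a - fps_cutoff M a \<in> lq q" by (rule lq_diff)
    then have "qsum q (a - fps_cutoff M a) = (\<Sum>n. \<bar>fps_nth (a - fps_cutoff M a) (n + M)\<bar> powr q)
       + (\<Sum>n<M. \<bar>fps_nth (a - fps_cutoff M a) n\<bar> powr q)"
      unfolding qsum_def by (intro suminf_split_initial_segment lq_summable)
    then show ?thesis by simp
  qed
  then show ?thesis using suminf_exist_split2[OF s] by simp
qed

end

text \<open>Substituting \<open>X\<^sup>m\<close> for \<open>X\<close> replaces the step \<open>h\<close> by \<open>m h\<close>, so one base step suffices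
  to compare the moduli at all dyadic scales.\<close>

definition stretch :: "nat \<Rightarrow> 'a::comm_ring_1 fps \<Rightarrow> 'a fps" where
  "stretch m a = a oo fps_X ^ m"

lemma stretch_nth:
  assumes "0 < m"
  shows "fps_nth (stretch m a) n = (if m dvd n then fps_nth a (n div m) else 0)"
proof -
  have "fps_nth (stretch m a) n = (\<Sum>i\<in>{0..n}. fps_nth a i * (if n = m * i then 1 else 0))"
    by (simp add: stretch_def fps_compose_nth flip: power_mult)
  also have "\<dots> = (\<Sum>i\<in>{0..n}. if n = m * i then fps_nth a i else 0)"
    by (intro sum.cong) auto
  also have "\<dots> = (if m dvd n then fps_nth a (n div m) else 0)"
  proof (cases "m dvd n")
    case True
    then obtain k where k: "n = m * k" by auto
    have "(\<Sum>i\<in>{0..n}. if n = m * i then fps_nth a i else 0) = (\<Sum>i\<in>{0..n}. if k = i then fps_nth a i else 0)"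
      using assms k by (intro sum.cong) auto
    then show ?thesis using assms k True by simp
  next
    case False
    then show ?thesis by (auto intro!: sum.neutral)
  qed
  finally show ?thesis .
qed

lemma stretch_mult: "0 < m \<Longrightarrow> stretch m (a * b :: 'a::idom fps) = stretch m a * stretch m b"
  unfolding stretch_def by (rule fps_compose_mult_distrib) simp

lemma stretch_add: "stretch m (a + b) = stretch m a + stretch m b"
  unfolding stretch_def by (rule fps_compose_add_distrib)

lemma stretch_simps [simp]:
  "stretch m 1 = 1" "stretch m 0 = 0" "stretch m (fps_const c) = fps_const c"
  "0 < m \<Longrightarrow> stretch m fps_X = fps_X ^ m" "stretch 1 a = a" "stretch (Suc 0) a = a"
  unfolding stretch_def by (auto simp: fps_eq_iff)

lemma stretch_stretch: "0 < m \<Longrightarrow> 0 < k \<Longrightarrow> stretch m (stretch k a) = stretch (m * k) a"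
  by (simp add: fps_eq_iff stretch_nth div_mult2_eq)
    (metis div_mult2_eq dvd_div_iff_mult dvd_mult_left mult.commute dvd_mult_div_cancel neq0_conv)

lemma sums_stretch:
  assumes "0 < m" "\<And>n. F n 0 = 0"
  shows "(\<lambda>n. F n (fps_nth (stretch m a) n)) sums s \<longleftrightarrow> (\<lambda>k. F (m * k) (fps_nth a k)) sums s"
proof -
  have "(\<lambda>k. F (m * k) (fps_nth (stretch m a) (m * k))) sums s \<longleftrightarrow> (\<lambda>n. F n (fps_nth (stretch m a) n)) sums s"
    by (rule sums_mono_reindex) (use assms in \<open>auto simp: strict_mono_def stretch_nth dvd_def\<close>)
  then show ?thesis using assms by (simp add: stretch_nth)
qed

lemma lq_stretch:
  assumes "0 < m" "a \<in> lq q"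
  shows "stretch m a \<in> lq q" "qsum q (stretch m a) = qsum q a"
  using sums_stretch[of m "\<lambda>n x. \<bar>x\<bar> powr q" a] assms
  by (auto simp: lq_def qsum_def summable_def suminf_def)

section \<open>The series \<open>(1 - X)\<^sup>b\<close>\<close>

text \<open>The formal power series \<open>(1 - X)\<^sup>b\<close> for real \<open>b\<close>. When \<open>X\<close> acts as the translation by a step
  \<open>h\<close> it becomes the difference of order \<open>b\<close>, up to a final translation.\<close>

definition diff_symbol :: "real \<Rightarrow> real fps" where
  "diff_symbol b = Abs_fps (\<lambda>n. (-1) ^ n * (b gchoose n))"

lemma diff_symbol_nth: "fps_nth (diff_symbol b) n = (-1) ^ n * (b gchoose n)"
  by (simp add: diff_symbol_def)

lemma diff_symbol_eq_compose: "diff_symbol b = fps_binomial b oo (- fps_X)"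
  by (simp add: fps_compose_uminus' diff_symbol_def)

lemma diff_symbol_add: "diff_symbol (a + b) = diff_symbol a * diff_symbol b"
  unfolding diff_symbol_eq_compose fps_binomial_add_mult by (rule fps_compose_mult_distrib) simp

lemma diff_symbol_of_nat: "diff_symbol (real n) = (1 - fps_X) ^ n"
proof -
  have "diff_symbol (real n) = (1 + fps_X) ^ n oo (- fps_X)"
    unfolding diff_symbol_eq_compose fps_binomial_of_nat ..
  also have "\<dots> = (1 - fps_X) ^ n"
    by (simp add: fps_compose_add_distrib flip: fps_compose_power)
  finally show ?thesis .
qed

lemma diff_symbol_0 [simp]: "diff_symbol 0 = 1" and diff_symbol_1: "diff_symbol 1 = 1 - fps_X"
  using diff_symbol_of_nat[of 0] diff_symbol_of_nat[of 1] by simp_all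

lemma diff_symbol_minus: "diff_symbol (- a) * diff_symbol a = 1"
  using diff_symbol_add[of "- a" a] by simp

lemma stretch_diff_symbol_of_nat: "0 < m \<Longrightarrow> stretch m (diff_symbol (real n)) = (1 - fps_X ^ m) ^ n"
  by (simp add: diff_symbol_of_nat stretch_def fps_compose_sub_distrib flip: fps_compose_power)

lemma fps_deriv_diff_symbol: "(1 - fps_X) * fps_deriv (diff_symbol a) = - fps_const a * diff_symbol a"
proof -
  have "fps_nth (1 + fps_X :: real fps) 0 \<noteq> 0" by simp
  then have "(1 + fps_X) * fps_deriv (fps_binomial a) = fps_const a * fps_binomial a"
    by (simp add: fps_binomial_deriv fps_divide_unit inverse_mult_eq_1' mult.left_commute)
  then have "((1 + fps_X) * fps_deriv (fps_binomial a)) oo (- fps_X) = (fps_const a * fps_binomial a) oo (- fps_X)"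
    by simp
  then have "(1 - fps_X) * (fps_deriv (fps_binomial a) oo (- fps_X)) = fps_const a * diff_symbol a"
    by (simp add: fps_compose_mult_distrib fps_compose_add_distrib diff_symbol_eq_compose)
  moreover have "fps_deriv (diff_symbol a) = - (fps_deriv (fps_binomial a) oo (- fps_X))"
    unfolding diff_symbol_eq_compose by (subst fps_compose_deriv) auto
  ultimately show ?thesis by (metis fps_const_neg mult_minus_left mult_minus_right)
qed

text \<open>The identity \<open>(1 - X)\<^sup>a (1 + X)\<^sup>a = (1 - X\<^sup>2)\<^sup>a\<close> for real \<open>a\<close>: the quotient
  \<open>(1 - X\<^sup>2)\<^sup>a (1 - X)\<^sup>-\<^sup>a\<close> satisfies the differential equation \<open>(1 + X) G' = a G\<close>, which
  together with the constant term characterises \<open>(1 + X)\<^sup>a\<close>. It links the differences with steps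
  \<open>h\<close> and \<open>2 h\<close>.\<close>

lemma diff_symbol_mult_fps_binomial: "diff_symbol a * fps_binomial a = stretch 2 (diff_symbol a)"
proof -
  let ?S = "stretch 2 (diff_symbol a)" and ?G = "stretch 2 (diff_symbol a) * diff_symbol (- a)"
  have unit: "fps_nth (1 + fps_X :: real fps) 0 \<noteq> 0" by simp
  have S: "(1 - fps_X ^ 2) * fps_deriv ?S = - fps_const (2 * a) * fps_X * ?S"
  proof -
    have "fps_deriv ?S = (fps_deriv (diff_symbol a) oo fps_X ^ 2) * (fps_const 2 * fps_X)"
      unfolding stretch_def by (subst fps_compose_deriv) (auto simp: fps_deriv_power numeral_fps_const)
    moreover have "(1 - fps_X ^ 2) * (fps_deriv (diff_symbol a) oo fps_X ^ 2) = - fps_const a * ?S"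
      using arg_cong[OF fps_deriv_diff_symbol[of a], of "\<lambda>f. f oo fps_X ^ 2"]
      by (simp add: stretch_def fps_compose_mult_distrib fps_compose_sub_distrib fps_compose_uminus)
    ultimately have "(1 - fps_X ^ 2) * fps_deriv ?S = (- fps_const a * ?S) * (fps_const 2 * fps_X)"
      by (metis mult.assoc)
    also have "\<dots> = - (fps_const 2 * fps_const a) * fps_X * ?S" by algebra
    finally show ?thesis by simp
  qed
  have T: "(1 - fps_X) * fps_deriv (diff_symbol (- a)) = fps_const a * diff_symbol (- a)"
    using fps_deriv_diff_symbol[of "- a"] by simp
  have "(1 - fps_X) * ((1 + fps_X) * fps_deriv ?G) = (1 - fps_X) * (fps_const a * ?G)"
  proof -
    have "(1 - fps_X) * ((1 + fps_X) * fps_deriv ?G)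
       = ((1 - fps_X ^ 2) * fps_deriv ?S) * diff_symbol (- a) + (1 + fps_X) * ?S * ((1 - fps_X) * fps_deriv (diff_symbol (- a)))"
      by (simp add: algebra_simps power2_eq_square)
    also have "\<dots> = (1 - fps_X) * (fps_const a * ?G)"
    proof -
      have two: "fps_const (2 * a) = 2 * fps_const a"
        by (simp add: numeral_fps_const)
      show ?thesis unfolding S T two by algebra
    qed
    finally show ?thesis .
  qed
  moreover have "(1 - fps_X :: real fps) \<noteq> 0"
    by (metis diff_zero fps_X_neq_one right_minus_eq)
  ultimately have "(1 + fps_X) * fps_deriv ?G = fps_const a * ?G" by simp
  then have "fps_const a * ?G / (1 + fps_X) = (1 + fps_X) * fps_deriv ?G * inverse (1 + fps_X)"
    by (simp only: fps_divide_unit[OF unit])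
  also have "\<dots> = fps_deriv ?G * ((1 + fps_X) * inverse (1 + fps_X))" by (simp only: ac_simps)
  also have "\<dots> = fps_deriv ?G" using inverse_mult_eq_1'[OF unit] by simp
  finally have "fps_deriv ?G = fps_const a * ?G / (1 + fps_X)" ..
  moreover have "fps_nth ?G 0 = 1" by (simp add: stretch_nth diff_symbol_nth)
  ultimately have "?G = fps_binomial a" by (subst fps_binomial_ODE_unique'[symmetric]) simp
  then have "diff_symbol a * fps_binomial a = ?S * (diff_symbol (- a) * diff_symbol a)" by (simp only: ac_simps)
  then show ?thesis by (simp only: diff_symbol_minus mult_1_right)
qed

lemma gbinomial_decay:
  fixes a :: real
  assumes "0 < a"
  obtains C where "0 < C" "\<And>n. \<bar>a gchoose n\<bar> \<le> C * real (Suc n) powr (- 1 - a)"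
proof -
  let ?g = "\<lambda>n. (a gchoose n) / ((-1) ^ n / exp ((a + 1) * of_real (ln (real n))))"
  have "Bseq ?g" using gbinomial_asymptotic[of a] by (intro convergent_imp_Bseq convergentI)
  then obtain K where K: "0 < K" "\<And>n. norm (?g n) \<le> K" by (auto elim: BseqE)
  define C where "C = K * 2 powr (a + 1) + 1"
  have "\<bar>a gchoose n\<bar> \<le> C * real (Suc n) powr (- 1 - a)" for n
  proof (cases "n = 0")
    case True
    then show ?thesis using K by (simp add: C_def)
  next
    case False
    have "\<bar>a gchoose n\<bar> * real n powr (a + 1) \<le> K"
      using K(2)[of n] False by (simp add: abs_mult powr_def power_abs)
    then have "\<bar>a gchoose n\<bar> \<le> K * real n powr (- 1 - a)"
      using False by (simp add: powr_minus field_simps powr_diff powr_add)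
    also have "real n powr (- 1 - a) \<le> (real (Suc n) / 2) powr (- 1 - a)"
      using False assms by (intro powr_mono2') auto
    also have "\<dots> = 2 powr (a + 1) * real (Suc n) powr (- 1 - a)"
      by (subst powr_divide) (auto simp: powr_minus powr_diff powr_add divide_simps)
    also have "K * \<dots> \<le> C * real (Suc n) powr (- 1 - a)"
      unfolding C_def mult.assoc[symmetric] using K by (intro mult_right_mono) auto
    finally show ?thesis using K by simp
  qed
  moreover have "0 < C" using K by (simp add: C_def add_pos_pos)
  ultimately show ?thesis using that by blast
qed

text \<open>The threshold \<open>1/q - 1\<close> of the admissible orders is where \<open>\<Sum> n\<^sup>-\<^sup>q\<^sup>(\<^sup>1\<^sup>+\<^sup>a\<^sup>)\<close> starts to converge.\<close>

lemma lq_decay: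
  assumes "0 < q" "1 / q - 1 < a" "0 \<le> C" "\<And>n. \<bar>fps_nth f n\<bar> \<le> C * real (Suc n) powr (- 1 - a)"
  shows "f \<in> lq q"
proof -
  have "1 < q * (1 + a)" using assms by (simp add: field_simps)
  then have "summable (\<lambda>n. real n powr (- (q * (1 + a))))" by (simp add: summable_real_powr_iff)
  then have s: "summable (\<lambda>n. C powr q * real (Suc n) powr (- (q * (1 + a))))"
    by (subst summable_Suc_iff) (rule summable_mult)
  have "\<bar>fps_nth f n\<bar> powr q \<le> C powr q * real (Suc n) powr (- (q * (1 + a)))" for n
  proof -
    have "\<bar>fps_nth f n\<bar> powr q \<le> (C * real (Suc n) powr (- 1 - a)) powr q"
      using assms by (intro powr_mono2) auto
    also have "\<dots> = C powr q * real (Suc n) powr (- (q * (1 + a)))"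
      using assms by (simp add: powr_mult powr_powr algebra_simps)
    finally show ?thesis .
  qed
  with s show ?thesis by (rule qsum_mono_bound(1))
qed

text \<open>The positive orders \<open>a\<close> for which \<open>(1 - X)\<^sup>a\<close> lies in \<open>lq q\<close>, provided that \<open>0 < q \<le> 1\<close>.\<close>

definition admissible :: "real \<Rightarrow> real \<Rightarrow> bool" where
  "admissible q a \<longleftrightarrow> (a \<in> \<nat> \<and> a \<noteq> 0) \<or> 1 / q - 1 < a"

lemma admissible_pos: "0 < q \<Longrightarrow> q \<le> 1 \<Longrightarrow> admissible q a \<Longrightarrow> 0 < a"
  by (auto simp: admissible_def Nats_def) (smt (verit) le_divide_eq_1_pos)

lemma admissible_add_one: "admissible q a \<Longrightarrow> admissible q (a + 1)"
proof (unfold admissible_def, elim disjE conjE)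
  assume "a \<in> \<nat>" "a \<noteq> 0"
  then have "a + 1 \<in> \<nat>" "a + 1 \<noteq> 0" by (auto elim!: Nats_cases)
  then show "(a + 1 \<in> \<nat> \<and> a + 1 \<noteq> 0) \<or> 1 / q - 1 < a + 1" by blast
qed auto

lemma diff_symbol_lq:
  assumes "0 < q" "q \<le> 1" "admissible q a"
  shows "diff_symbol a \<in> lq q"
  using assms(3) unfolding admissible_def
proof
  assume "a \<in> \<nat> \<and> a \<noteq> 0"
  then obtain k where "a = real k" by (auto elim: Nats_cases)
  then show ?thesis
    by (intro lq_finite_support(1)[of q "Suc k"]) (use assms in \<open>auto simp: diff_symbol_nth simp flip: binomial_gbinomial\<close>)
next
  assume a: "1 / q - 1 < a"
  have "0 < a" using assms by (rule admissible_pos)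
  then obtain C where "0 < C" "\<And>n. \<bar>a gchoose n\<bar> \<le> C * real (Suc n) powr (- 1 - a)"
    using gbinomial_decay by metis
  then show ?thesis
    by (intro lq_decay[OF assms(1) a, of C]) (auto simp: diff_symbol_nth abs_mult power_abs)
qed

text \<open>The binomial series at the endpoint \<open>z = 1\<close>: it converges uniformly on \<open>[0, 1]\<close>, so its sum
  is continuous there and equals the limit of \<open>(1 + z)\<^sup>a\<close>.\<close>

lemma gbinomial_sum_eq_two_powr:
  fixes a :: real
  assumes "0 < a"
  shows "(\<lambda>n. a gchoose n) sums (2 powr a)"
proof -
  obtain C where C: "0 < C" "\<And>n. \<bar>a gchoose n\<bar> \<le> C * real (Suc n) powr (- 1 - a)"
    using gbinomial_decay[OF assms] by metis
  have "summable (\<lambda>n. real n powr (- 1 - a))" using assms by (simp add: summable_real_powr_iff)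
  then have s: "summable (\<lambda>n. C * real (Suc n) powr (- 1 - a))"
    by (subst summable_Suc_iff) (rule summable_mult)
  have u: "uniform_limit {0..1} (\<lambda>n z. \<Sum>i<n. (a gchoose i) * z ^ i) (\<lambda>z. \<Sum>i. (a gchoose i) * z ^ i) sequentially"
  proof (rule Weierstrass_m_test[OF _ s])
    fix n and z :: real assume "z \<in> {0..1}"
    then have "\<bar>a gchoose n\<bar> * z ^ n \<le> \<bar>a gchoose n\<bar> * 1"
      by (intro mult_left_mono power_le_one) auto
    with C(2)[of n] \<open>z \<in> {0..1}\<close> show "norm ((a gchoose n) * z ^ n) \<le> C * real (Suc n) powr (- 1 - a)"
      by (simp add: abs_mult)
  qed
  have "continuous_on {0..1} (\<lambda>z::real. \<Sum>i. (a gchoose i) * z ^ i)"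
    by (rule uniform_limit_theorem[OF _ u]) (auto intro!: always_eventually continuous_intros)
  then have "((\<lambda>z::real. \<Sum>i. (a gchoose i) * z ^ i) \<longlongrightarrow> (\<Sum>i. (a gchoose i) * 1 ^ i)) (at 1 within {0..1})"
    unfolding continuous_on_def by (rule bspec) simp
  then have "((\<lambda>z::real. \<Sum>i. (a gchoose i) * z ^ i) \<longlongrightarrow> (\<Sum>i. (a gchoose i) * 1 ^ i)) (at_left 1)"
    by (simp add: at_within_Icc_at_left)
  then have L: "((\<lambda>z::real. (1 + z) powr a) \<longlongrightarrow> (\<Sum>i. (a gchoose i) * 1 ^ i)) (at_left 1)"
  proof (rule Lim_transform_eventually)
    show "\<forall>\<^sub>F z::real in at_left 1. (\<Sum>i. (a gchoose i) * z ^ i) = (1 + z) powr a"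
      using eventually_at_left_real[of 0 1] gen_binomial_real[of _ a]
      by (auto elim!: eventually_mono simp: sums_iff)
  qed
  have R: "((\<lambda>z::real. (1 + z) powr a) \<longlongrightarrow> (1 + 1) powr a) (at_left 1)"
    by (intro tendsto_intros) auto
  have "(\<Sum>i. (a gchoose i) * 1 ^ i) = (1 + 1) powr a"
    using tendsto_unique[OF _ L R] by simp
  then have "(\<Sum>i. a gchoose i) = 2 powr a" by simp
  moreover have "summable (\<lambda>i. a gchoose i)"
    by (rule summable_comparison_test'[OF s]) (use C in auto)
  ultimately show ?thesis by (simp add: sums_iff)
qed

lemma powr_tail_le:
  assumes "1 \<le> s" "0 < n"
  shows "summable (\<lambda>i. real (i + Suc n) powr (- s - 1))" "(\<Sum>i. real (i + Suc n) powr (- s - 1)) \<le> real n powr (- s)"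
proof -
  have le: "(x + 1) powr (- s - 1) \<le> x powr (- s) - (x + 1) powr (- s)" if "0 < x" for x :: real
  proof -
    have "1 + 1 / (x + 1) \<le> (x + 1) / x" using that by (simp add: field_simps)
    also have "\<dots> \<le> ((x + 1) / x) powr s"
      using that assms powr_mono[of 1 s "(x + 1) / x"] by simp
    also have "\<dots> = x powr (- s) * (x + 1) powr s"
      using that by (simp add: powr_divide powr_minus field_simps)
    finally have "(1 + 1 / (x + 1)) * (x + 1) powr (- s) \<le> x powr (- s) * (x + 1) powr s * (x + 1) powr (- s)"
      by (rule mult_right_mono) simp
    also have "\<dots> = x powr (- s)" using that by (simp add: powr_minus)
    also have "(1 + 1 / (x + 1)) * (x + 1) powr (- s) = (x + 1) powr (- s) + (x + 1) powr (- s - 1)"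
      using that by (simp add: powr_diff field_simps)
    finally show ?thesis by simp
  qed
  have lim: "(\<lambda>i. real (i + n) powr (- s)) \<longlonglongrightarrow> 0"
    using assms by (intro LIMSEQ_ignore_initial_segment tendsto_neg_powr filterlim_real_sequentially) auto
  have tel: "(\<lambda>i. real (i + n) powr (- s) - real (Suc i + n) powr (- s)) sums (real (0 + n) powr (- s) - 0)"
    by (rule telescope_sums'[OF lim])
  have le': "real (i + Suc n) powr (- s - 1) \<le> real (i + n) powr (- s) - real (Suc i + n) powr (- s)" for i
    using le[of "real (i + n)"] assms by (simp add: add_ac)
  show "summable (\<lambda>i. real (i + Suc n) powr (- s - 1))"
    by (rule summable_comparison_test'[OF sums_summable[OF tel]]) (use le' in auto)
  then have "(\<Sum>i. real (i + Suc n) powr (- s - 1)) \<le> (\<Sum>i. real (i + n) powr (- s) - real (Suc i + n) powr (- s))"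
    by (intro suminf_le sums_summable[OF tel] le')
  also have "\<dots> = real n powr (- s)" using tel by (simp add: sums_iff)
  finally show "(\<Sum>i. real (i + Suc n) powr (- s - 1)) \<le> real n powr (- s)" .
qed

text \<open>Since \<open>((1 + X)/2)\<^sup>a\<close> takes the value \<open>1\<close> at \<open>X = 1\<close>, the factor \<open>1 - X\<close> can be split off from
  \<open>1 - ((1 + X)/2)\<^sup>a\<close>. The point is that the cofactor stays in \<open>lq q\<close> even for \<open>q < 1\<close>. Up to the factor
  \<open>2\<^sup>-\<^sup>a\<close> its coefficients are the tails of the series \<open>\<Sum> (a gchoose i)\<close>. Adding two neighbouring tails
  replaces \<open>a gchoose i\<close> by \<open>(a + 1) gchoose (i + 1)\<close>, so the alternation of the signs makes the tail as
  small as its first term, up to a constant.\<close>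

lemma half_sum_power_factor:
  assumes "0 < q" "q \<le> 1" "admissible q a"
  obtains B where "B \<in> lq q" "1 - fps_const (2 powr - a) * fps_binomial a = (1 - fps_X) * B"
  using assms(3) unfolding admissible_def
proof (elim disjE conjE)
  assume "a \<in> \<nat>" "a \<noteq> 0"
  then obtain k where k: "a = real k" by (auto elim: Nats_cases)
  let ?P = "fps_const (1 / 2) * (1 + fps_X) :: real fps"
  have P: "?P \<in> lq q" by (intro lq_const_mult lq_add assms lq_simple)
  have Pi: "?P ^ i \<in> lq q" for i
    by (induction i) (auto intro: lq_mult(1)[OF assms(1,2) P] simp: lq_simple[OF assms(1,2)] simp del: fps_const_mult)
  have S: "(\<Sum>i<j. ?P ^ i) \<in> lq q" for j
    by (induction j) (auto intro!: lq_add(1)[OF assms(1,2)] Pi lq_simple(1)[OF assms(1,2)])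
  have h: "fps_const (1/2) + fps_const (1/2) = (1::real fps)" by simp
  have "fps_const (2 powr - a) * fps_binomial a = ?P ^ k"
    by (simp only: k fps_binomial_of_nat power_mult_distrib fps_const_power)
      (simp add: powr_minus powr_realpow power_divide inverse_eq_divide)
  also have "1 - ?P ^ k = (1 - ?P) * (\<Sum>i<k. ?P ^ i)" by (rule one_diff_power_eq)
  also have "1 - ?P = (1 - fps_X) * fps_const (1 / 2)"
    using h by (simp add: algebra_simps)
  finally have "1 - fps_const (2 powr - a) * fps_binomial a = (1 - fps_X) * (fps_const (1/2) * (\<Sum>i<k. ?P ^ i))"
    by (simp add: mult.assoc)
  moreover have "fps_const (1/2) * (\<Sum>i<k. ?P ^ i) \<in> lq q" by (intro lq_const_mult assms S)
  ultimately show ?thesis using that by blast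
next
  assume a: "1 / q - 1 < a"
  have pos: "0 < a" using assms by (rule admissible_pos)
  obtain C where C: "0 < C" "\<And>n. \<bar>a gchoose n\<bar> \<le> C * real (Suc n) powr (- 1 - a)"
    using gbinomial_decay[OF pos] by metis
  obtain C' where C': "0 < C'" "\<And>n. \<bar>(a + 1) gchoose n\<bar> \<le> C' * real (Suc n) powr (- 1 - (a + 1))"
    using gbinomial_decay[of "a + 1"] pos by (metis add_pos_pos zero_less_one)
  define b where "b n = a gchoose n" for n
  have sb: "b sums (2 powr a)" unfolding b_def using gbinomial_sum_eq_two_powr[OF pos] .
  define t where "t n = (\<Sum>i. b (i + Suc n))" for n
  have s: "summable (\<lambda>i. b (i + n))" for n using sb by (simp add: sums_iff)
  have t_Suc: "t n = b (Suc n) + t (Suc n)" for n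
    using suminf_split_head[OF s[of "Suc n"]] by (simp add: t_def)
  have t_0: "t 0 = 2 powr a - b 0"
    using suminf_split_head[OF s[of 0]] sb by (simp add: t_def sums_iff)
  have t_bound: "\<bar>t n\<bar> \<le> (C + C') * real (Suc n) powr (- 1 - a)" for n
  proof -
    \<comment> \<open>neighbouring terms combine by Pascal's rule and gain one power of decay\<close>
    have "t n + t (Suc n) = (\<Sum>i. b (i + Suc n) + b (i + Suc (Suc n)))"
      unfolding t_def by (rule suminf_add) (rule s)+
    also have "\<dots> = (\<Sum>i. (a + 1) gchoose (i + Suc (Suc n)))"
      by (simp add: b_def gbinomial_Suc_Suc)
    finally have 1: "2 * t n = b (Suc n) + (\<Sum>i. (a + 1) gchoose (i + Suc (Suc n)))"
      using t_Suc[of n] by simp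
    have *: "norm ((a + 1) gchoose (i + Suc (Suc n))) \<le> C' * real (i + Suc (Suc (Suc n))) powr (- (1 + a) - 1)" for i
      using C'(2)[of "i + Suc (Suc n)"] by (simp add: algebra_simps)
    have S: "summable (\<lambda>i. real (i + Suc (Suc (Suc n))) powr (- (1 + a) - 1))" 
      using pos by (intro powr_tail_le) auto
    have "norm (\<Sum>i. (a + 1) gchoose (i + Suc (Suc n))) \<le> (\<Sum>i. C' * real (i + Suc (Suc (Suc n))) powr (- (1 + a) - 1))"
      using * summable_mult[OF S] by (rule norm_suminf_le)
    also have "\<dots> = C' * (\<Sum>i. real (i + Suc (Suc (Suc n))) powr (- (1 + a) - 1))"
      by (rule suminf_mult[OF S])
    also have "\<dots> \<le> C' * real (Suc (Suc n)) powr (- (1 + a))"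
      using C' pos by (intro mult_left_mono powr_tail_le) auto
    finally have 2: "\<bar>\<Sum>i. (a + 1) gchoose (i + Suc (Suc n))\<bar> \<le> C' * real (Suc (Suc n)) powr (- 1 - a)"
      by simp
    have "2 * \<bar>t n\<bar> \<le> (C + C') * real (Suc (Suc n)) powr (- 1 - a)"
      using 1 2 C(2)[of "Suc n"] by (simp add: b_def algebra_simps)
    also have "\<dots> \<le> (C + C') * real (Suc n) powr (- 1 - a)"
      using C C' pos by (intro mult_left_mono powr_mono2') auto
    finally show ?thesis by simp
  qed
  define B where "B = fps_const (2 powr - a) * Abs_fps t"
  have "Abs_fps t \<in> lq q"
    by (rule lq_decay[OF assms(1) a, of "C + C'"]) (use C C' t_bound in auto)
  then have B: "B \<in> lq q" unfolding B_def by (intro lq_const_mult assms)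
  have "(1 - fps_X) * Abs_fps t = fps_const (2 powr a) - fps_binomial a"
  proof (rule fps_ext)
    fix n
    show "fps_nth ((1 - fps_X) * Abs_fps t) n = fps_nth (fps_const (2 powr a) - fps_binomial a) n"
    proof (cases n)
      case 0
      then show ?thesis by (simp add: algebra_simps t_0 b_def)
    next
      case (Suc k)
      then show ?thesis using t_Suc[of k] by (simp add: left_diff_distrib b_def)
    qed
  qed
  then have "(1 - fps_X) * B = fps_const (2 powr - a) * (fps_const (2 powr a) - fps_binomial a)"
    by (simp add: B_def mult.left_commute)
  also have "\<dots> = 1 - fps_const (2 powr - a) * fps_binomial a"
    by (simp add: right_diff_distrib powr_minus)
  finally have "1 - fps_const (2 powr - a) * fps_binomial a = (1 - fps_X) * B" by simp
  with B show ?thesis using that by blast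
qed

section \<open>Fractional powers of averages\<close>

lemma one_plus_powr_le:
  fixes x s :: real
  assumes "- 1 \<le> x" "0 < s" "s \<le> 1"
  shows "(1 + x) powr s \<le> 1 + s * x"
proof (cases "x = - 1")
  case False
  then have "(1 + x) powr s * 1 powr (1 - s) \<le> s * (1 + x) + (1 - s) * 1"
    using assms by (intro Youngs_inequality_0) auto
  then show ?thesis by (simp add: algebra_simps)
qed (use assms in simp)

lemma sum_powr_le:
  assumes "0 < \<beta>" "\<beta> \<le> 1"
  shows "(\<Sum>n<M. real (Suc n) powr (\<beta> - 1)) \<le> real M powr \<beta> / \<beta>"
proof (induction M)
  case (Suc M)
  let ?y = "real (Suc M)"
  have "(real M / ?y) powr \<beta> = (1 + (- 1 / ?y)) powr \<beta>" by (simp add: field_simps)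
  also have "\<dots> \<le> 1 + \<beta> * (- 1 / ?y)"
    using assms by (intro one_plus_powr_le) (auto simp: field_simps)
  finally have "real M powr \<beta> / ?y powr \<beta> \<le> 1 - \<beta> / ?y" by (simp add: powr_divide)
  then have "real M powr \<beta> \<le> (1 - \<beta> / ?y) * ?y powr \<beta>" by (simp add: pos_divide_le_eq)
  also have "\<dots> = ?y powr \<beta> - \<beta> * ?y powr (\<beta> - 1)" by (simp add: powr_diff field_simps)
  finally have "(real M powr \<beta> + \<beta> * ?y powr (\<beta> - 1)) / \<beta> \<le> ?y powr \<beta> / \<beta>"
    using assms by (intro divide_right_mono) auto
  then have "real M powr \<beta> / \<beta> + ?y powr (\<beta> - 1) \<le> ?y powr \<beta> / \<beta>"
    using assms by (simp add: add_divide_distrib)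
  with Suc show ?case by simp
qed simp

context
  fixes \<beta> :: real
  assumes \<beta>: "0 < \<beta>" "\<beta> < 1"
begin

text \<open>The coefficients of \<open>(1 - X)\<^sup>-\<^sup>\<beta>\<close> are the Cesaro numbers of order \<open>\<beta> - 1\<close>; they behave like
  \<open>n\<^sup>\<beta>\<^sup>-\<^sup>1\<close>.\<close>

definition cesaro :: "nat \<Rightarrow> real" where
  "cesaro n = fps_nth (diff_symbol (- \<beta>)) n"

definition cesaro_scaled :: "nat \<Rightarrow> real" where
  "cesaro_scaled n = cesaro n * real (Suc n) powr (1 - \<beta>)"

lemma cesaro_rec: "cesaro 0 = 1" "cesaro (Suc n) = cesaro n * (1 - (1 - \<beta>) / real (Suc n))"
proof -
  show "cesaro 0 = 1" by (simp add: cesaro_def diff_symbol_nth)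
  have *: "cesaro n = pochhammer \<beta> n / fact n" for n
    by (simp add: cesaro_def diff_symbol_nth gbinomial_pochhammer flip: power_mult_distrib)
  then show "cesaro (Suc n) = cesaro n * (1 - (1 - \<beta>) / real (Suc n))"
    unfolding * by (simp add: pochhammer_Suc field_simps)
qed

text \<open>After scaling by \<open>(n + 1)\<^sup>1\<^sup>-\<^sup>\<beta>\<close> the coefficients decrease, and the quotient of consecutive ones is
  \<open>1 + O(1/n\<^sup>2)\<close>. Summing these errors gives a rate \<open>O(1/n)\<close> for the oscillation beyond \<open>n\<close>; with the
  mere limit the sums over blocks below could not be controlled.\<close>

lemma cesaro_scaled_bounds:
  shows "0 \<le> cesaro_scaled n" "cesaro_scaled n \<le> 1" 
    and "l \<le> m \<Longrightarrow> cesaro_scaled m \<le> cesaro_scaled l" 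
    and "l \<le> m \<Longrightarrow> cesaro_scaled l - cesaro_scaled m \<le> 2 / real (Suc l)"
proof -
  define s where "s = 1 - \<beta>"
  have s: "0 < s" "s < 1" using \<beta> by (auto simp: s_def)
  have nonneg: "0 \<le> cesaro_scaled n" for n
  proof -
    have "0 \<le> cesaro n"
    proof (induction n)
      case (Suc n)
      have "s / real (Suc n) \<le> 1" using s by (simp add: field_simps)
      then show ?case using Suc by (auto simp: cesaro_rec s_def)
    qed (simp add: cesaro_rec)
    then show ?thesis by (simp add: cesaro_scaled_def)
  qed
  have step: "cesaro_scaled (Suc n) \<le> cesaro_scaled n" 
    "cesaro_scaled n - cesaro_scaled (Suc n) \<le> cesaro_scaled n * (s / (real (Suc n))\<^sup>2)" for n
  proof -
    define x where "x = 1 / real (Suc n)"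
    have x: "0 < x" "x \<le> 1" by (auto simp: x_def)
    define \<rho> where "\<rho> = (1 - s * x) * (1 + x) powr s"
    have "real (Suc (Suc n)) = real (Suc n) * (1 + x)" by (simp add: x_def field_simps)
    then have "real (Suc (Suc n)) powr s = real (Suc n) powr s * (1 + x) powr s"
      using x by (simp add: powr_mult)
    then have rec: "cesaro_scaled (Suc n) = cesaro_scaled n * \<rho>"
      by (simp add: cesaro_scaled_def cesaro_rec \<rho>_def x_def s_def)
    have sx: "0 \<le> s * x" "s * x \<le> 1" using s x by (auto intro: mult_le_one)
    have "\<rho> \<le> (1 - s * x) * (1 + s * x)"
      unfolding \<rho>_def using sx s x by (intro mult_left_mono one_plus_powr_le) auto
    also have "\<dots> = 1 - (s * x)\<^sup>2" by (simp add: algebra_simps power2_eq_square)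
    also have "\<dots> \<le> 1" by simp
    finally have le: "\<rho> \<le> 1" .
    \<comment> \<open>with \<open>s = 1 - \<beta>\<close>, the lower bound comes from \<open>(1 + x)\<^sup>s = (1 + x) / (1 + x)\<^sup>\<beta>\<close> and Bernoulli for \<open>(1 + x)\<^sup>\<beta>\<close>\<close>
    have "1 - s * x\<^sup>2 \<le> 1 - s * x\<^sup>2 / (1 + \<beta> * x)"
    proof -
      have "s * x\<^sup>2 / (1 + \<beta> * x) \<le> s * x\<^sup>2 / 1"
        using s x \<beta> by (intro divide_left_mono) (auto intro: add_pos_pos)
      then show ?thesis by simp
    qed
    also have "\<dots> = (1 - s * x) * ((1 + x) / (1 + \<beta> * x))"
    proof -
      have "0 < 1 + \<beta> * x" using \<beta> x by (simp add: add_pos_pos)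
      then show ?thesis by (simp add: field_simps power2_eq_square s_def)
    qed
    also have "\<dots> \<le> (1 - s * x) * ((1 + x) / (1 + x) powr \<beta>)"
      using sx x \<beta> by (intro mult_left_mono divide_left_mono one_plus_powr_le mult_pos_pos add_pos_pos) auto
    also have "\<dots> = \<rho>" using x by (simp add: \<rho>_def s_def powr_diff)
    finally have ge: "1 - s * x\<^sup>2 \<le> \<rho>" .
    show "cesaro_scaled (Suc n) \<le> cesaro_scaled n"
      unfolding rec using nonneg[of n] le by (simp add: mult_left_le)
    have "cesaro_scaled n * (1 - s * x\<^sup>2) \<le> cesaro_scaled (Suc n)"
      unfolding rec using ge nonneg[of n] by (rule mult_left_mono)
    then show "cesaro_scaled n - cesaro_scaled (Suc n) \<le> cesaro_scaled n * (s / (real (Suc n))\<^sup>2)"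
      by (simp add: x_def algebra_simps power_divide)
  qed
  have dec: "decseq cesaro_scaled" by (rule decseq_SucI) (rule step)
  then have one: "cesaro_scaled n \<le> 1" for n
    using decseqD[OF dec, of 0 n] by (simp add: cesaro_scaled_def cesaro_rec)
  have step': "cesaro_scaled n - cesaro_scaled (Suc n) \<le> 2 / real (Suc n) - 2 / real (Suc (Suc n))" for n
  proof -
    have "cesaro_scaled n - cesaro_scaled (Suc n) \<le> cesaro_scaled n * (s / (real (Suc n))\<^sup>2)" by (rule step)
    also have "\<dots> \<le> 1 * (1 / (real (Suc n))\<^sup>2)"
      using one[of n] nonneg[of n] s by (intro mult_mono divide_right_mono) auto
    also have "\<dots> = 2 / (2 * (real (Suc n))\<^sup>2)" by simp
    also have "\<dots> \<le> 2 / (real (Suc n) * real (Suc (Suc n)))"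
    proof (rule divide_left_mono)
      show "real (Suc n) * real (Suc (Suc n)) \<le> 2 * (real (Suc n))\<^sup>2"
        by (simp add: power2_eq_square algebra_simps)
    qed auto
    also have "\<dots> = 2 / real (Suc n) - 2 / real (Suc (Suc n))" by (simp add: field_simps)
    finally show ?thesis .
  qed
  show "0 \<le> cesaro_scaled n" "cesaro_scaled n \<le> 1" by (rule nonneg one)+
  show "cesaro_scaled m \<le> cesaro_scaled l" if "l \<le> m" using dec that by (rule decseqD)
  show "cesaro_scaled l - cesaro_scaled m \<le> 2 / real (Suc l)" if "l \<le> m"
  proof -
    have "cesaro_scaled l - cesaro_scaled m \<le> 2 / real (Suc l) - 2 / real (Suc m)"
      using that
    proof (induction m rule: dec_induct)
      case (step n)
      then show ?case using step'[of n] by linarith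
    qed simp
    also have "\<dots> \<le> 2 / real (Suc l)" by simp
    finally show ?thesis .
  qed
qed

lemma cesaro_eq: "cesaro n = cesaro_scaled n * real (Suc n) powr (\<beta> - 1)"
  by (simp add: cesaro_scaled_def mult.assoc flip: powr_add)

lemma cesaro_block_difference:
  assumes "0 < M"
  defines "l n \<equiv> n div M"
  shows "\<bar>cesaro n - real M powr (\<beta> - 1) * cesaro (l n)\<bar>
    \<le> (real (Suc n) powr (\<beta> - 1) - real (M * Suc (l n)) powr (\<beta> - 1))
      + 2 * real M powr (\<beta> - 1) * real (Suc (l n)) powr (\<beta> - 2)"
proof -
  have "n < M * Suc (l n)" using assms by (simp add: l_def dividend_less_times_div)
  then have "Suc n \<le> M * Suc (l n)" by simp
  then have le: "real (M * Suc (l n)) powr (\<beta> - 1) \<le> real (Suc n) powr (\<beta> - 1)"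
    using \<beta> by (intro powr_mono2') (auto simp del: of_nat_mult of_nat_Suc)
  let ?d = "real (Suc n) powr (\<beta> - 1) - real (M * Suc (l n)) powr (\<beta> - 1)"
  let ?e = "real (M * Suc (l n)) powr (\<beta> - 1)"
  have ln: "l n \<le> n" by (simp add: l_def)
  have e: "?e = real M powr (\<beta> - 1) * real (Suc (l n)) powr (\<beta> - 1)"
    unfolding of_nat_mult by (rule powr_mult)
  have "cesaro n - real M powr (\<beta> - 1) * cesaro (l n) = cesaro_scaled n * ?d - (cesaro_scaled (l n) - cesaro_scaled n) * ?e"
    unfolding cesaro_eq[of n] cesaro_eq[of "l n"] e by (simp add: algebra_simps)
  also have "\<bar>\<dots>\<bar> \<le> cesaro_scaled n * ?d + (cesaro_scaled (l n) - cesaro_scaled n) * ?e"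
    using cesaro_scaled_bounds(1)[of n] cesaro_scaled_bounds(3)[OF ln] le
    by (intro order_trans[OF abs_triangle_ineq4]) (simp add: abs_mult)
  also have "\<dots> \<le> 1 * ?d + 2 / real (Suc (l n)) * ?e"
    using cesaro_scaled_bounds(2)[of n] cesaro_scaled_bounds(4)[OF ln] le
    by (intro add_mono mult_right_mono) auto
  also have "2 / real (Suc (l n)) * ?e = 2 * real M powr (\<beta> - 1) * real (Suc (l n)) powr (\<beta> - 2)"
  proof -
    have "real (Suc (l n)) powr (\<beta> - 2) = real (Suc (l n)) powr (\<beta> - 1) / real (Suc (l n))"
      using powr_diff[of "real (Suc (l n))" "\<beta> - 1" 1] by (simp del: of_nat_Suc)
    then show ?thesis unfolding e by simp
  qed
  finally show ?thesis by simp
qed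

text \<open>Inside a block \<open>M l \<le> n < M (l + 1)\<close> the coefficient \<open>cesaro n\<close> is replaced by the constant
  \<open>M\<^sup>\<beta>\<^sup>-\<^sup>1 cesaro l\<close>. The errors of the power \<open>n\<^sup>\<beta>\<^sup>-\<^sup>1\<close> telescope over the blocks and those of the
  scaled coefficients sum to a multiple of \<open>\<Sum> (l + 1)\<^sup>\<beta>\<^sup>-\<^sup>2\<close>; both totals are \<open>O(M\<^sup>\<beta>)\<close>.\<close>

lemma cesaro_block_difference_sum:
  obtains C where "\<And>M. 0 < M \<Longrightarrow> summable (\<lambda>n. \<bar>cesaro n - real M powr (\<beta> - 1) * cesaro (n div M)\<bar>)
    \<and> (\<Sum>n. \<bar>cesaro n - real M powr (\<beta> - 1) * cesaro (n div M)\<bar>) \<le> C * real M powr \<beta>"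
proof -
  let ?z = "\<lambda>L. \<Sum>l<L. real (Suc l) powr (\<beta> - 2)"
  have "summable (\<lambda>n. real n powr (\<beta> - 2))" using \<beta> by (simp add: summable_real_powr_iff)
  then have sz: "summable (\<lambda>n. real (Suc n) powr (\<beta> - 2))" by (subst summable_Suc_iff)
  define Z where "Z = (\<Sum>n. real (Suc n) powr (\<beta> - 2))"
  have Z: "?z L \<le> Z" for L unfolding Z_def by (rule sum_le_suminf[OF sz]) auto
  define C where "C = 1 / \<beta> + 1 + 2 * Z"
  show ?thesis
  proof (rule that[of C])
    fix M :: nat assume M: "0 < M"
    let ?R = "\<lambda>n. \<bar>cesaro n - real M powr (\<beta> - 1) * cesaro (n div M)\<bar>"
    let ?B = "real M powr \<beta>"
    have MB: "real M * real M powr (\<beta> - 1) = ?B" using M by (simp add: powr_diff)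
    have part: "sum ?R {..<M * Suc L} \<le> ?B * (1 / \<beta> + 1 - real (Suc L) powr (\<beta> - 1)) + 2 * ?B * ?z (Suc L)" for L
    proof (induction L)
      case 0
      have "sum ?R {..<M} \<le> (\<Sum>n<M. real (Suc n) powr (\<beta> - 1) + real M powr (\<beta> - 1))"
      proof (rule sum_mono)
        fix n assume "n \<in> {..<M}"
        then have div: "n div M = 0" by simp
        show "?R n \<le> real (Suc n) powr (\<beta> - 1) + real M powr (\<beta> - 1)"
          using cesaro_block_difference[OF M, of n] unfolding div by simp
      qed
      also have "\<dots> = (\<Sum>n<M. real (Suc n) powr (\<beta> - 1)) + ?B"
        by (simp add: sum.distrib MB)
      also have "\<dots> \<le> ?B / \<beta> + ?B" using sum_powr_le[of \<beta> M] \<beta> by simp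
      also have "\<dots> \<le> ?B * (1 / \<beta> + 1 - 1) + 2 * ?B" by simp
      finally show ?case by simp
    next
      case (Suc L)
      let ?b = "(real (M * Suc L) powr (\<beta> - 1) - real (M * Suc (Suc L)) powr (\<beta> - 1))
          + 2 * real M powr (\<beta> - 1) * real (Suc (Suc L)) powr (\<beta> - 2)"
      have b: "?R n \<le> ?b" if "n \<in> {M * Suc L..<M * Suc (Suc L)}" for n
      proof -
        have div: "n div M = Suc L"
          using that by (intro div_nat_eqI) (auto simp: mult.commute)
        have "real (Suc n) powr (\<beta> - 1) \<le> real (M * Suc L) powr (\<beta> - 1)"
          using that \<beta> M by (intro powr_mono2') (auto simp del: of_nat_mult of_nat_Suc mult_Suc_right)
        then show ?thesis using cesaro_block_difference[OF M, of n] unfolding div by linarith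
      qed
      have "sum ?R {..<M * Suc (Suc L)} = sum ?R {..<M * Suc L} + sum ?R {M * Suc L..<M * Suc (Suc L)}"
        unfolding lessThan_atLeast0 by (rule sum.atLeastLessThan_concat[symmetric]) auto
      also have "sum ?R {M * Suc L..<M * Suc (Suc L)} \<le> real (card {M * Suc L..<M * Suc (Suc L)}) * ?b"
        using b by (rule sum_bounded_above)
      also have "card {M * Suc L..<M * Suc (Suc L)} = M" by simp
      also have "real M * ?b = ?B * (real (Suc L) powr (\<beta> - 1) - real (Suc (Suc L)) powr (\<beta> - 1))
           + 2 * ?B * real (Suc (Suc L)) powr (\<beta> - 2)"
        unfolding of_nat_mult MB[symmetric] by (subst (1 2) powr_mult) (auto simp: algebra_simps)
      finally show ?case using Suc by (simp add: algebra_simps)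
    qed
    have "sum ?R {..<n} \<le> C * ?B" for n
    proof -
      have "n \<le> M * Suc n" using M mult_le_mono[of 1 M n "Suc n"] by simp
      then have "sum ?R {..<n} \<le> sum ?R {..<M * Suc n}" by (intro sum_mono2) auto
      also have "\<dots> \<le> ?B * (1 / \<beta> + 1 - real (Suc n) powr (\<beta> - 1)) + 2 * ?B * ?z (Suc n)" by (rule part)
      also have "\<dots> \<le> ?B * (1 / \<beta> + 1) + 2 * ?B * Z"
        by (intro add_mono mult_left_mono Z) auto
      also have "\<dots> = C * ?B" by (simp add: C_def algebra_simps)
      finally show ?thesis .
    qed
    then have "summable ?R" "suminf ?R \<le> C * ?B"
      by (auto intro!: summableI_nonneg_bounded suminf_le_const)
    then show "summable ?R \<and> suminf ?R \<le> C * ?B" ..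
  qed
qed

end

lemma fps_nth_geometric_mult_stretch:
  assumes "0 < M"
  shows "fps_nth ((\<Sum>i<M. fps_X ^ i) * stretch M a) n = (fps_nth a (n div M) :: real)"
proof -
  have g: "fps_nth (\<Sum>i<M. fps_X ^ i :: real fps) i = (if i < M then 1 else 0)" for i
    by (simp add: fps_sum_nth)
  have "fps_nth ((\<Sum>i<M. fps_X ^ i) * stretch M a) n
      = (\<Sum>i\<in>{0..n}. (if i < M then 1 else 0) * (if M dvd n - i then fps_nth a ((n - i) div M) else 0))"
    by (simp add: fps_mult_nth g stretch_nth assms)
  also have "\<dots> = (\<Sum>i\<in>{n mod M}. fps_nth a (n div M))"
  proof (rule sum.mono_neutral_cong_right)
    show "\<forall>i\<in>{0..n} - {n mod M}. (if i < M then 1 else 0) * (if M dvd n - i then fps_nth a ((n - i) div M) else 0) = 0"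
    proof
      fix i assume i: "i \<in> {0..n} - {n mod M}"
      have "i = n mod M" if "i < M" "M dvd n - i"
        using that i by (metis DiffD1 atLeastAtMost_iff mod_eq_dvd_iff_nat mod_less)
      with i show "(if i < M then 1 else 0) * (if M dvd n - i then fps_nth a ((n - i) div M) else 0) = 0" by auto
    qed
  qed (use assms in \<open>auto simp: minus_mod_eq_mult_div\<close>)
  finally show ?thesis by simp
qed

text \<open>The fractional power of the averaging series \<open>(1 + X + \<dots> + X\<^sup>M\<^sup>-\<^sup>1) / M\<close> is bounded in
  \<open>\<ell>\<^sub>1\<close> uniformly in \<open>M\<close>. In general its coefficients change sign, so the bound cannot be
  read off from the value at \<open>X = 1\<close>. If \<open>(1 - X)\<^sup>-\<^sup>\<beta>\<close> is replaced by
  the series that is constant on blocks of length \<open>M\<close>, that is by a multiple of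
  \<open>(1 + \<dots> + X\<^sup>M\<^sup>-\<^sup>1) (1 - X\<^sup>M)\<^sup>-\<^sup>\<beta>\<close>, the factor \<open>(1 - X\<^sup>M)\<^sup>\<beta>\<close> cancels exactly;
  the error of the replacement is the previous estimate.\<close>

lemma fractional_average_bounded:
  assumes "0 \<le> \<beta>" "\<beta> < 1"
  obtains C where "0 < C" "\<And>M. 0 < M \<Longrightarrow> diff_symbol (- \<beta>) * stretch M (diff_symbol \<beta>) \<in> lq 1"
    "\<And>M. 0 < M \<Longrightarrow> qsum 1 (diff_symbol (- \<beta>) * stretch M (diff_symbol \<beta>)) \<le> C * real M powr \<beta>"
proof (cases "\<beta> = 0")
  case True
  have "qsum 1 1 \<le> 1" using lq_finite_support(2)[of 1 1 1] by simp
  then show ?thesis using that[of 1] True by simp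
next
  case False
  then have \<beta>: "0 < \<beta>" "\<beta> < 1" using assms by auto
  note one = zero_less_one[where 'a = real] order_refl[of "1::real"]
  obtain C where C: "\<And>M. 0 < M \<Longrightarrow> summable (\<lambda>n. \<bar>cesaro \<beta> n - real M powr (\<beta> - 1) * cesaro \<beta> (n div M)\<bar>)
    \<and> (\<Sum>n. \<bar>cesaro \<beta> n - real M powr (\<beta> - 1) * cesaro \<beta> (n div M)\<bar>) \<le> C * real M powr \<beta>"
    by (rule cesaro_block_difference_sum[OF \<beta>]) blast
  have bl: "diff_symbol \<beta> \<in> lq 1" using \<beta> by (intro diff_symbol_lq) (auto simp: admissible_def)
  have main: "diff_symbol (- \<beta>) * stretch M (diff_symbol \<beta>) \<in> lq 1 \<and>
     qsum 1 (diff_symbol (- \<beta>) * stretch M (diff_symbol \<beta>)) \<le> (1 + C * qsum 1 (diff_symbol \<beta>)) * real M powr \<beta>" if M: "0 < M" for M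
  proof -
    let ?k = "real M powr (\<beta> - 1)" and ?g = "\<Sum>i<M. fps_X ^ i :: real fps"
    define R where "R = diff_symbol (- \<beta>) - fps_const ?k * (?g * stretch M (diff_symbol (- \<beta>)))"
    have Rn: "fps_nth R n = cesaro \<beta> n - ?k * cesaro \<beta> (n div M)" for n
      by (simp add: R_def fps_nth_geometric_mult_stretch[OF M] cesaro_def[OF \<beta>])
    have R: "R \<in> lq 1" "qsum 1 R \<le> C * real M powr \<beta>"
      using C[OF M] by (simp_all add: lq_def qsum_def Rn)
    have gn: "fps_nth ?g i = (if i < M then 1 else 0)" for i
      by (simp add: fps_sum_nth)
    have g: "?g \<in> lq 1" "qsum 1 ?g = real M"
      using lq_finite_support[OF one, of M ?g] by (simp_all add: gn)
    have sb: "stretch M (diff_symbol \<beta>) \<in> lq 1" "qsum 1 (stretch M (diff_symbol \<beta>)) = qsum 1 (diff_symbol \<beta>)"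
      using lq_stretch[OF M bl] by auto
    have "stretch M (diff_symbol (- \<beta>)) * stretch M (diff_symbol \<beta>) = 1"
      by (simp add: diff_symbol_minus M flip: stretch_mult)
    then have "fps_const ?k * (?g * stretch M (diff_symbol (- \<beta>))) * stretch M (diff_symbol \<beta>) = fps_const ?k * ?g"
      by (simp add: mult.assoc)
    then have eq: "diff_symbol (- \<beta>) * stretch M (diff_symbol \<beta>) = fps_const ?k * ?g + R * stretch M (diff_symbol \<beta>)"
      by (simp add: R_def algebra_simps)
    have 1: "fps_const ?k * ?g \<in> lq 1" "qsum 1 (fps_const ?k * ?g) = real M powr \<beta>"
      using lq_const_mult[OF one g(1), of ?k] g M by (auto simp: powr_diff)
    have 2: "R * stretch M (diff_symbol \<beta>) \<in> lq 1" "qsum 1 (R * stretch M (diff_symbol \<beta>)) \<le> qsum 1 R * qsum 1 (diff_symbol \<beta>)"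
      using lq_mult[OF one R(1) sb(1)] sb(2) by auto
    note 2(2)
    also have "qsum 1 R * qsum 1 (diff_symbol \<beta>) \<le> C * real M powr \<beta> * qsum 1 (diff_symbol \<beta>)"
      using R qsum_nonneg[OF bl] by (intro mult_right_mono)
    finally have "qsum 1 (diff_symbol (- \<beta>) * stretch M (diff_symbol \<beta>)) \<le> (1 + C * qsum 1 (diff_symbol \<beta>)) * real M powr \<beta>"
      using lq_add(2)[OF one 1(1) 2(1)] 1 unfolding eq by (simp add: algebra_simps)
    then show ?thesis using lq_add(1)[OF one 1(1) 2(1)] unfolding eq by simp
  qed
  let ?C = "1 + \<bar>C * qsum 1 (diff_symbol \<beta>)\<bar>"
  have "(1 + C * qsum 1 (diff_symbol \<beta>)) * real M powr \<beta> \<le> ?C * real M powr \<beta>" for M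
    by (intro mult_right_mono) auto
  with main have "diff_symbol (- \<beta>) * stretch M (diff_symbol \<beta>) \<in> lq 1 \<and>
     qsum 1 (diff_symbol (- \<beta>) * stretch M (diff_symbol \<beta>)) \<le> ?C * real M powr \<beta>" if "0 < M" for M
    using that order_trans by blast
  then show ?thesis by (intro that[of ?C]) auto
qed

section \<open>The discrete Marchaud inequality for functionals on power series\<close>

text \<open>The properties of \<open>N a = \<parallel>a(T) f\<parallel>\<^sub>p\<close> that the argument uses, where \<open>(T f) x = f (x - h)\<close>. Besides finite
  sums they involve only a crude bound by \<open>qsum\<close>, so no double series of functions ever has to be rearranged.\<close>

locale shift_functional =
  fixes q :: real and N :: "real fps \<Rightarrow> real"
  assumes q: "0 < q" "q \<le> 1"
    and nonneg: "0 \<le> N a"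
    and subadditive: "a \<in> lq q \<Longrightarrow> b \<in> lq q \<Longrightarrow> N (a + b) powr q \<le> N a powr q + N b powr q"
    and homogeneous: "a \<in> lq q \<Longrightarrow> N (fps_const c * a) = \<bar>c\<bar> * N a"
    and shift_invariant: "a \<in> lq q \<Longrightarrow> N (fps_X * a) = N a"
    and bounded: "a \<in> lq q \<Longrightarrow> N a powr q \<le> qsum q a * N 1 powr q"
begin

lemma shift_power_invariant: "a \<in> lq q \<Longrightarrow> N (fps_X ^ n * a) = N a"
proof (induction n)
  case (Suc n)
  then have "fps_X ^ n * a \<in> lq q" by (intro lq_mult lq_simple q)
  then show ?case using Suc shift_invariant[of "fps_X ^ n * a"] by (simp add: mult.assoc)
qed simp

lemma zero: "N 0 = 0"
  using homogeneous[of 0 0] lq_simple[OF q] by simp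

lemma mult_cutoff_bound:
  assumes a: "a \<in> lq q"
  shows "N (fps_cutoff M b * a) powr q \<le> (\<Sum>n<M. \<bar>fps_nth b n\<bar> powr q) * N a powr q"
proof (induction M)
  case 0
  then show ?case by (simp add: zero)
next
  case (Suc M)
  have c: "fps_cutoff M b \<in> lq q" by (rule lq_finite_support(1)[OF q, of M]) simp
  have eq: "fps_cutoff (Suc M) b = fps_cutoff M b + fps_const (fps_nth b M) * fps_X ^ M"
    by (auto simp: fps_eq_iff less_Suc_eq)
  have X: "fps_X ^ M * a \<in> lq q" by (intro lq_mult lq_simple q a)
  have "N (fps_cutoff (Suc M) b * a) powr q
      = N (fps_cutoff M b * a + fps_const (fps_nth b M) * (fps_X ^ M * a)) powr q"
    unfolding eq by (simp add: algebra_simps)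
  also have "\<dots> \<le> N (fps_cutoff M b * a) powr q + N (fps_const (fps_nth b M) * (fps_X ^ M * a)) powr q"
    by (intro subadditive lq_mult lq_const_mult lq_simple q a c)
  also have "N (fps_const (fps_nth b M) * (fps_X ^ M * a)) powr q = \<bar>fps_nth b M\<bar> powr q * N a powr q"
    using homogeneous[OF X] by (simp add: shift_power_invariant a powr_mult nonneg)
  finally show ?case using Suc by (simp add: algebra_simps)
qed

text \<open>For a polynomial \<open>b\<close> this is the triangle inequality. The remainder of a general \<open>b\<close> is
  controlled by the crude bound, applied to a product with small \<open>qsum\<close>.\<close>

lemma mult_bound:
  assumes a: "a \<in> lq q" and b: "b \<in> lq q"
  shows "N (b * a) powr q \<le> qsum q b * N a powr q"
proof -
  have sb: "summable (\<lambda>n. \<bar>fps_nth b n\<bar> powr q)" using b by (rule lq_summable)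
  have le: "N (b * a) powr q \<le> qsum q b * N a powr q + qsum q (b - fps_cutoff M b) * (qsum q a * N 1 powr q)" for M
  proof -
    have c: "fps_cutoff M b \<in> lq q" by (rule lq_finite_support(1)[OF q, of M]) simp
    have d: "b - fps_cutoff M b \<in> lq q" by (rule lq_diff[OF q b c])
    have "N (b * a) powr q = N (fps_cutoff M b * a + (b - fps_cutoff M b) * a) powr q"
      by (simp add: algebra_simps)
    also have "\<dots> \<le> N (fps_cutoff M b * a) powr q + N ((b - fps_cutoff M b) * a) powr q"
      by (intro subadditive lq_mult q a c d)
    also have "N (fps_cutoff M b * a) powr q \<le> (\<Sum>n<M. \<bar>fps_nth b n\<bar> powr q) * N a powr q"
      by (rule mult_cutoff_bound[OF a])
    also have "\<dots> \<le> qsum q b * N a powr q"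
      unfolding qsum_def by (intro mult_right_mono sum_le_suminf[OF sb]) auto
    also have "N ((b - fps_cutoff M b) * a) powr q \<le> qsum q ((b - fps_cutoff M b) * a) * N 1 powr q"
      by (intro bounded lq_mult q a d)
    also have "\<dots> \<le> (qsum q (b - fps_cutoff M b) * qsum q a) * N 1 powr q"
      by (intro mult_right_mono lq_mult q a d) auto
    finally show ?thesis by (simp add: mult.assoc)
  qed
  have "(\<lambda>M. qsum q b * N a powr q + qsum q (b - fps_cutoff M b) * (qsum q a * N 1 powr q))
     \<longlonglongrightarrow> qsum q b * N a powr q + 0 * (qsum q a * N 1 powr q)"
    by (intro tendsto_intros lq_tail[OF q b])
  then show ?thesis using le by (auto intro: LIMSEQ_le_const)
qed

lemma shift_functional_stretch: "0 < m \<Longrightarrow> shift_functional q (\<lambda>a. N (stretch m a))"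
proof
  fix a b c assume m: "0 < m" and a: "a \<in> lq q"
  note sa = lq_stretch[OF m a]
  show "N (stretch m (fps_const c * a)) = \<bar>c\<bar> * N (stretch m a)"
    using homogeneous[OF sa(1)] by (simp add: stretch_mult m)
  show "N (stretch m (fps_X * a)) = N (stretch m a)"
    using shift_power_invariant[OF sa(1)] by (simp add: stretch_mult m)
  show "N (stretch m a) powr q \<le> qsum q a * N (stretch m 1) powr q"
    using bounded[OF sa(1)] sa(2) by simp
  assume "b \<in> lq q"
  then show "N (stretch m (a + b)) powr q \<le> N (stretch m a) powr q + N (stretch m b) powr q"
    using subadditive[OF sa(1) lq_stretch(1)[OF m]] by (simp add: stretch_add)
qed (use q nonneg in auto)

end

text \<open>The two situations in which the exponent \<open>\<theta>\<close> is available: either the \<open>\<theta>\<close>-th power is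
  subadditive, or \<open>N\<close> is a seminorm that inherits from \<open>L\<^sub>p\<close> uniform smoothness of power type \<open>\<theta>\<close>.\<close>

locale marchaud_functional = shift_functional +
  fixes \<theta> K :: real
  assumes q_le_\<theta>: "q \<le> \<theta>" and K: "0 \<le> K"
    and smooth: "\<theta> = q \<or> q = 1 \<and> (\<forall>a\<in>lq 1. \<forall>b\<in>lq 1.
      N (a + b) powr \<theta> + N (a - b) powr \<theta> \<le> 2 * N a powr \<theta> + 2 * K * N b powr \<theta>)"
begin

lemma \<theta>_pos: "0 < \<theta>"
  using q_le_\<theta> q by linarith

lemma marchaud_functional_stretch: "0 < m \<Longrightarrow> marchaud_functional q (\<lambda>a. N (stretch m a)) \<theta> K"
proof (intro marchaud_functional.intro shift_functional_stretch, assumption)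
  assume m: "0 < m"
  have "stretch m (a - b) = stretch m a - stretch m b" for a b :: "real fps"
    unfolding stretch_def by (rule fps_compose_sub_distrib)
  then show "marchaud_functional_axioms q (\<lambda>a. N (stretch m a)) \<theta> K"
    using q_le_\<theta> K smooth by unfold_locales (auto simp: stretch_add intro!: lq_stretch(1)[OF m])
qed

lemma mult_bound_\<theta>:
  assumes a: "a \<in> lq q" and b: "b \<in> lq q"
  shows "N (b * a) powr \<theta> \<le> qsum q b powr (\<theta> / q) * N a powr \<theta>"
proof -
  have "N (b * a) powr \<theta> = (N (b * a) powr q) powr (\<theta> / q)"
    using q by (simp add: powr_powr)
  also have "\<dots> \<le> (qsum q b * N a powr q) powr (\<theta> / q)"
    using mult_bound[OF a b] q \<theta>_pos by (intro powr_mono2) auto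
  also have "\<dots> = qsum q b powr (\<theta> / q) * N a powr \<theta>"
    using q qsum_nonneg[OF b] by (simp add: powr_mult powr_powr)
  finally show ?thesis .
qed

end

text \<open>For \<open>N a = \<parallel>a(T) f\<parallel>\<^sub>p\<close>, with \<open>(T f) x = f (x - h)\<close>, this is the \<open>\<theta>\<close>-th power of the norm of
  the difference of order \<open>a\<close> with step \<open>2\<^sup>j h\<close>.\<close>

definition dyad :: "(real fps \<Rightarrow> real) \<Rightarrow> real \<Rightarrow> real \<Rightarrow> nat \<Rightarrow> real" where
  "dyad N \<theta> a j = N (stretch (2 ^ j) (diff_symbol a)) powr \<theta>"

lemma dyad_nonneg [simp]: "0 \<le> dyad N \<theta> a j"
  by (simp add: dyad_def)

lemma dyad_stretch: "dyad (\<lambda>b. N (stretch (2 ^ i) b)) \<theta> a j = dyad N \<theta> a (i + j)"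
  by (simp add: dyad_def stretch_stretch power_add)

lemma (in marchaud_functional) dyad_bound:
  assumes "admissible q a"
  shows "dyad N \<theta> a j \<le> qsum q (diff_symbol a) powr (\<theta> / q) * N 1 powr \<theta>"
proof -
  have b: "diff_symbol a \<in> lq q" by (rule diff_symbol_lq[OF q assms])
  have p: "0 < (2::nat) ^ j" by simp
  show ?thesis
    using mult_bound_\<theta>[of 1 "stretch (2 ^ j) (diff_symbol a)"] lq_stretch[OF p b] lq_simple[OF q]
    by (simp add: dyad_def)
qed

text \<open>The discrete Marchaud inequality from order \<open>b\<close> to order \<open>a\<close>, with a constant that is uniform
  in the functional. Uniformity allows it to be applied to the stretched functionals, that is to larger
  steps.\<close>

definition marchaud_bound :: "real \<Rightarrow> real \<Rightarrow> real \<Rightarrow> real \<Rightarrow> real \<Rightarrow> bool" where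
  "marchaud_bound q \<theta> K a b \<longleftrightarrow> (\<exists>C\<ge>0. \<forall>N. marchaud_functional q N \<theta> K \<longrightarrow> (\<forall>k.
     dyad N \<theta> a 0 \<le> C * ((2 powr (- a * \<theta>)) ^ k * N 1 powr \<theta>
       + (\<Sum>j<k. (2 powr (- a * \<theta>)) ^ j * dyad N \<theta> b j))))"

lemma telescope_dyadic:
  fixes v w :: "nat \<Rightarrow> real"
  assumes "\<And>j. v j \<le> x * v (Suc j) + w j" "0 \<le> x"
  shows "v 0 \<le> x ^ k * v k + (\<Sum>j<k. x ^ j * w j)"
proof (induction k)
  case (Suc k)
  have "x ^ k * v k \<le> x ^ k * (x * v (Suc k) + w k)"
    using assms by (intro mult_left_mono) auto
  with Suc show ?case by (simp add: algebra_simps)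
qed simp

text \<open>From \<open>(1 - X)\<^sup>a = 2\<^sup>-\<^sup>a (1 - X\<^sup>2)\<^sup>a + B (1 - X)\<^sup>a\<^sup>+\<^sup>1\<close> with \<open>B\<close> in \<open>lq q\<close>. If the \<open>q\<close>-th power
  is subadditive, the weight of the first term is exactly \<open>2\<^sup>-\<^sup>a\<^sup>q\<close>, and the inequality can be iterated
  without loss.\<close>

lemma marchaud_bound_subadditive:
  assumes q: "0 < q" "q \<le> 1" and a: "admissible q a"
  shows "marchaud_bound q q K a (a + 1)"
proof -
  obtain B where B: "B \<in> lq q" "1 - fps_const (2 powr - a) * fps_binomial a = (1 - fps_X) * B"
    by (rule half_sum_power_factor[OF q a]) blast
  have id: "diff_symbol a = fps_const (2 powr - a) * stretch 2 (diff_symbol a) + B * diff_symbol (a + 1)"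
  proof -
    have "B * diff_symbol (a + 1) = ((1 - fps_X) * B) * diff_symbol a" by (simp add: diff_symbol_add diff_symbol_1)
    also have "\<dots> = diff_symbol a - fps_const (2 powr - a) * (diff_symbol a * fps_binomial a)"
      unfolding B(2)[symmetric] by (simp add: algebra_simps)
    finally show ?thesis by (simp add: diff_symbol_mult_fps_binomial)
  qed
  let ?x = "2 powr (- a * q)" and ?C = "max (qsum q B) (qsum q (diff_symbol a))"
  have "dyad N q a 0 \<le> ?C * (?x ^ k * N 1 powr q + (\<Sum>j<k. ?x ^ j * dyad N q (a + 1) j))"
    if "marchaud_functional q N q K" for N k
  proof -
    interpret marchaud_functional q N q K by fact
    have step: "dyad N q a j \<le> ?x * dyad N q a (Suc j) + qsum q B * dyad N q (a + 1) j" for j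
    proof -
      have m: "0 < (2::nat) ^ j" "0 < (2::nat) ^ Suc j" "0 < (2::nat)" by simp_all
      have b: "diff_symbol a \<in> lq q" "diff_symbol (a + 1) \<in> lq q"
        using a admissible_add_one[OF a] by (auto intro: diff_symbol_lq q)
      let ?s = "stretch (2 ^ j)"
      have sb: "?s (diff_symbol (a + 1)) \<in> lq q" "?s B \<in> lq q" "qsum q (?s B) = qsum q B" 
          "stretch (2 ^ Suc j) (diff_symbol a) \<in> lq q"
        using b B lq_stretch m by blast+
      have "?s (diff_symbol a) = fps_const (2 powr - a) * stretch (2 ^ Suc j) (diff_symbol a) + ?s B * ?s (diff_symbol (a + 1))"
        by (subst id) (simp add: stretch_add stretch_mult m stretch_stretch mult.commute)
      then have "dyad N q a j \<le> N (fps_const (2 powr - a) * stretch (2 ^ Suc j) (diff_symbol a)) powr q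
          + N (?s B * ?s (diff_symbol (a + 1))) powr q"
        unfolding dyad_def by (simp only:) (intro subadditive lq_mult lq_const_mult q sb)
      also have "N (fps_const (2 powr - a) * stretch (2 ^ Suc j) (diff_symbol a)) powr q = ?x * dyad N q a (Suc j)"
        unfolding homogeneous[OF sb(4)] dyad_def by (simp add: powr_mult nonneg powr_powr)
      also have "N (?s B * ?s (diff_symbol (a + 1))) powr q \<le> qsum q B * dyad N q (a + 1) j"
        using mult_bound[OF sb(1,2)] sb(3) by (simp add: dyad_def)
      finally show ?thesis by simp
    qed
    have "dyad N q a 0 \<le> ?x ^ k * dyad N q a k + (\<Sum>j<k. ?x ^ j * (qsum q B * dyad N q (a + 1) j))"
      by (rule telescope_dyadic[where v = "dyad N q a" and w = "\<lambda>j. qsum q B * dyad N q (a + 1) j", OF step]) simp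
    also have "\<dots> \<le> ?x ^ k * (?C * N 1 powr q) + (\<Sum>j<k. ?x ^ j * (?C * dyad N q (a + 1) j))"
    proof (intro add_mono mult_left_mono sum_mono)
      have "dyad N q a k \<le> qsum q (diff_symbol a) * N 1 powr q"
        using dyad_bound[OF a, of k] q qsum_nonneg[OF diff_symbol_lq[OF q a]] by simp
      also have "\<dots> \<le> ?C * N 1 powr q" by (intro mult_right_mono) auto
      finally show "dyad N q a k \<le> ?C * N 1 powr q" .
    qed (auto intro!: mult_right_mono)
    also have "\<dots> = ?C * (?x ^ k * N 1 powr q + (\<Sum>j<k. ?x ^ j * dyad N q (a + 1) j))"
      by (simp add: sum_distrib_left algebra_simps)
    finally show ?thesis .
  qed
  moreover have "0 \<le> ?C" using qsum_nonneg[OF B(1)] by simp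
  ultimately show ?thesis unfolding marchaud_bound_def by blast
qed

definition avg :: "nat \<Rightarrow> real fps" where
  "avg m = fps_const (1 / 2) * (1 + fps_X ^ m)"

lemma one_in_unit: "0 < (1::real)" "(1::real) \<le> 1" by auto

lemma avg_lq: "avg m \<in> lq 1"
  unfolding avg_def by (intro lq_const_mult lq_add lq_simple one_in_unit)

lemma halves: "fps_const (1 / 2) + fps_const (1 / 2) = (1 :: real fps)"
  by simp

context marchaud_functional
begin

context
  assumes q1: "q = 1"
    and smooth1: "\<forall>a\<in>lq 1. \<forall>b\<in>lq 1.
      N (a + b) powr \<theta> + N (a - b) powr \<theta> \<le> 2 * N a powr \<theta> + 2 * K * N b powr \<theta>"
begin

lemma triangle: "a \<in> lq 1 \<Longrightarrow> b \<in> lq 1 \<Longrightarrow> N (a + b) \<le> N a + N b"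
  using subadditive[of a b] q1 nonneg by simp

lemma avg_contraction:
  assumes "u \<in> lq 1"
  shows "N (avg m * u) \<le> N u"
proof -
  have X: "fps_X ^ m * u \<in> lq 1" by (intro lq_mult lq_simple one_in_unit assms)
  have "avg m * u = fps_const (1 / 2) * u + fps_const (1 / 2) * (fps_X ^ m * u)"
    by (simp add: avg_def algebra_simps)
  then have "N (avg m * u) \<le> N (fps_const (1 / 2) * u) + N (fps_const (1 / 2) * (fps_X ^ m * u))"
    by (simp only:) (intro triangle lq_const_mult one_in_unit assms X)
  also have "\<dots> = N u"
    using homogeneous[of u "1/2"] homogeneous[of "fps_X ^ m * u" "1/2"] shift_power_invariant[of u m] assms X q1 by simp
  finally show ?thesis .
qed

text \<open>With \<open>x = (1 + X\<^sup>m) u / 2\<close> and \<open>y = (1 - X\<^sup>m) u / 2\<close> both \<open>x + y = u\<close> and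
  \<open>x - y = X\<^sup>m u\<close> have the same size. Hence the smoothness inequality bounds \<open>u\<close> itself, with the constant
  one in front of the average \<open>x\<close>; the step can therefore be iterated over all scales although \<open>\<theta> > 1\<close>.\<close>

lemma avg_step:
  assumes u: "u \<in> lq 1"
  shows "N u powr \<theta> \<le> N (avg m * u) powr \<theta> + K * N ((1 - fps_X ^ m) * u) powr \<theta>"
proof -
  let ?y = "fps_const (1 / 2) * ((1 - fps_X ^ m) * u)"
  have d: "(1 - fps_X ^ m) * u \<in> lq 1"
    using assms by (intro lq_mult lq_diff lq_simple one_in_unit)
  have y: "?y \<in> lq 1" by (rule lq_const_mult(1)[OF one_in_unit d])
  have x: "avg m * u \<in> lq 1" by (rule lq_mult(1)[OF one_in_unit avg_lq assms])
  have "avg m * u + ?y = (fps_const (1 / 2) + fps_const (1 / 2)) * u"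
    unfolding avg_def by algebra
  moreover have "avg m * u - ?y = (fps_const (1 / 2) + fps_const (1 / 2)) * (fps_X ^ m * u)"
    unfolding avg_def by algebra
  ultimately have e: "avg m * u + ?y = u" "avg m * u - ?y = fps_X ^ m * u"
    unfolding halves by simp_all
  have "2 * N u powr \<theta> \<le> 2 * N (avg m * u) powr \<theta> + 2 * K * N ?y powr \<theta>"
    using smooth1[rule_format, OF x y] shift_power_invariant[of u m] u q1 unfolding e by simp
  also have "N ?y powr \<theta> \<le> N ((1 - fps_X ^ m) * u) powr \<theta>"
    using homogeneous[of "(1 - fps_X ^ m) * u" "1/2"] d q1 nonneg[of ?y] \<theta>_pos
    by (intro powr_mono2) (simp, simp, simp)
  finally show ?thesis using K by (simp add: mult_left_mono)
qed

lemma avg_power_step: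
  assumes u: "u \<in> lq 1"
  shows "N u powr \<theta> \<le> N (avg m ^ n * u) powr \<theta> + real n * K * N ((1 - fps_X ^ m) * u) powr \<theta>"
proof -
  have l: "avg m ^ n * u \<in> lq 1" for n
  proof (induction n)
    case (Suc n)
    then show ?case using lq_mult(1)[OF one_in_unit avg_lq] by (simp add: mult.assoc)
  qed (simp add: u)
  have d: "1 - fps_X ^ m \<in> lq 1" by (intro lq_diff lq_simple one_in_unit)
  have c: "N ((1 - fps_X ^ m) * (avg m ^ n * u)) \<le> N ((1 - fps_X ^ m) * u)" for n
  proof (induction n)
    case (Suc n)
    have "(1 - fps_X ^ m) * (avg m ^ Suc n * u) = avg m * ((1 - fps_X ^ m) * (avg m ^ n * u))"
      by (simp add: ac_simps)
    then have "N ((1 - fps_X ^ m) * (avg m ^ Suc n * u)) \<le> N ((1 - fps_X ^ m) * (avg m ^ n * u))"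
      using avg_contraction[OF lq_mult(1)[OF one_in_unit d l[of n]]] by metis
    with Suc show ?case by linarith
  qed simp
  show ?thesis
  proof (induction n)
    case (Suc n)
    have "N (avg m ^ n * u) powr \<theta> \<le> N (avg m * (avg m ^ n * u)) powr \<theta>
        + K * N ((1 - fps_X ^ m) * (avg m ^ n * u)) powr \<theta>"
      by (rule avg_step[OF l])
    also have "K * N ((1 - fps_X ^ m) * (avg m ^ n * u)) powr \<theta> \<le> K * N ((1 - fps_X ^ m) * u) powr \<theta>"
      using c[of n] K \<theta>_pos nonneg by (intro mult_left_mono powr_mono2) auto
    finally show ?case using Suc by (simp add: algebra_simps)
  qed simp
qed

end

end

text \<open>For an integer \<open>a = n\<close> one applies the averaging step \<open>n\<close> times at each scale, since
  \<open>((1 + X)/2)\<^sup>n (1 - X)\<^sup>n = 2\<^sup>-\<^sup>n (1 - X\<^sup>2)\<^sup>n\<close>. For fractional \<open>a\<close> the operator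
  \<open>((1 + X)/2)\<^sup>a\<close> need not be a contraction, and the loss at each scale would be fatal. Instead
  \<open>n = \<lceil>a\<rceil>\<close> integer averages are applied at each scale; with \<open>\<beta> = n - a\<close> the result at scale \<open>m\<close> is
  \<open>m\<^sup>-\<^sup>n (1 - X\<^sup>m)\<^sup>n (1 - X)\<^sup>-\<^sup>\<beta> = m\<^sup>-\<^sup>a E\<^sub>m (1 - X\<^sup>m)\<^sup>a\<close>, where \<open>E\<^sub>m\<close> is a fractional power of an
  average, uniformly bounded in \<open>\<ell>\<^sub>1\<close>. The loss then occurs only once.\<close>

lemma marchaud_bound_smooth:
  assumes a: "0 < a" and \<theta>: "\<theta> \<noteq> 1"
  shows "marchaud_bound 1 \<theta> K a (a + 1)"
proof -
  note one = zero_less_one[where 'a = real] order_refl[of "1::real"]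
  define n where "n = nat \<lceil>a\<rceil>"
  define \<beta> where "\<beta> = real n - a"
  have \<beta>: "0 \<le> \<beta>" "\<beta> < 1" unfolding \<beta>_def n_def using a by linarith+
  obtain M where M: "0 < M" "\<And>m. 0 < m \<Longrightarrow> diff_symbol (- \<beta>) * stretch m (diff_symbol \<beta>) \<in> lq 1"
    "\<And>m. 0 < m \<Longrightarrow> qsum 1 (diff_symbol (- \<beta>) * stretch m (diff_symbol \<beta>)) \<le> M * real m powr \<beta>"
    by (rule fractional_average_bounded[OF \<beta>]) blast
  have adm: "admissible 1 a" "admissible 1 (a + 1)" using a by (auto simp: admissible_def)
  let ?x = "2 powr (- a * \<theta>)"
  define C where "C = M powr \<theta> * (qsum 1 (diff_symbol a) powr \<theta> + real n * \<bar>K\<bar>)"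
  have C0: "0 \<le> C" by (simp add: C_def)
  have "dyad N \<theta> a 0 \<le> C * (?x ^ k * N 1 powr \<theta> + (\<Sum>j<k. ?x ^ j * dyad N \<theta> (a + 1) j))"
    if mf: "marchaud_functional 1 N \<theta> K" for N k
  proof -
    interpret marchaud_functional 1 N \<theta> K by fact
    have sm: "\<forall>a\<in>lq 1. \<forall>b\<in>lq 1. N (a + b) powr \<theta> + N (a - b) powr \<theta> \<le> 2 * N a powr \<theta> + 2 * K * N b powr \<theta>"
      using smooth \<theta> by auto
    define U where "U m = fps_const (real m powr - real n) * (stretch m (diff_symbol (real n)) * diff_symbol (- \<beta>))" for m
    have fact_bound: "fps_const (real m powr - real n) * (stretch m (diff_symbol (real n + c)) * diff_symbol (- \<beta>)) \<in> lq 1 \<and>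
        N (fps_const (real m powr - real n) * (stretch m (diff_symbol (real n + c)) * diff_symbol (- \<beta>))) \<le> M * real m powr (- a) * N (stretch m (diff_symbol (a + c)))"
      if m: "0 < m" and ac: "admissible 1 (a + c)" for m c
    proof -
      have "diff_symbol (real n + c) = diff_symbol \<beta> * diff_symbol (a + c)" by (simp add: \<beta>_def flip: diff_symbol_add)
      then have e: "stretch m (diff_symbol (real n + c)) * diff_symbol (- \<beta>) = (diff_symbol (- \<beta>) * stretch m (diff_symbol \<beta>)) * stretch m (diff_symbol (a + c))"
        by (simp add: stretch_mult m)
      have s: "stretch m (diff_symbol (a + c)) \<in> lq 1" by (intro lq_stretch m diff_symbol_lq one ac)
      have l: "stretch m (diff_symbol (real n + c)) * diff_symbol (- \<beta>) \<in> lq 1"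
        unfolding e by (intro lq_mult one M(2) m s)
      have "N (stretch m (diff_symbol (real n + c)) * diff_symbol (- \<beta>)) \<le> qsum 1 (diff_symbol (- \<beta>) * stretch m (diff_symbol \<beta>)) * N (stretch m (diff_symbol (a + c)))"
        unfolding e using mult_bound[OF s M(2)[OF m]] nonneg by simp
      also have "\<dots> \<le> M * real m powr \<beta> * N (stretch m (diff_symbol (a + c)))"
        by (intro mult_right_mono M(3) m nonneg)
      finally have b: "N (stretch m (diff_symbol (real n + c)) * diff_symbol (- \<beta>)) \<le> M * real m powr \<beta> * N (stretch m (diff_symbol (a + c)))" .
      have "N (fps_const (real m powr - real n) * (stretch m (diff_symbol (real n + c)) * diff_symbol (- \<beta>)))
          = real m powr - real n * N (stretch m (diff_symbol (real n + c)) * diff_symbol (- \<beta>))"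
        by (subst homogeneous[OF l]) simp
      also have "\<dots> \<le> real m powr - real n * (M * real m powr \<beta> * N (stretch m (diff_symbol (a + c))))"
        by (intro mult_left_mono b) simp
      also have "\<dots> = M * (real m powr - real n * real m powr \<beta>) * N (stretch m (diff_symbol (a + c)))"
        by (simp only: ac_simps)
      also have "real m powr - real n * real m powr \<beta> = real m powr (- a)"
        by (simp add: \<beta>_def flip: powr_add)
      finally show ?thesis using lq_const_mult(1)[OF one l] by blast
    qed
    have U1: "U 1 = diff_symbol a"
      by (simp add: U_def \<beta>_def flip: diff_symbol_add)
    have U_lq: "U m \<in> lq 1" "N (U m) \<le> M * real m powr (- a) * N (stretch m (diff_symbol a))" if "0 < m" for m
      using fact_bound[OF that, of 0] adm by (auto simp: U_def)
    have dU: "N ((1 - fps_X ^ m) * U m) \<le> M * real m powr (- a) * N (stretch m (diff_symbol (a + 1)))" if m: "0 < m" for m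
    proof -
      have "(1 - fps_X ^ m) * U m = fps_const (real m powr - real n) * (stretch m (diff_symbol (real n + 1)) * diff_symbol (- \<beta>))"
        using m stretch_diff_symbol_of_nat[OF m, of 1] by (simp add: U_def diff_symbol_add stretch_mult ac_simps)
      then show ?thesis using fact_bound[OF m adm(2)] by simp
    qed
    have avgU: "avg m ^ n * U m = U (2 * m)" if m: "0 < m" for m
    proof -
      have "((1 + fps_X ^ m) * (1 - fps_X ^ m)) = (1 - fps_X ^ (2 * m) :: real fps)"
        by (simp only: mult_2 power_add) algebra
      then have "(1 + fps_X ^ m) ^ n * (1 - fps_X ^ m) ^ n = (1 - fps_X ^ (2 * m) :: real fps) ^ n"
        by (metis power_mult_distrib)
      moreover have "fps_const (1 / 2) ^ n * fps_const (real m powr - real n) = fps_const (real (2 * m) powr - real n)"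
        using m by (simp add: fps_const_power powr_minus powr_realpow field_simps)
      moreover have "avg m ^ n * U m = (fps_const (1 / 2) ^ n * fps_const (real m powr - real n)) *
          (((1 + fps_X ^ m) ^ n * (1 - fps_X ^ m) ^ n) * diff_symbol (- \<beta>))"
        unfolding U_def stretch_diff_symbol_of_nat[OF m] avg_def power_mult_distrib by (simp only: ac_simps)
      ultimately show ?thesis using m by (simp only: U_def stretch_diff_symbol_of_nat)
    qed
    define w where "w j = real n * K * (M * (2 ^ j) powr (- a) * N (stretch (2 ^ j) (diff_symbol (a + 1)))) powr \<theta>" for j :: nat
    have step: "N (U (2 ^ j)) powr \<theta> \<le> 1 * N (U (2 ^ Suc j)) powr \<theta> + w j" for j :: nat
    proof -
      have m: "0 < (2::nat) ^ j" by simp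
      have "N (U (2 ^ j)) powr \<theta> \<le> N (U (2 ^ Suc j)) powr \<theta> + real n * K * N ((1 - fps_X ^ 2 ^ j) * U (2 ^ j)) powr \<theta>"
        using avg_power_step[OF refl sm U_lq(1)[OF m], of "2 ^ j" n] avgU[OF m] by simp
      also have "real n * K * N ((1 - fps_X ^ 2 ^ j) * U (2 ^ j)) powr \<theta> \<le> w j"
        unfolding w_def using dU[OF m] K \<theta>_pos nonneg by (intro mult_left_mono powr_mono2) auto
      finally show ?thesis by simp
    qed
    have x: "((2 ^ j) powr (- a)) powr \<theta> = ?x ^ j" for j :: nat
      by (simp add: powr_powr powr_realpow[symmetric] mult.commute mult.left_commute)
    have "dyad N \<theta> a 0 = N (U (2 ^ 0)) powr \<theta>" by (simp add: dyad_def U1[unfolded One_nat_def])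
    also have "\<dots> \<le> N (U (2 ^ k)) powr \<theta> + (\<Sum>j<k. w j)"
      using telescope_dyadic[where v = "\<lambda>j. N (U (2 ^ j)) powr \<theta>", OF step, of k] by simp
    also have "N (U (2 ^ k)) powr \<theta> \<le> (M * (2 ^ k) powr (- a) * N (stretch (2 ^ k) (diff_symbol a))) powr \<theta>"
      using U_lq(2)[of "2 ^ k"] \<theta>_pos nonneg by (intro powr_mono2) auto
    also have "\<dots> = M powr \<theta> * ?x ^ k * dyad N \<theta> a k"
      using M(1) nonneg by (simp add: powr_mult x dyad_def)
    also have "\<dots> \<le> M powr \<theta> * ?x ^ k * (qsum 1 (diff_symbol a) powr \<theta> * N 1 powr \<theta>)"
      using dyad_bound[OF adm(1), of k] by (intro mult_left_mono) auto
    also have "\<dots> = M powr \<theta> * qsum 1 (diff_symbol a) powr \<theta> * (?x ^ k * N 1 powr \<theta>)" by simp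
    also have "\<dots> \<le> C * (?x ^ k * N 1 powr \<theta>)"
      unfolding C_def by (intro mult_right_mono mult_left_mono) auto
    also have "(\<Sum>j<k. w j) \<le> (\<Sum>j<k. C * (?x ^ j * dyad N \<theta> (a + 1) j))"
    proof (rule sum_mono)
      fix j
      have "w j = M powr \<theta> * (real n * K) * (?x ^ j * dyad N \<theta> (a + 1) j)"
        unfolding w_def using M(1) nonneg by (simp add: powr_mult x dyad_def)
      also have "\<dots> \<le> C * (?x ^ j * dyad N \<theta> (a + 1) j)"
        unfolding C_def using K by (intro mult_right_mono mult_left_mono) auto
      finally show "w j \<le> C * (?x ^ j * dyad N \<theta> (a + 1) j)" .
    qed
    finally show ?thesis by (simp add: sum_distrib_left distrib_left)
  qed
  then show ?thesis unfolding marchaud_bound_def using C0 by blast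
qed

text \<open>Hardy's inequality for dyadic sums: inserting one bound into the other produces a double sum
  whose inner weights are geometric, because \<open>a < b\<close>.\<close>

lemma marchaud_bound_trans:
  assumes ab: "marchaud_bound q \<theta> K a b" and bc: "marchaud_bound q \<theta> K b c" and "a < b" "0 < \<theta>"
  shows "marchaud_bound q \<theta> K a c"
proof -
  obtain C1 where C1: "0 \<le> C1" "\<And>N k. marchaud_functional q N \<theta> K \<Longrightarrow>
     dyad N \<theta> a 0 \<le> C1 * ((2 powr (- a * \<theta>)) ^ k * N 1 powr \<theta> + (\<Sum>j<k. (2 powr (- a * \<theta>)) ^ j * dyad N \<theta> b j))"
    using ab unfolding marchaud_bound_def by blast
  obtain C2 where C2: "0 \<le> C2" "\<And>N k. marchaud_functional q N \<theta> K \<Longrightarrow>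
     dyad N \<theta> b 0 \<le> C2 * ((2 powr (- b * \<theta>)) ^ k * N 1 powr \<theta> + (\<Sum>j<k. (2 powr (- b * \<theta>)) ^ j * dyad N \<theta> c j))"
    using bc unfolding marchaud_bound_def by blast
  define x where "x = 2 powr (- a * \<theta>)"
  define y where "y = 2 powr (- b * \<theta>)"
  define z where "z = 2 powr (- (b - a) * \<theta>)"
  have xy: "y = x * z" by (simp add: x_def y_def z_def algebra_simps flip: powr_add)
  have pos: "0 < x" "0 < y" "0 < z" by (auto simp: x_def y_def z_def)
  have "- (b - a) * \<theta> < 0" using assms by (intro mult_neg_pos) auto
  then have z1: "z < 1" using powr_less_mono[of "- (b - a) * \<theta>" 0 2] by (simp add: z_def)
  have geo: "(\<Sum>j\<in>S. z ^ f j) \<le> 1 / (1 - z)" if "finite S" "inj_on f S" for S :: "nat set" and f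
  proof -
    have "(\<Sum>j\<in>S. z ^ f j) = sum ((^) z) (f ` S)" by (simp add: sum.reindex that)
    also have "\<dots> \<le> (\<Sum>i. z ^ i)"
      using that pos z1 by (intro sum_le_suminf summable_geometric) auto
    also have "\<dots> = 1 / (1 - z)" using pos z1 by (simp add: suminf_geometric)
    finally show ?thesis .
  qed
  define Z where "Z = 1 / (1 - z)"
  have Z: "0 \<le> Z" using z1 by (simp add: Z_def)
  define C where "C = C1 * (1 + C2 * Z)"
  have "dyad N \<theta> a 0 \<le> C * (x ^ k * N 1 powr \<theta> + (\<Sum>j<k. x ^ j * dyad N \<theta> c j))"
    if mf: "marchaud_functional q N \<theta> K" for N k
  proof -
    interpret marchaud_functional q N \<theta> K by fact
    let ?F = "N 1 powr \<theta>"
    have b_le: "x ^ j * dyad N \<theta> b j \<le> C2 * (x ^ k * z ^ (k - j) * ?F + (\<Sum>l\<in>{j..<k}. z ^ (l - j) * (x ^ l * dyad N \<theta> c l)))"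
      if "j < k" for j
    proof -
      have "dyad N \<theta> b j = dyad (\<lambda>b. N (stretch (2 ^ j) b)) \<theta> b 0" by (simp add: dyad_stretch)
      also have "\<dots> \<le> C2 * (y ^ (k - j) * ?F + (\<Sum>i<k - j. y ^ i * dyad N \<theta> c (j + i)))"
        using C2(2)[OF marchaud_functional_stretch[of "2 ^ j"], of "k - j"] by (simp add: y_def dyad_stretch)
      finally have "x ^ j * dyad N \<theta> b j \<le> x ^ j * (C2 * (y ^ (k - j) * ?F + (\<Sum>i<k - j. y ^ i * dyad N \<theta> c (j + i))))"
        using pos by (intro mult_left_mono) auto
      also have "\<dots> = C2 * ((x ^ j * y ^ (k - j)) * ?F + (\<Sum>i<k - j. (x ^ j * y ^ i) * dyad N \<theta> c (j + i)))"
        by (simp add: sum_distrib_left algebra_simps)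
      also have "x ^ j * y ^ (k - j) = x ^ k * z ^ (k - j)"
        using that by (simp add: xy power_mult_distrib flip: power_add)
      also have "(\<Sum>i<k - j. (x ^ j * y ^ i) * dyad N \<theta> c (j + i)) = (\<Sum>l\<in>{j..<k}. z ^ (l - j) * (x ^ l * dyad N \<theta> c l))"
        by (rule sum.reindex_bij_witness[of _ "\<lambda>l. l - j" "\<lambda>i. j + i"])
          (use that in \<open>auto simp: xy power_mult_distrib power_add\<close>)
      finally show ?thesis .
    qed
    have "(\<Sum>j<k. x ^ j * dyad N \<theta> b j)
        \<le> (\<Sum>j<k. C2 * (x ^ k * z ^ (k - j) * ?F + (\<Sum>l\<in>{j..<k}. z ^ (l - j) * (x ^ l * dyad N \<theta> c l))))"
      by (intro sum_mono b_le) auto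
    also have "\<dots> = C2 * (x ^ k * ?F * (\<Sum>j<k. z ^ (k - j)) + (\<Sum>j<k. \<Sum>l\<in>{j..<k}. z ^ (l - j) * (x ^ l * dyad N \<theta> c l)))"
      by (simp add: sum_distrib_left sum.distrib algebra_simps)
    also have "(\<Sum>j<k. \<Sum>l\<in>{j..<k}. z ^ (l - j) * (x ^ l * dyad N \<theta> c l))
        = (\<Sum>l<k. \<Sum>j\<in>{..l}. z ^ (l - j) * (x ^ l * dyad N \<theta> c l))"
      unfolding sum.Sigma[OF finite_lessThan ballI[OF finite_atLeastLessThan]] sum.Sigma[OF finite_lessThan ballI[OF finite_atMost]]
      by (rule sum.reindex_bij_witness[of _ prod.swap prod.swap]) auto
    also have "\<dots> = (\<Sum>l<k. (\<Sum>j\<in>{..l}. z ^ (l - j)) * (x ^ l * dyad N \<theta> c l))"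
      by (simp add: sum_distrib_right)
    also have "\<dots> \<le> (\<Sum>l<k. Z * (x ^ l * dyad N \<theta> c l))"
      unfolding Z_def using pos by (intro sum_mono mult_right_mono geo) (auto simp: inj_on_def)
    also have "(\<Sum>j<k. z ^ (k - j)) \<le> Z"
      unfolding Z_def by (intro geo) (auto simp: inj_on_def)
    finally have "(\<Sum>j<k. x ^ j * dyad N \<theta> b j) \<le> C2 * (x ^ k * ?F * Z + (\<Sum>l<k. Z * (x ^ l * dyad N \<theta> c l)))"
      using C2(1) pos by (simp add: mult_left_mono)
    also have "\<dots> = C2 * Z * (x ^ k * ?F + (\<Sum>l<k. x ^ l * dyad N \<theta> c l))"
      by (simp add: sum_distrib_left algebra_simps)
    finally have S: "(\<Sum>j<k. x ^ j * dyad N \<theta> b j) \<le> C2 * Z * (x ^ k * ?F + (\<Sum>l<k. x ^ l * dyad N \<theta> c l))" .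
    have P: "0 \<le> (\<Sum>l<k. x ^ l * dyad N \<theta> c l)" using pos by (intro sum_nonneg) auto
    have "dyad N \<theta> a 0 \<le> C1 * (x ^ k * ?F + (\<Sum>j<k. x ^ j * dyad N \<theta> b j))"
      using C1(2)[OF mf] by (simp add: x_def)
    also have "\<dots> \<le> C1 * ((x ^ k * ?F + (\<Sum>l<k. x ^ l * dyad N \<theta> c l)) + C2 * Z * (x ^ k * ?F + (\<Sum>l<k. x ^ l * dyad N \<theta> c l)))"
      using C1(1) S P by (intro mult_left_mono add_mono) auto
    finally show ?thesis by (simp add: C_def algebra_simps)
  qed
  moreover have "0 \<le> C" using C1 C2 Z by (simp add: C_def)
  ultimately show ?thesis unfolding marchaud_bound_def x_def by blast
qed

text \<open>Steps of length one in the order are composed until the order \<open>a + g\<close> is exceeded by some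
  \<open>d > 1/q - 1\<close>; the factor \<open>(1 - X)\<^sup>d\<close> is then bounded and brings the order back to \<open>a + g\<close>.\<close>

theorem abstract_marchaud:
  assumes q: "0 < q" "q \<le> 1" and \<theta>: "\<theta> = q \<or> q = 1 \<and> 0 < \<theta>"
    and a: "admissible q a" and g: "0 < g" and ag: "admissible q (a + g)"
  shows "marchaud_bound q \<theta> K a (a + g)"
proof -
  have \<theta>0: "0 < \<theta>" using q \<theta> by auto
  have step: "marchaud_bound q \<theta> K a (a + 1)" if "admissible q a" for a
  proof (cases "\<theta> = q")
    case True
    then show ?thesis using marchaud_bound_subadditive[OF q that] by simp
  next
    case False
    then show ?thesis using marchaud_bound_smooth[of a \<theta>] \<theta> admissible_pos[OF q that] by auto
  qed
  have adm: "admissible q (a + real (Suc m))" for m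
  proof (induction m)
    case (Suc m)
    then show ?case using admissible_add_one by (force simp: add_ac)
  qed (use admissible_add_one[OF a] in simp)
  have int: "marchaud_bound q \<theta> K a (a + real (Suc m))" for m
  proof (induction m)
    case (Suc m)
    show ?case
      using marchaud_bound_trans[OF Suc step[OF adm[of m]]] \<theta>0 by (simp add: add_ac)
  qed (use step[OF a] in simp)
  obtain m where m: "g + 1 / q - 1 < real m" using reals_Archimedean2 by blast
  define d where "d = real (Suc m) - g"
  have d: "admissible q d" using m unfolding admissible_def d_def by auto
  obtain C where C: "0 \<le> C" "\<And>N k. marchaud_functional q N \<theta> K \<Longrightarrow>
     dyad N \<theta> a 0 \<le> C * ((2 powr (- a * \<theta>)) ^ k * N 1 powr \<theta> + (\<Sum>j<k. (2 powr (- a * \<theta>)) ^ j * dyad N \<theta> (a + real (Suc m)) j))"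
    using int[of m] unfolding marchaud_bound_def by blast
  define D where "D = qsum q (diff_symbol d) powr (\<theta> / q)"
  let ?x = "2 powr (- a * \<theta>)"
  have "dyad N \<theta> a 0 \<le> C * (1 + D) * (?x ^ k * N 1 powr \<theta> + (\<Sum>j<k. ?x ^ j * dyad N \<theta> (a + g) j))"
    if mf: "marchaud_functional q N \<theta> K" for N k
  proof -
    interpret marchaud_functional q N \<theta> K by fact
    have D: "dyad N \<theta> (a + real (Suc m)) j \<le> D * dyad N \<theta> (a + g) j" for j
    proof -
      have p: "0 < (2::nat) ^ j" by simp
      have "a + real (Suc m) = d + (a + g)" by (simp add: d_def)
      then have e: "stretch (2 ^ j) (diff_symbol (a + real (Suc m))) = stretch (2 ^ j) (diff_symbol d) * stretch (2 ^ j) (diff_symbol (a + g))"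
        by (simp only: diff_symbol_add stretch_mult[OF p])
      show ?thesis unfolding dyad_def e D_def
        using mult_bound_\<theta>[OF lq_stretch(1)[OF p diff_symbol_lq[OF q ag]] lq_stretch(1)[OF p diff_symbol_lq[OF q d]]]
           lq_stretch(2)[OF p diff_symbol_lq[OF q d]] by simp
    qed
    have P: "0 \<le> (\<Sum>j<k. ?x ^ j * dyad N \<theta> (a + g) j)" by (intro sum_nonneg) auto
    have "(\<Sum>j<k. ?x ^ j * dyad N \<theta> (a + real (Suc m)) j) \<le> (\<Sum>j<k. ?x ^ j * (D * dyad N \<theta> (a + g) j))"
      by (intro sum_mono mult_left_mono D) auto
    also have "\<dots> = D * (\<Sum>j<k. ?x ^ j * dyad N \<theta> (a + g) j)"
      by (simp add: sum_distrib_left mult.left_commute)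
    finally have S: "(\<Sum>j<k. ?x ^ j * dyad N \<theta> (a + real (Suc m)) j) \<le> D * (\<Sum>j<k. ?x ^ j * dyad N \<theta> (a + g) j)" .
    have D0: "0 \<le> D" by (simp add: D_def)
    have "dyad N \<theta> a 0 \<le> C * (?x ^ k * N 1 powr \<theta> + D * (\<Sum>j<k. ?x ^ j * dyad N \<theta> (a + g) j))"
      using C(2)[OF mf, of k] mult_left_mono[OF add_left_mono[OF S] C(1)] order_trans by blast
    also have "\<dots> \<le> C * ((1 + D) * (?x ^ k * N 1 powr \<theta>) + (1 + D) * (\<Sum>j<k. ?x ^ j * dyad N \<theta> (a + g) j))"
    proof (intro mult_left_mono add_mono)
      have "1 * (?x ^ k * N 1 powr \<theta>) \<le> (1 + D) * (?x ^ k * N 1 powr \<theta>)"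
        using D0 by (intro mult_right_mono) auto
      then show "?x ^ k * N 1 powr \<theta> \<le> (1 + D) * (?x ^ k * N 1 powr \<theta>)" by simp
      show "D * (\<Sum>j<k. ?x ^ j * dyad N \<theta> (a + g) j) \<le> (1 + D) * (\<Sum>j<k. ?x ^ j * dyad N \<theta> (a + g) j)"
        using P by (intro mult_right_mono) auto
    qed (rule C(1))
    finally show ?thesis by (simp add: algebra_simps)
  qed
  moreover have "0 \<le> C * (1 + D)" using C(1) by (simp add: D_def)
  ultimately show ?thesis unfolding marchaud_bound_def by blast
qed

section \<open>Translations and the triangle inequality in \<open>L\<^sub>p\<close>\<close>

lemma lebesgue_translation:
  fixes a :: "'a::euclidean_space"
  shows "distr lebesgue lebesgue ((+) a) = lebesgue" "(+) a \<in> lebesgue \<rightarrow>\<^sub>M lebesgue"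
proof -
  have T: "(\<lambda>x. a + (\<Sum>j\<in>Basis. (1 * (x \<bullet> j)) *\<^sub>R j)) = (+) a"
    by (auto simp: euclidean_representation)
  show "(+) a \<in> lebesgue \<rightarrow>\<^sub>M lebesgue"
    using lebesgue_affine_measurable[of "\<lambda>_. 1" a] unfolding T by simp
  show "distr lebesgue lebesgue ((+) a) = lebesgue"
    using lebesgue_affine_euclidean[of "\<lambda>_. 1" a] unfolding T by (simp add: density_1)
qed

lemma nn_integral_translation:
  assumes "f \<in> borel_measurable lebesgue"
  shows "(\<integral>\<^sup>+x. f (a + x) \<partial>lebesgue) = (\<integral>\<^sup>+x. f x \<partial>(lebesgue :: 'a::euclidean_space measure))"
proof -
  have "(\<integral>\<^sup>+x. f x \<partial>(lebesgue :: 'a measure)) = (\<integral>\<^sup>+x. f x \<partial>distr lebesgue lebesgue ((+) a))"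
    by (simp add: lebesgue_translation)
  also have "\<dots> = (\<integral>\<^sup>+x. f (a + x) \<partial>lebesgue)"
    by (rule nn_integral_distr) (use assms lebesgue_translation in auto)
  finally show ?thesis ..
qed

lemma measurable_translate:
  fixes a :: "'a::euclidean_space"
  shows "f \<in> borel_measurable lebesgue \<Longrightarrow> (\<lambda>x. f (x + a)) \<in> borel_measurable lebesgue"
  using measurable_compose[OF lebesgue_translation(2)[of a]] by (simp add: add.commute)

lemma AE_translate:
  fixes a :: "'a::euclidean_space"
  assumes "AE x in lebesgue. P x"
  shows "AE x in lebesgue. P (x + a)"
proof -
  obtain N where N: "N \<in> null_sets lebesgue" "{x \<in> space lebesgue. \<not> P x} \<subseteq> N"
    using assms by (auto elim!: AE_E3 simp: eventually_ae_filter)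
  have "AE x in distr lebesgue lebesgue ((+) a). x \<notin> N"
    unfolding lebesgue_translation using N(1) by (rule AE_not_in)
  moreover have "{x \<in> space lebesgue. x \<notin> N} \<in> sets lebesgue"
    using Compl_in_sets_lebesgue[of N] N(1) by (simp add: null_setsD2 Compl_eq)
  ultimately have "AE x in lebesgue. a + x \<notin> N"
    by (subst (asm) AE_distr_iff[OF lebesgue_translation(2)]) (auto simp: Compl_in_sets_lebesgue)
  then show ?thesis by eventually_elim (use N(2) in \<open>auto simp: add.commute\<close>)
qed

lemma Lp_norm_translate:
  fixes a :: "real^'n"
  assumes f: "f \<in> borel_measurable lebesgue"
  shows "Lp_norm p (\<lambda>x. f (x + a)) = Lp_norm p f"
proof (cases "p = \<infinity>")
  case True
  have m: "(\<lambda>x. f (x + b)) \<in> borel_measurable lebesgue" for b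
    using f by (rule measurable_translate)
  have le: "esssup lebesgue (\<lambda>x. ennreal (norm (g (x + b)))) \<le> esssup lebesgue (\<lambda>x. ennreal (norm (g x)))"
    if g: "g \<in> borel_measurable lebesgue" for g :: "real^'n \<Rightarrow> complex" and b
  proof (rule esssup_I)
    show "(\<lambda>x. ennreal (norm (g (x + b)))) \<in> borel_measurable lebesgue"
      using measurable_translate[OF g, of b] by measurable
    show "AE x in lebesgue. ennreal (norm (g (x + b))) \<le> esssup lebesgue (\<lambda>x. ennreal (norm (g x)))"
      by (rule AE_translate) (rule esssup_AE)
  qed
  show ?thesis
    using le[OF f, of a] le[OF m[of a], of "- a"] True by (simp add: Lp_norm_def antisym)
next
  case False
  have "(\<lambda>x. ennreal (norm (f x) powr enn2real p)) \<in> borel_measurable lebesgue"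
    using f by measurable
  from nn_integral_translation[OF this, of a] show ?thesis
    using False by (simp add: Lp_norm_def add.commute)
qed

lemma Lp_norm_cong_AE:
  fixes f g :: "real^'n \<Rightarrow> complex"
  assumes [measurable]: "f \<in> borel_measurable lebesgue" "g \<in> borel_measurable lebesgue"
    and "AE x in lebesgue. f x = g x"
  shows "Lp_norm p f = Lp_norm p g"
proof (cases "p = \<infinity>")
  case True
  have "esssup lebesgue (\<lambda>x. ennreal (norm (f x))) = esssup lebesgue (\<lambda>x. ennreal (norm (g x)))"
    by (rule esssup_AE_cong) (use assms(3) in auto)
  with True show ?thesis by (simp add: Lp_norm_def)
next
  case False
  have "(\<integral>\<^sup>+x. ennreal (norm (f x) powr enn2real p) \<partial>lebesgue) = (\<integral>\<^sup>+x. ennreal (norm (g x) powr enn2real p) \<partial>lebesgue)"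
    by (rule nn_integral_cong_AE) (use assms(3) in auto)
  with False show ?thesis by (simp add: Lp_norm_def)
qed

definition Lp_real :: "ennreal \<Rightarrow> (real^'n \<Rightarrow> complex) \<Rightarrow> real" where
  "Lp_real p f = enn2real (Lp_norm p f)"

lemma Lp_real_nonneg [simp]: "0 \<le> Lp_real p f"
  by (simp add: Lp_real_def)

lemma Lp_norm_eq_real: "f \<in> Lp_space p \<Longrightarrow> Lp_norm p f = ennreal (Lp_real p f)"
  by (simp add: Lp_space_def Lp_real_def)

lemma Lp_space_measurable: "f \<in> Lp_space p \<Longrightarrow> f \<in> borel_measurable lebesgue"
  by (simp add: Lp_space_def)

lemma Lp_space_translate: "f \<in> Lp_space p \<Longrightarrow> (\<lambda>x. f (x + a)) \<in> Lp_space p"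
  and Lp_real_translate: "f \<in> Lp_space p \<Longrightarrow> Lp_real p (\<lambda>x. f (x + a)) = Lp_real p f"
  by (auto simp: Lp_space_def Lp_real_def measurable_translate Lp_norm_translate)

text \<open>For finite exponents the arguments run on the level of the integral of the \<open>r\<close>-th power, which
  avoids roots of extended nonnegative reals.\<close>

definition power_integral :: "real \<Rightarrow> (real^'n \<Rightarrow> complex) \<Rightarrow> ennreal" where
  "power_integral r f = (\<integral>\<^sup>+x. ennreal (norm (f x) powr r) \<partial>lebesgue)"

lemma
  assumes r: "0 < r"
  shows Lp_space_finite_iff: "f \<in> Lp_space (ennreal r) \<longleftrightarrow> f \<in> borel_measurable lebesgue \<and> power_integral r f < \<infinity>"
    and Lp_real_powr: "f \<in> Lp_space (ennreal r) \<Longrightarrow> power_integral r f = ennreal (Lp_real (ennreal r) f powr r)"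
proof -
  have n: "Lp_norm (ennreal r) f = power_integral r f epowr (1 / r)" for f :: "real^'n \<Rightarrow> complex"
    using r by (simp add: Lp_norm_def power_integral_def)
  show iff: "f \<in> Lp_space (ennreal r) \<longleftrightarrow> f \<in> borel_measurable lebesgue \<and> power_integral r f < \<infinity>"
    by (auto simp: Lp_space_def n ennreal_powr_def less_top[symmetric] top_unique)
  show "power_integral r f = ennreal (Lp_real (ennreal r) f powr r)" if "f \<in> Lp_space (ennreal r)"
  proof -
    have fin: "power_integral r f < \<infinity>" using that iff by simp
    then have "Lp_real (ennreal r) f = enn2real (power_integral r f) powr (1 / r)"
      by (simp add: Lp_real_def n ennreal_powr_def less_top[symmetric])
    then show ?thesis using fin r by (simp add: powr_powr)
  qed
qed

lemma Lp_space_infinity_iff: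
  "f \<in> Lp_space \<infinity> \<longleftrightarrow> f \<in> borel_measurable lebesgue \<and> (\<exists>B\<ge>0. AE x in lebesgue. norm (f x) \<le> B)"
proof
  assume f: "f \<in> Lp_space \<infinity>"
  have "AE x in lebesgue. ennreal (norm (f x)) \<le> Lp_norm \<infinity> f"
    by (simp add: Lp_norm_def esssup_AE)
  then have "AE x in lebesgue. norm (f x) \<le> Lp_real \<infinity> f"
    unfolding Lp_norm_eq_real[OF f] by simp
  then show "f \<in> borel_measurable lebesgue \<and> (\<exists>B\<ge>0. AE x in lebesgue. norm (f x) \<le> B)"
    using f by (auto simp: Lp_space_def intro!: exI[of _ "Lp_real \<infinity> f"])
next
  assume "f \<in> borel_measurable lebesgue \<and> (\<exists>B\<ge>0. AE x in lebesgue. norm (f x) \<le> B)"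
  then obtain B where [measurable]: "f \<in> borel_measurable lebesgue" and B: "0 \<le> B" "AE x in lebesgue. norm (f x) \<le> B"
    by auto
  have "Lp_norm \<infinity> f \<le> ennreal B"
    using B(2) unfolding Lp_norm_def by (auto intro!: esssup_I elim!: eventually_mono simp: ennreal_leI)
  then show "f \<in> Lp_space \<infinity>" by (auto simp: Lp_space_def intro: le_less_trans)
qed

lemma AE_norm_le_Lp_real:
  assumes "f \<in> Lp_space \<infinity>"
  shows "AE x in lebesgue. norm (f x) \<le> Lp_real \<infinity> f"
proof -
  have "AE x in lebesgue. ennreal (norm (f x)) \<le> Lp_norm \<infinity> f"
    by (simp add: Lp_norm_def esssup_AE)
  then show ?thesis unfolding Lp_norm_eq_real[OF assms] by simp
qed

lemma Lp_real_infinity_le: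
  assumes [measurable]: "f \<in> borel_measurable lebesgue" and B: "0 \<le> B" "AE x in lebesgue. norm (f x) \<le> B"
  shows "f \<in> Lp_space \<infinity>" "Lp_real \<infinity> f \<le> B"
proof -
  show f: "f \<in> Lp_space \<infinity>" using assms Lp_space_infinity_iff by blast
  have "Lp_norm \<infinity> f \<le> ennreal B"
    using B(2) unfolding Lp_norm_def by (auto intro!: esssup_I elim!: eventually_mono simp: ennreal_leI)
  then show "Lp_real \<infinity> f \<le> B" unfolding Lp_norm_eq_real[OF f] using B by simp
qed

lemma Lp_real_finite_le:
  assumes "0 < r" "f \<in> borel_measurable lebesgue" "0 \<le> B" "power_integral r f \<le> ennreal (B powr r)"
  shows "f \<in> Lp_space (ennreal r)" "Lp_real (ennreal r) f \<le> B"
proof -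
  show f: "f \<in> Lp_space (ennreal r)"
    using assms by (simp add: Lp_space_finite_iff) (metis ennreal_less_top le_less_trans)
  have "Lp_real (ennreal r) f powr r \<le> B powr r"
    using assms Lp_real_powr[OF assms(1) f] by simp
  then show "Lp_real (ennreal r) f \<le> B"
    using assms(1,3) Lp_real_nonneg[of "ennreal r" f] powr_less_mono2[of r B "Lp_real (ennreal r) f"] by linarith
qed

lemma Lp_scale:
  assumes f: "f \<in> Lp_space p" and p: "0 < p"
  shows "(\<lambda>x. c * f x) \<in> Lp_space p" "Lp_real p (\<lambda>x. c * f x) = norm c * Lp_real p f"
proof -
  note [measurable] = Lp_space_measurable[OF f]
  have le: "(\<lambda>x. c * f x) \<in> Lp_space p \<and> Lp_real p (\<lambda>x. c * f x) \<le> norm c * Lp_real p f"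
    if f: "f \<in> Lp_space p" for f :: "real^'n \<Rightarrow> complex" and c
  proof -
    note [measurable] = Lp_space_measurable[OF f]
    show ?thesis
    proof (cases p)
      case (real r)
      with p have r: "0 < r" by simp
      have "power_integral r (\<lambda>x. c * f x) = (\<integral>\<^sup>+x. ennreal (norm c powr r) * ennreal (norm (f x) powr r) \<partial>lebesgue)"
        unfolding power_integral_def by (simp add: norm_mult powr_mult ennreal_mult)
      also have "\<dots> = ennreal (norm c powr r) * power_integral r f"
        unfolding power_integral_def by (rule nn_integral_cmult) measurable
      also have "\<dots> = ennreal ((norm c * Lp_real p f) powr r)"
        using Lp_real_powr[OF r f[unfolded real]] by (simp add: real powr_mult ennreal_mult)
      finally show ?thesis using Lp_real_finite_le[OF r, of "\<lambda>x. c * f x" "norm c * Lp_real p f"] real by simp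
    next
      case top
      have "AE x in lebesgue. norm (c * f x) \<le> norm c * Lp_real \<infinity> f"
        using AE_norm_le_Lp_real[OF f[unfolded top infinity_ennreal_def[symmetric]]]
        by eventually_elim (simp add: norm_mult mult_left_mono)
      then show ?thesis using Lp_real_infinity_le[of "\<lambda>x. c * f x" "norm c * Lp_real \<infinity> f"] top by simp
    qed
  qed
  show 1: "(\<lambda>x. c * f x) \<in> Lp_space p" using le[OF f] by blast
  show "Lp_real p (\<lambda>x. c * f x) = norm c * Lp_real p f"
  proof (cases "c = 0")
    case True
    then show ?thesis using le[OF f, of 0] by (auto intro: antisym)
  next
    case False
    have "Lp_real p f \<le> norm (inverse c) * Lp_real p (\<lambda>x. c * f x)"
      using le[OF 1, of "inverse c"] False by (simp flip: mult.assoc)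
    then have "norm c * Lp_real p f \<le> Lp_real p (\<lambda>x. c * f x)"
      using False by (simp add: norm_inverse norm_divide field_simps)
    then show ?thesis using le[OF f, of c] by auto
  qed
qed

lemma convex_combination_powr:
  fixes x y :: real
  assumes "0 \<le> x" "0 \<le> y" "0 < s" "0 < t" "s + t = 1" "1 \<le> r"
  shows "(s * x + t * y) powr r \<le> s * x powr r + t * y powr r"
proof -
  have scale: "(u * z) powr r \<le> u * z powr r" if "0 < u" "u \<le> 1" for u z :: real
  proof -
    have "u powr r \<le> u" using that powr_mono'[of 1 r u] assms by simp
    then show ?thesis by (simp add: powr_mult mult_right_mono)
  qed
  consider "x = 0" | "y = 0" | "0 < x" "0 < y" using assms by linarith
  then show ?thesis
  proof cases
    case 3
    have s: "s = 1 - t" using assms by simp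
    show ?thesis
      using convex_onD[OF powr_convex[OF assms(6)], of t x y] 3 assms unfolding s by simp
  qed (use scale[of t y] scale[of s x] assms in auto)
qed

text \<open>Minkowski's inequality, from the convexity of \<open>x\<^sup>r\<close> applied pointwise to the convex combination of
  \<open>|f| / A\<close> and \<open>|g| / B\<close>. The numbers \<open>A\<close> and \<open>B\<close> slightly exceed the norms, so that they never vanish.\<close>

lemma Lp_triangle_ge_1:
  assumes r: "1 \<le> r" and f: "f \<in> Lp_space (ennreal r)" and g: "g \<in> Lp_space (ennreal r)"
  shows "(\<lambda>x. f x + g x) \<in> Lp_space (ennreal r) \<and>
    Lp_real (ennreal r) (\<lambda>x. f x + g x) \<le> Lp_real (ennreal r) f + Lp_real (ennreal r) g"
proof -
  have r0: "0 < r" using r by simp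
  note [measurable] = Lp_space_measurable[OF f] Lp_space_measurable[OF g]
  let ?p = "ennreal r"
  have main: "(\<lambda>x. f x + g x) \<in> Lp_space ?p \<and> Lp_real ?p (\<lambda>x. f x + g x) \<le> A + B"
    if A: "0 < A" "Lp_real ?p f \<le> A" and B: "0 < B" "Lp_real ?p g \<le> B" for A B
  proof -
    define s where "s = A / (A + B)"
    define t where "t = B / (A + B)"
    have st: "0 < s" "0 < t" "s + t = 1" "0 < A + B"
      using A B by (auto simp: s_def t_def add_pos_pos simp flip: add_divide_distrib)
    have "norm (f x + g x) powr r \<le> (A + B) powr r * (s * (norm (f x) / A) powr r + t * (norm (g x) / B) powr r)" for x
    proof -
      have "norm (f x + g x) powr r \<le> (norm (f x) + norm (g x)) powr r"
        using r by (intro powr_mono2 norm_triangle_ineq) auto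
      also have "norm (f x) + norm (g x) = (A + B) * (s * (norm (f x) / A) + t * (norm (g x) / B))"
        using A B st by (simp add: s_def t_def distrib_left)
      also have "\<dots> powr r = (A + B) powr r * (s * (norm (f x) / A) + t * (norm (g x) / B)) powr r"
        by (simp add: powr_mult)
      also have "\<dots> \<le> (A + B) powr r * (s * (norm (f x) / A) powr r + t * (norm (g x) / B) powr r)"
        using A B st r by (intro mult_left_mono convex_combination_powr) auto
      finally show ?thesis .
    qed
    then have "power_integral r (\<lambda>x. f x + g x) \<le> (\<integral>\<^sup>+x. ennreal ((A + B) powr r * (s / A powr r)) * ennreal (norm (f x) powr r)
         + ennreal ((A + B) powr r * (t / B powr r)) * ennreal (norm (g x) powr r) \<partial>lebesgue)"
      unfolding power_integral_def using st A B
      by (intro nn_integral_mono) (simp add: powr_divide algebra_simps flip: ennreal_mult ennreal_plus)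
    also have "\<dots> = ennreal ((A + B) powr r * (s / A powr r)) * power_integral r f + ennreal ((A + B) powr r * (t / B powr r)) * power_integral r g"
      unfolding power_integral_def by (subst nn_integral_add) (auto simp: nn_integral_cmult)
    also have "\<dots> \<le> ennreal ((A + B) powr r * (s / A powr r)) * ennreal (A powr r) + ennreal ((A + B) powr r * (t / B powr r)) * ennreal (B powr r)"
      unfolding Lp_real_powr[OF r0 f] Lp_real_powr[OF r0 g] using A B r
      by (intro add_mono mult_left_mono ennreal_leI powr_mono2) auto
    also have "\<dots> = ennreal ((A + B) powr r * (s + t))"
      using A B st(1,2) by (simp add: distrib_left flip: ennreal_mult ennreal_plus)
    finally have "power_integral r (\<lambda>x. f x + g x) \<le> ennreal ((A + B) powr r)" using st by simp
    then show ?thesis using Lp_real_finite_le[OF r0, of "\<lambda>x. f x + g x" "A + B"] st by simp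
  qed
  have "Lp_real ?p (\<lambda>x. f x + g x) \<le> Lp_real ?p f + Lp_real ?p g + e" if "0 < e" for e
    using main[of "Lp_real ?p f + e / 2" "Lp_real ?p g + e / 2"] that by (simp add: add_nonneg_pos)
  moreover have "(\<lambda>x. f x + g x) \<in> Lp_space ?p"
    using main[of "Lp_real ?p f + 1" "Lp_real ?p g + 1"] by (simp add: add_nonneg_pos)
  ultimately show ?thesis using field_le_epsilon by blast
qed

lemma Lp_triangle_le_1:
  assumes r: "0 < r" "r \<le> 1" and f: "f \<in> Lp_space (ennreal r)" and g: "g \<in> Lp_space (ennreal r)"
  shows "(\<lambda>x. f x + g x) \<in> Lp_space (ennreal r) \<and>
    Lp_real (ennreal r) (\<lambda>x. f x + g x) powr r \<le> Lp_real (ennreal r) f powr r + Lp_real (ennreal r) g powr r"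
proof -
  note [measurable] = Lp_space_measurable[OF f] Lp_space_measurable[OF g]
  let ?p = "ennreal r"
  have "norm (f x + g x) powr r \<le> norm (f x) powr r + norm (g x) powr r" for x
  proof -
    have "norm (f x + g x) powr r \<le> (norm (f x) + norm (g x)) powr r"
      using r by (intro powr_mono2 norm_triangle_ineq) auto
    also have "\<dots> \<le> norm (f x) powr r + norm (g x) powr r" using r by (intro powr_subadditive) auto
    finally show ?thesis .
  qed
  then have "power_integral r (\<lambda>x. f x + g x) \<le> (\<integral>\<^sup>+x. ennreal (norm (f x) powr r) + ennreal (norm (g x) powr r) \<partial>lebesgue)"
    unfolding power_integral_def by (intro nn_integral_mono) (simp flip: ennreal_plus)
  also have "\<dots> = power_integral r f + power_integral r g" unfolding power_integral_def by (subst nn_integral_add) auto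
  also have "\<dots> = ennreal (Lp_real ?p f powr r + Lp_real ?p g powr r)"
    unfolding Lp_real_powr[OF r(1) f] Lp_real_powr[OF r(1) g] by simp
  finally have le: "power_integral r (\<lambda>x. f x + g x) \<le> ennreal (Lp_real ?p f powr r + Lp_real ?p g powr r)" .
  then have m: "(\<lambda>x. f x + g x) \<in> Lp_space ?p"
    unfolding Lp_space_finite_iff[OF r(1)] by (auto intro: le_less_trans)
  then show ?thesis using le unfolding Lp_real_powr[OF r(1) m] by (subst (asm) ennreal_le_iff) auto
qed

text \<open>The largest exponent at most one for which the power of the (quasi-)norm is subadditive; it is
  \<open>min 1 p\<close> as a real number.\<close>

definition triangle_exponent :: "ennreal \<Rightarrow> real" where
  "triangle_exponent p = (if p < 1 then enn2real p else 1)"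

lemma triangle_exponent:
  assumes "0 < p"
  shows "0 < triangle_exponent p" "triangle_exponent p \<le> 1"
  using assms unfolding triangle_exponent_def by (cases p; auto simp: enn2real_positive_iff enn2real_le)+

lemma Lp_triangle:
  assumes p: "0 < p" and f: "f \<in> Lp_space p" and g: "g \<in> Lp_space p"
  shows "(\<lambda>x. f x + g x) \<in> Lp_space p" 
    "Lp_real p (\<lambda>x. f x + g x) powr triangle_exponent p \<le> Lp_real p f powr triangle_exponent p + Lp_real p g powr triangle_exponent p"
proof -
  note [measurable] = Lp_space_measurable[OF f] Lp_space_measurable[OF g]
  have "(\<lambda>x. f x + g x) \<in> Lp_space p \<and> Lp_real p (\<lambda>x. f x + g x) powr triangle_exponent p 
      \<le> Lp_real p f powr triangle_exponent p + Lp_real p g powr triangle_exponent p"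
  proof (cases p)
    case (real r)
    show ?thesis
    proof (cases "r < 1")
      case True
      then have "triangle_exponent p = r" using real by (simp add: triangle_exponent_def ennreal_less_one_iff)
      then show ?thesis using Lp_triangle_le_1[of r f g] True real p f g by simp
    next
      case False
      then have "triangle_exponent p = 1" using real by (simp add: triangle_exponent_def ennreal_less_one_iff)
      then show ?thesis using Lp_triangle_ge_1[of r f g] False real f g by simp
    qed
  next
    case top
    have "AE x in lebesgue. norm (f x + g x) \<le> Lp_real \<infinity> f + Lp_real \<infinity> g"
      using AE_norm_le_Lp_real[OF f[unfolded top infinity_ennreal_def[symmetric]]] AE_norm_le_Lp_real[OF g[unfolded top infinity_ennreal_def[symmetric]]]
      by eventually_elim (meson norm_triangle_le add_mono)
    then show ?thesis using Lp_real_infinity_le[of "\<lambda>x. f x + g x" "Lp_real \<infinity> f + Lp_real \<infinity> g"] top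
      by (simp add: triangle_exponent_def)
  qed
  then show "(\<lambda>x. f x + g x) \<in> Lp_space p" 
    "Lp_real p (\<lambda>x. f x + g x) powr triangle_exponent p \<le> Lp_real p f powr triangle_exponent p + Lp_real p g powr triangle_exponent p"
    by auto
qed

lemma Lp_real_cong_AE:
  assumes "f \<in> borel_measurable lebesgue" "g \<in> Lp_space p" "AE x in lebesgue. f x = g x"
  shows "f \<in> Lp_space p" "Lp_real p f = Lp_real p g"
  using Lp_norm_cong_AE[OF assms(1) Lp_space_measurable[OF assms(2)] assms(3), of p] assms
  by (auto simp: Lp_space_def Lp_real_def)

lemma Lp_norm_of_real_norm: "Lp_norm p (\<lambda>x. complex_of_real (norm (f x))) = Lp_norm p f"
  by (simp add: Lp_norm_def)

text \<open>Countable subadditivity in the form that covers all \<open>p\<close>: monotone convergence for finite \<open>p\<close>, a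
  countable union of null sets for \<open>p = \<infinity>\<close>.\<close>

lemma Lp_monotone_limit:
  fixes s :: "nat \<Rightarrow> real^'n \<Rightarrow> real"
  assumes p: "0 < p" and B: "0 \<le> B"
    and s: "\<And>n x. 0 \<le> s n x" "\<And>x. incseq (\<lambda>n. s n x)"
    and L: "\<And>n. (\<lambda>x. complex_of_real (s n x)) \<in> Lp_space p" "\<And>n. Lp_real p (\<lambda>x. complex_of_real (s n x)) \<le> B"
  shows "AE x in lebesgue. convergent (\<lambda>n. s n x)"
    and "\<And>F. F \<in> borel_measurable lebesgue \<Longrightarrow> AE x in lebesgue. norm (F x) \<le> lim (\<lambda>n. s n x) \<Longrightarrow>
       F \<in> Lp_space p \<and> Lp_real p F \<le> B"
proof -
  have bounded_convergent: "convergent (\<lambda>n. s n x)" if "\<And>n. s n x \<le> c" for x c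
    using s(2)[of x] that by (metis incseq_convergent convergentI)
  have m: "(\<lambda>x. complex_of_real (s n x)) \<in> borel_measurable lebesgue" for n
    using L(1) by (rule Lp_space_measurable)
  have [measurable]: "s n \<in> borel_measurable lebesgue" for n
    using measurable_compose[OF m[of n] borel_measurable_Re] by simp
  have "(AE x in lebesgue. convergent (\<lambda>n. s n x)) \<and> (\<forall>F. F \<in> borel_measurable lebesgue \<longrightarrow> 
    (AE x in lebesgue. norm (F x) \<le> lim (\<lambda>n. s n x)) \<longrightarrow> F \<in> Lp_space p \<and> Lp_real p F \<le> B)"
  proof (cases p)
    case (real r)
    with p have r: "0 < r" by simp
    let ?S = "\<lambda>x. SUP n. ennreal (s n x powr r)"
    have bound: "power_integral r (\<lambda>x. complex_of_real (s n x)) \<le> ennreal (B powr r)" for n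
      unfolding Lp_real_powr[OF r L(1)[of n, unfolded real]]
      using L(2)[of n] r by (intro ennreal_leI powr_mono2) (auto simp: real)
    have "incseq (\<lambda>n x. ennreal (s n x powr r))"
      using s r by (auto simp: incseq_def le_fun_def intro!: ennreal_leI powr_mono2)
    then have "(\<integral>\<^sup>+x. ?S x \<partial>lebesgue) = (SUP n. (\<integral>\<^sup>+x. ennreal (s n x powr r) \<partial>lebesgue))"
      by (intro nn_integral_monotone_convergence_SUP) auto
    also have "\<dots> \<le> ennreal (B powr r)"
      using bound s(1) by (intro SUP_least) (simp add: power_integral_def)
    finally have int: "(\<integral>\<^sup>+x. ?S x \<partial>lebesgue) \<le> ennreal (B powr r)" .
    then have fin: "AE x in lebesgue. ?S x \<noteq> \<infinity>"
      by (intro nn_integral_PInf_AE) (auto simp: top_unique)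
    have c: "AE x in lebesgue. convergent (\<lambda>n. s n x)"
      using fin
    proof eventually_elim
      case (elim x)
      then obtain c where c: "0 \<le> c" "?S x = ennreal c" by (cases "?S x") auto
      have "s n x \<le> c powr (1 / r)" for n
      proof -
        have "ennreal (s n x powr r) \<le> ennreal c" unfolding c(2)[symmetric] by (rule SUP_upper) simp
        then have "(s n x powr r) powr (1 / r) \<le> c powr (1 / r)"
          using c(1) r by (intro powr_mono2) auto
        then show ?thesis using s(1)[of n x] r by (simp add: powr_powr)
      qed
      then show ?case by (rule bounded_convergent)
    qed
    have "F \<in> Lp_space p \<and> Lp_real p F \<le> B"
      if F: "F \<in> borel_measurable lebesgue" "AE x in lebesgue. norm (F x) \<le> lim (\<lambda>n. s n x)" for F :: "real^'n \<Rightarrow> complex"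
    proof -
      have "AE x in lebesgue. ennreal (norm (F x) powr r) \<le> ?S x"
        using F(2) c
      proof eventually_elim
        case (elim x)
        then have lim: "(\<lambda>n. s n x) \<longlonglongrightarrow> lim (\<lambda>n. s n x)" by (simp add: convergent_LIMSEQ_iff)
        have "(\<lambda>n. s n x powr r) \<longlonglongrightarrow> lim (\<lambda>n. s n x) powr r"
          by (rule tendsto_powr'[OF lim tendsto_const]) (use r s(1) in auto)
        then have "ennreal (lim (\<lambda>n. s n x) powr r) \<le> ?S x"
          by (intro LIMSEQ_le_const2[OF tendsto_ennrealI]) (auto intro!: exI[of _ 0] SUP_upper)
        moreover have "norm (F x) powr r \<le> lim (\<lambda>n. s n x) powr r"
          using elim r by (intro powr_mono2) auto
        ultimately show ?case by (meson ennreal_leI order_trans)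
      qed
      then have "power_integral r F \<le> (\<integral>\<^sup>+x. ?S x \<partial>lebesgue)"
        unfolding power_integral_def by (rule nn_integral_mono_AE)
      with int have "power_integral r F \<le> ennreal (B powr r)" by (rule order_trans[rotated])
      then show ?thesis using Lp_real_finite_le[OF r F(1) B] real by simp
    qed
    with c show ?thesis by blast
  next
    case top
    then have pt: "p = \<infinity>" by simp
    have "AE x in lebesgue. \<forall>n. norm (complex_of_real (s n x)) \<le> Lp_real \<infinity> (\<lambda>x. complex_of_real (s n x))"
      unfolding AE_all_countable using AE_norm_le_Lp_real L(1)[unfolded pt] by blast
    then have b: "AE x in lebesgue. \<forall>n. s n x \<le> B"
    proof eventually_elim
      case (elim x)
      have "s n x \<le> B" for n
        using elim[rule_format, of n] L(2)[of n] by (simp add: pt)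
      then show ?case by blast
    qed
    then have c: "AE x in lebesgue. convergent (\<lambda>n. s n x)"
      by eventually_elim (blast intro: bounded_convergent)
    have "F \<in> Lp_space p \<and> Lp_real p F \<le> B"
      if F: "F \<in> borel_measurable lebesgue" "AE x in lebesgue. norm (F x) \<le> lim (\<lambda>n. s n x)" for F :: "real^'n \<Rightarrow> complex"
    proof -
      have "AE x in lebesgue. norm (F x) \<le> B"
        using F(2) b c
      proof eventually_elim
        case (elim x)
        then have "lim (\<lambda>n. s n x) \<le> B"
          by (intro LIMSEQ_le_const2[of "\<lambda>n. s n x"]) (auto simp: convergent_LIMSEQ_iff)
        with elim show ?case by simp
      qed
      then show ?thesis using Lp_real_infinity_le[OF F(1) B] pt by simp
    qed
    with c show ?thesis by blast
  qed
  then show "AE x in lebesgue. convergent (\<lambda>n. s n x)"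
    and "\<And>F. F \<in> borel_measurable lebesgue \<Longrightarrow> AE x in lebesgue. norm (F x) \<le> lim (\<lambda>n. s n x) \<Longrightarrow>
       F \<in> Lp_space p \<and> Lp_real p F \<le> B"
    by blast+
qed

section \<open>Power series in a translation acting on \<open>L\<^sub>p\<close>\<close>

definition shift_series :: "real^'n \<Rightarrow> (real^'n \<Rightarrow> complex) \<Rightarrow> real fps \<Rightarrow> real^'n \<Rightarrow> complex" where
  "shift_series h f a x = (\<Sum>\<nu>. complex_of_real (fps_nth a \<nu>) * f (x - real \<nu> *\<^sub>R h))"

lemma shift_series_measurable:
  assumes "f \<in> borel_measurable lebesgue"
  shows "shift_series h f a \<in> borel_measurable lebesgue"
proof -
  have [measurable]: "(\<lambda>x. f (x - real \<nu> *\<^sub>R h)) \<in> borel_measurable lebesgue" for \<nu>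
    using measurable_translate[OF assms, of "- (real \<nu> *\<^sub>R h)"] by simp
  have "(\<lambda>x. \<Sum>\<nu>. complex_of_real (fps_nth a \<nu>) * f (x - real \<nu> *\<^sub>R h)) \<in> borel_measurable lebesgue"
    by measurable
  then show ?thesis unfolding shift_series_def .
qed

context
  fixes p :: ennreal and f :: "real^'n \<Rightarrow> complex" and h :: "real^'n"
  assumes p: "0 < p" and f: "f \<in> Lp_space p"
begin

text \<open>The partial sums of \<open>\<Sum> |a\<^sub>\<nu>| |f (x - \<nu> h)|\<close> are bounded in \<open>L\<^sub>p\<close> by the triangle inequality and
  translation invariance. Hence the series converges almost everywhere, and the fractional differences make
  sense off a null set.\<close>

lemma shift_series_bounds:
  assumes a: "a \<in> lq (triangle_exponent p)"
  shows "AE x in lebesgue. summable (\<lambda>\<nu>. \<bar>fps_nth a \<nu>\<bar> * norm (f (x - real \<nu> *\<^sub>R h)))"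
    and "shift_series h f a \<in> Lp_space p"
    and "Lp_real p (shift_series h f a) powr triangle_exponent p \<le> qsum (triangle_exponent p) a * Lp_real p f powr triangle_exponent p"
proof -
  define q where "q = triangle_exponent p"
  have q: "0 < q" "q \<le> 1" using triangle_exponent[OF p] by (auto simp: q_def)
  have sa: "summable (\<lambda>n. \<bar>fps_nth a n\<bar> powr q)" using a by (simp add: lq_summable q_def)
  have qa: "0 \<le> qsum q a" using a by (simp add: qsum_nonneg q_def)
  define s where "s n x = (\<Sum>\<nu><n. \<bar>fps_nth a \<nu>\<bar> * norm (f (x - real \<nu> *\<^sub>R h)))" for n x
  define B where "B = qsum q a powr (1 / q) * Lp_real p f"
  have B: "0 \<le> B" "B powr q = qsum q a * Lp_real p f powr q"
    using q qa by (auto simp: B_def powr_mult powr_powr)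
  have nf: "(\<lambda>x. complex_of_real (norm (f x))) \<in> Lp_space p" "Lp_real p (\<lambda>x. complex_of_real (norm (f x))) = Lp_real p f"
  proof -
    have "(\<lambda>x. complex_of_real (norm (f x))) \<in> borel_measurable lebesgue"
      using Lp_space_measurable[OF f] by measurable
    then show "(\<lambda>x. complex_of_real (norm (f x))) \<in> Lp_space p" "Lp_real p (\<lambda>x. complex_of_real (norm (f x))) = Lp_real p f"
      using f by (simp_all add: Lp_space_def Lp_real_def Lp_norm_of_real_norm)
  qed
  have L: "(\<lambda>x. complex_of_real (s n x)) \<in> Lp_space p \<and>
     Lp_real p (\<lambda>x. complex_of_real (s n x)) powr q \<le> (\<Sum>\<nu><n. \<bar>fps_nth a \<nu>\<bar> powr q) * Lp_real p f powr q" for n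
  proof (induction n)
    case 0
    have "(\<lambda>x. 0 * f x) \<in> Lp_space p" "Lp_real p (\<lambda>x. 0 * f x) = 0" using Lp_scale[OF f p, of 0] by auto
    then show ?case by (simp add: s_def)
  next
    case (Suc n)
    let ?g = "\<lambda>x. complex_of_real \<bar>fps_nth a n\<bar> * complex_of_real (norm (f (x + - (real n *\<^sub>R h))))"
    note t = Lp_space_translate[OF nf(1), of "- (real n *\<^sub>R h)"]
    have g: "?g \<in> Lp_space p" "Lp_real p ?g = \<bar>fps_nth a n\<bar> * Lp_real p f"
      using Lp_scale[OF t p, of "complex_of_real \<bar>fps_nth a n\<bar>"] Lp_real_translate[OF nf(1), of "- (real n *\<^sub>R h)"] nf(2)
      by auto
    have eq: "(\<lambda>x. complex_of_real (s (Suc n) x)) = (\<lambda>x. complex_of_real (s n x) + ?g x)"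
      by (simp add: s_def)
    have "Lp_real p (\<lambda>x. complex_of_real (s n x) + ?g x) powr q \<le> Lp_real p (\<lambda>x. complex_of_real (s n x)) powr q + Lp_real p ?g powr q"
      using Lp_triangle(2)[OF p _ g(1)] Suc by (simp only: q_def)
    also have "Lp_real p ?g powr q = \<bar>fps_nth a n\<bar> powr q * Lp_real p f powr q"
      unfolding g(2) by (simp add: powr_mult)
    finally have "Lp_real p (\<lambda>x. complex_of_real (s (Suc n) x)) powr q \<le> (\<Sum>\<nu><Suc n. \<bar>fps_nth a \<nu>\<bar> powr q) * Lp_real p f powr q"
      using Suc unfolding eq by (simp add: algebra_simps)
    moreover have "(\<lambda>x. complex_of_real (s (Suc n) x)) \<in> Lp_space p"
      unfolding eq using Lp_triangle(1)[OF p _ g(1)] Suc by blast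
    ultimately show ?case by blast
  qed
  have LB: "Lp_real p (\<lambda>x. complex_of_real (s n x)) \<le> B" for n
  proof -
    have "(\<Sum>\<nu><n. \<bar>fps_nth a \<nu>\<bar> powr q) * Lp_real p f powr q \<le> qsum q a * Lp_real p f powr q"
      unfolding qsum_def by (intro mult_right_mono sum_le_suminf[OF sa]) auto
    then have "Lp_real p (\<lambda>x. complex_of_real (s n x)) powr q \<le> B powr q"
      using L[of n] B(2) by linarith
    then show ?thesis
      using q(1) B(1) powr_less_mono2[of q B] by (meson linorder_not_le)
  qed
  have inc: "incseq (\<lambda>n. s n x)" for x
    unfolding s_def by (rule incseq_SucI) simp
  have nn: "0 \<le> s n x" for n x unfolding s_def by (intro sum_nonneg) auto
  note lim = Lp_monotone_limit[OF p B(1) nn inc _ LB]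
  have c: "AE x in lebesgue. convergent (\<lambda>n. s n x)" by (rule lim) (use L in blast)
  then show sum: "AE x in lebesgue. summable (\<lambda>\<nu>. \<bar>fps_nth a \<nu>\<bar> * norm (f (x - real \<nu> *\<^sub>R h)))"
    by (simp add: s_def summable_iff_convergent)
  have "shift_series h f a \<in> Lp_space p \<and> Lp_real p (shift_series h f a) \<le> B"
  proof (rule lim)
    show "shift_series h f a \<in> borel_measurable lebesgue" by (rule shift_series_measurable[OF Lp_space_measurable[OF f]])
    show "AE x in lebesgue. norm (shift_series h f a x) \<le> lim (\<lambda>n. s n x)"
      using sum
    proof eventually_elim
      case (elim x)
      then have "summable (\<lambda>\<nu>. norm (complex_of_real (fps_nth a \<nu>) * f (x - real \<nu> *\<^sub>R h)))"
        by (simp add: norm_mult)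
      from summable_norm[OF this] show ?case
        by (simp add: shift_series_def s_def norm_mult suminf_eq_lim)
    qed
  qed (use L in blast)
  then show "shift_series h f a \<in> Lp_space p"
    and "Lp_real p (shift_series h f a) powr triangle_exponent p \<le> qsum (triangle_exponent p) a * Lp_real p f powr triangle_exponent p"
    using powr_mono2[of q "Lp_real p (shift_series h f a)" B] q B by (auto simp flip: q_def)
qed

lemma shift_series_linear:
  assumes a: "a \<in> lq (triangle_exponent p)" and b: "b \<in> lq (triangle_exponent p)"
  shows "AE x in lebesgue. shift_series h f (a + fps_const c * b) x = shift_series h f a x + complex_of_real c * shift_series h f b x"
  using shift_series_bounds(1)[OF a] shift_series_bounds(1)[OF b]
proof eventually_elim
  case (elim x)
  have s: "summable (\<lambda>\<nu>. complex_of_real (fps_nth a \<nu>) * f (x - real \<nu> *\<^sub>R h))"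
    "summable (\<lambda>\<nu>. complex_of_real (fps_nth b \<nu>) * f (x - real \<nu> *\<^sub>R h))"
    by (rule summable_norm_cancel, use elim in \<open>simp add: norm_mult\<close>)+
  have "shift_series h f (a + fps_const c * b) x = (\<Sum>\<nu>. complex_of_real (fps_nth a \<nu>) * f (x - real \<nu> *\<^sub>R h)
      + complex_of_real c * (complex_of_real (fps_nth b \<nu>) * f (x - real \<nu> *\<^sub>R h)))"
    unfolding shift_series_def by (simp add: algebra_simps)
  also have "\<dots> = shift_series h f a x + complex_of_real c * shift_series h f b x"
    unfolding shift_series_def suminf_mult[OF s(2), symmetric]
    by (rule suminf_add[symmetric]) (use s in \<open>auto intro: summable_mult\<close>)
  finally show ?case .
qed

lemma shift_series_shift:
  assumes a: "a \<in> lq (triangle_exponent p)"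
  shows "AE x in lebesgue. shift_series h f (fps_X * a) x = shift_series h f a (x + - h)"
  using AE_translate[OF shift_series_bounds(1)[OF a], of "- h"]
proof eventually_elim
  case (elim x)
  have e: "x - real (Suc \<nu>) *\<^sub>R h = x + - h - real \<nu> *\<^sub>R h" for \<nu>
    by (simp add: algebra_simps)
  have s: "summable (\<lambda>\<nu>. complex_of_real (fps_nth a \<nu>) * f (x + - h - real \<nu> *\<^sub>R h))"
    by (rule summable_norm_cancel) (use elim in \<open>simp add: norm_mult\<close>)
  let ?F = "\<lambda>\<nu>. complex_of_real (fps_nth (fps_X * a) \<nu>) * f (x - real \<nu> *\<^sub>R h)"
  have Suc: "?F (Suc \<nu>) = complex_of_real (fps_nth a \<nu>) * f (x + - h - real \<nu> *\<^sub>R h)" for \<nu>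
    unfolding e by simp
  have "summable (\<lambda>\<nu>. ?F (Suc \<nu>))" unfolding Suc by (rule s)
  then have "summable ?F" using summable_Suc_iff[of ?F] by blast
  from suminf_split_head[OF this] show ?case
    unfolding Suc shift_series_def by simp
qed

lemma shift_series_one: "shift_series h f 1 = f"
proof
  fix x
  have "(\<lambda>\<nu>. complex_of_real (fps_nth 1 \<nu>) * f (x - real \<nu> *\<^sub>R h)) sums (\<Sum>\<nu>\<in>{0}. complex_of_real (fps_nth 1 \<nu>) * f (x - real \<nu> *\<^sub>R h))"
    by (rule sums_finite) auto
  then show "shift_series h f 1 x = f x" by (simp add: shift_series_def sums_iff)
qed

lemma shift_series_measurable': "shift_series h f a \<in> borel_measurable lebesgue"
  by (rule shift_series_measurable[OF Lp_space_measurable[OF f]])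

lemma shift_series_is_shift_functional: "shift_functional (triangle_exponent p) (\<lambda>a. Lp_real p (shift_series h f a))"
proof
  show q: "0 < triangle_exponent p" "triangle_exponent p \<le> 1" using triangle_exponent[OF p] by auto
  fix a b c
  assume a: "a \<in> lq (triangle_exponent p)"
  note La = shift_series_bounds(2)[OF a]
  show "Lp_real p (shift_series h f (fps_const c * a)) = \<bar>c\<bar> * Lp_real p (shift_series h f a)"
  proof -
    have 0: "shift_series h f 0 x = 0" for x by (simp add: shift_series_def)
    have "AE x in lebesgue. shift_series h f (fps_const c * a) x = complex_of_real c * shift_series h f a x"
      using shift_series_linear[OF lq_simple(1)[OF q] a, of c] by (simp add: 0)
    then show ?thesis
      using Lp_real_cong_AE(2)[OF shift_series_measurable' Lp_scale(1)[OF La p]] Lp_scale(2)[OF La p, of "complex_of_real c"] by simp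
  qed
  show "Lp_real p (shift_series h f (fps_X * a)) = Lp_real p (shift_series h f a)"
    by (rule trans[OF Lp_real_cong_AE(2)[OF shift_series_measurable' Lp_space_translate[OF La] shift_series_shift[OF a]] Lp_real_translate[OF La]])
  show "Lp_real p (shift_series h f a) powr triangle_exponent p \<le> qsum (triangle_exponent p) a * Lp_real p (shift_series h f 1) powr triangle_exponent p"
    using shift_series_bounds(3)[OF a] by (simp add: shift_series_one)
  assume b: "b \<in> lq (triangle_exponent p)"
  note Lb = shift_series_bounds(2)[OF b]
  have "AE x in lebesgue. shift_series h f (a + b) x = shift_series h f a x + shift_series h f b x"
    using shift_series_linear[OF a b, of 1] by simp
  then show "Lp_real p (shift_series h f (a + b)) powr triangle_exponent p
      \<le> Lp_real p (shift_series h f a) powr triangle_exponent p + Lp_real p (shift_series h f b) powr triangle_exponent p"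
    using Lp_real_cong_AE(2)[OF shift_series_measurable' Lp_triangle(1)[OF p La Lb]] Lp_triangle(2)[OF p La Lb] by simp
qed simp

end

lemma shift_series_stretch: "0 < m \<Longrightarrow> shift_series h f (stretch m a) = shift_series (real m *\<^sub>R h) f a"
proof
  fix x assume "0 < m"
  then show "shift_series h f (stretch m a) x = shift_series (real m *\<^sub>R h) f a x"
    using sums_stretch[of m "\<lambda>n c. complex_of_real c * f (x - real n *\<^sub>R h)" a]
    by (simp add: shift_series_def suminf_def mult.commute)
qed

lemma frac_diff_eq_shift_series: "frac_diff a h f x = shift_series h f (diff_symbol a) (x + a *\<^sub>R h)"
  by (simp add: frac_diff_def shift_series_def diff_symbol_nth algebra_simps)

lemma Lp_norm_frac_diff:
  assumes "0 < p" "f \<in> Lp_space p" "diff_symbol a \<in> lq (triangle_exponent p)" "0 < m"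
  shows "Lp_norm p (frac_diff a (real m *\<^sub>R h) f) = ennreal (Lp_real p (shift_series h f (stretch m (diff_symbol a))))"
proof -
  have L: "shift_series (real m *\<^sub>R h) f (diff_symbol a) \<in> Lp_space p" by (rule shift_series_bounds(2)[OF assms(1-3)])
  have "Lp_norm p (frac_diff a (real m *\<^sub>R h) f) = Lp_norm p (\<lambda>x. shift_series (real m *\<^sub>R h) f (diff_symbol a) (x + a *\<^sub>R real m *\<^sub>R h))"
    by (simp add: frac_diff_eq_shift_series[abs_def])
  also have "\<dots> = Lp_norm p (shift_series (real m *\<^sub>R h) f (diff_symbol a))"
    by (rule Lp_norm_translate[OF Lp_space_measurable[OF L]])
  also have "\<dots> = ennreal (Lp_real p (shift_series (real m *\<^sub>R h) f (diff_symbol a)))" by (rule Lp_norm_eq_real[OF L])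
  finally show ?thesis using assms(4) by (simp add: shift_series_stretch)
qed

section \<open>Uniform smoothness of \<open>L\<^sub>p\<close>\<close>

lemma parallelogram: "(norm (u + v))\<^sup>2 + (norm (u - v))\<^sup>2 = 2 * (norm u)\<^sup>2 + 2 * (norm (v :: complex))\<^sup>2"
  unfolding cmod_power2 by (simp add: power2_eq_square algebra_simps)

lemma norm_powr_eq: "norm (w::complex) powr r = ((norm w)\<^sup>2) powr (r / 2)"
  by (cases "w = 0") (simp_all add: powr_powr flip: powr_numeral)

text \<open>The concavity of \<open>x\<^sup>r\<^sup>/\<^sup>2\<close> reduces this to the parallelogram law.\<close>

lemma clarkson_pointwise:
  fixes u v :: complex
  assumes r: "1 < r" "r \<le> 2"
  shows "norm (u + v) powr r + norm (u - v) powr r \<le> 2 * norm u powr r + 2 * norm v powr r"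
proof -
  let ?x = "(norm (u + v))\<^sup>2" and ?y = "(norm (u - v))\<^sup>2" and ?s = "r / 2"
  have "(1 / 2 * ?x powr ?s + 1 / 2 * ?y powr ?s) powr (1 / ?s) \<le> 1 / 2 * (?x powr ?s) powr (1 / ?s) + 1 / 2 * (?y powr ?s) powr (1 / ?s)"
    by (rule convex_combination_powr) (use r in auto)
  also have "\<dots> = (norm u)\<^sup>2 + (norm v)\<^sup>2"
    using r parallelogram[of u v] by (simp add: powr_powr)
  finally have "((1 / 2 * ?x powr ?s + 1 / 2 * ?y powr ?s) powr (1 / ?s)) powr ?s \<le> ((norm u)\<^sup>2 + (norm v)\<^sup>2) powr ?s"
    using r by (intro powr_mono2) auto
  also have "\<dots> \<le> (norm u)\<^sup>2 powr ?s + (norm v)\<^sup>2 powr ?s"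
    using r by (intro powr_subadditive) auto
  also have "((1 / 2 * ?x powr ?s + 1 / 2 * ?y powr ?s) powr (1 / ?s)) powr ?s = 1 / 2 * ?x powr ?s + 1 / 2 * ?y powr ?s"
    using r by (simp add: powr_powr)
  finally show ?thesis unfolding norm_powr_eq[of _ r] by simp
qed

lemma exp_sum_le: "exp y + exp (- y) \<le> 2 + y\<^sup>2 * exp \<bar>y :: real\<bar>"
proof -
  have *: "exp z + exp (- z) \<le> 2 + z\<^sup>2 * exp z" if "0 \<le> z" for z :: real
  proof -
    have "1 - exp (- z) \<le> z" using exp_ge_add_one_self[of "- z"] by simp
    then have "(1 - exp (- z))\<^sup>2 \<le> z\<^sup>2" using that by (intro power_mono) auto
    then have "exp z * (1 - exp (- z))\<^sup>2 \<le> exp z * z\<^sup>2" by (intro mult_left_mono) auto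
    moreover have "exp z * (1 - exp (- z))\<^sup>2 = exp z + exp (- z) - 2"
      by (simp add: power2_eq_square algebra_simps flip: exp_add)
    ultimately show ?thesis by (simp add: mult.commute)
  qed
  show ?thesis using *[of y] *[of "- y"] by (cases "0 \<le> y") auto
qed

text \<open>The exponential comes from the estimate \<open>e\<^sup>y + e\<^sup>-\<^sup>y \<le> 2 + y\<^sup>2 e\<^sup>|\<^sup>y\<^sup>|\<close> at
  \<open>y = (r/2) t\<close> with \<open>|t| \<le> 1\<close>.\<close>

definition smooth_const :: "real \<Rightarrow> real" where
  "smooth_const r = 1 + 2 * (r / 2)\<^sup>2 * exp (r / 2)"

lemma smooth_const_ge_1: "1 \<le> smooth_const r" by (simp add: smooth_const_def)

text \<open>With \<open>s = |u|\<^sup>2 + |v|\<^sup>2\<close> and \<open>d = 2 Re (u v\<^sup>*)\<close> the squares of \<open>|u \<plusminus> v|\<close> are \<open>s \<plusminus> d\<close>. In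
  \<open>(s + d)\<^sup>r\<^sup>/\<^sup>2 + (s - d)\<^sup>r\<^sup>/\<^sup>2\<close> the terms linear in \<open>d\<close> cancel, and \<open>d\<^sup>2 / s \<le> 4 |v|\<^sup>2\<close>.\<close>

lemma two_smooth_pointwise:
  fixes u v :: complex
  assumes r: "2 \<le> r"
  shows "norm (u + v) powr r + norm (u - v) powr r \<le> 2 * ((norm u)\<^sup>2 + smooth_const r * (norm v)\<^sup>2) powr (r / 2)"
proof -
  define \<rho> where "\<rho> = r / 2"
  have \<rho>: "1 \<le> \<rho>" using r by (simp add: \<rho>_def)
  define s where "s = (norm u)\<^sup>2 + (norm v)\<^sup>2"
  define d where "d = (norm (u + v))\<^sup>2 - s"
  have sd: "(norm (u + v))\<^sup>2 = s + d" "(norm (u - v))\<^sup>2 = s - d"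
    using parallelogram[of u v] by (auto simp: s_def d_def)
  have nn: "0 \<le> s + d" "0 \<le> s - d" unfolding sd[symmetric] by auto
  have "d = 2 * (u \<bullet> v)"
    by (simp add: d_def s_def power2_norm_eq_inner inner_add_left inner_add_right inner_commute)
  then have d2: "d\<^sup>2 \<le> 4 * s * (norm v)\<^sup>2"
  proof -
    have "\<bar>u \<bullet> v\<bar>\<^sup>2 \<le> (norm u * norm v)\<^sup>2" by (intro power_mono Cauchy_Schwarz_ineq2) auto
    also have "\<dots> \<le> s * (norm v)\<^sup>2" by (simp add: s_def power_mult_distrib mult_right_mono)
    finally show ?thesis using \<open>d = 2 * (u \<bullet> v)\<close> by (simp add: power_mult_distrib)
  qed
  define c where "c = \<rho>\<^sup>2 * exp \<rho>"
  have c: "0 \<le> c" by (simp add: c_def)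
  have K: "(norm u)\<^sup>2 + smooth_const r * (norm v)\<^sup>2 = s + 2 * c * (norm v)\<^sup>2"
    by (simp add: smooth_const_def s_def c_def \<rho>_def algebra_simps)
  have "(s + d) powr \<rho> + (s - d) powr \<rho> \<le> 2 * (s + 2 * c * (norm v)\<^sup>2) powr \<rho>"
  proof (cases "s = 0")
    case True
    then show ?thesis using nn by simp
  next
    case False
    have s: "0 < s" using nn False by linarith
    define t where "t = d / s"
    have t: "-1 \<le> t" "t \<le> 1" using s nn by (auto simp: t_def field_simps)
    have e: "s + d = s * (1 + t)" "s - d = s * (1 - t)" using s by (auto simp: t_def field_simps)
    have le_exp: "(1 + z) powr \<rho> \<le> exp (\<rho> * z)" if "-1 \<le> z" for z
    proof -
      have "(1 + z) powr \<rho> \<le> exp z powr \<rho>"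
        using that \<rho> exp_ge_add_one_self[of z] by (intro powr_mono2) auto
      then show ?thesis by (simp add: powr_def mult.commute)
    qed
    have "(1 + t) powr \<rho> + (1 - t) powr \<rho> \<le> exp (\<rho> * t) + exp (- (\<rho> * t))"
      using le_exp[of t] le_exp[of "- t"] t by simp
    also have "\<dots> \<le> 2 + (\<rho> * t)\<^sup>2 * exp \<bar>\<rho> * t\<bar>" by (rule exp_sum_le)
    also have "\<dots> \<le> 2 + (\<rho> * t)\<^sup>2 * exp \<rho>"
      using t \<rho> by (intro add_left_mono mult_left_mono) (auto simp: abs_mult mult_le_cancel_left1 abs_le_iff)
    also have "\<dots> = 2 + c * t\<^sup>2" by (simp add: c_def power_mult_distrib)
    also have "\<dots> \<le> 2 + c * (4 * (norm v)\<^sup>2 / s)"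
    proof (intro add_left_mono mult_left_mono c)
      show "t\<^sup>2 \<le> 4 * (norm v)\<^sup>2 / s"
        using d2 s by (simp add: t_def power_divide field_simps power2_eq_square)
    qed
    finally have "(1 + t) powr \<rho> + (1 - t) powr \<rho> \<le> 2 * (1 + 2 * c * (norm v)\<^sup>2 / s)"
      by (simp add: algebra_simps)
    also have "1 + 2 * c * (norm v)\<^sup>2 / s \<le> (1 + 2 * c * (norm v)\<^sup>2 / s) powr \<rho>"
      using powr_mono[of 1 \<rho> "1 + 2 * c * (norm v)\<^sup>2 / s"] \<rho> c s by simp
    finally have "s powr \<rho> * ((1 + t) powr \<rho> + (1 - t) powr \<rho>) \<le> s powr \<rho> * (2 * (1 + 2 * c * (norm v)\<^sup>2 / s) powr \<rho>)"
      by (intro mult_left_mono) auto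
    also have "\<dots> = 2 * (s * (1 + 2 * c * (norm v)\<^sup>2 / s)) powr \<rho>"
      by (simp add: powr_mult)
    also have "s * (1 + 2 * c * (norm v)\<^sup>2 / s) = s + 2 * c * (norm v)\<^sup>2"
      using s by (simp add: distrib_left)
    finally show ?thesis unfolding e powr_mult by (simp only: distrib_left)
  qed
  then show ?thesis unfolding K norm_powr_eq[of _ r] sd by (simp add: \<rho>_def)
qed

lemma Lp_diff:
  assumes "0 < p" "f \<in> Lp_space p" "g \<in> Lp_space p"
  shows "(\<lambda>x. f x - g x) \<in> Lp_space p"
  using Lp_triangle(1)[OF assms(1,2) Lp_scale(1)[OF assms(3,1), of "- 1"]] by simp

text \<open>The space \<open>L\<^sub>r\<close> is uniformly smooth of power type \<open>min r 2\<close>. For \<open>r \<le> 2\<close> the pointwise inequality is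
  integrated. For \<open>r > 2\<close> one integrates the pointwise bound and applies Minkowski's inequality in
  \<open>L\<^sub>r\<^sub>/\<^sub>2\<close> to \<open>|f|\<^sup>2\<close> and \<open>K |g|\<^sup>2\<close>; convexity then passes from the \<open>r\<close>-th powers of the norms to squares.\<close>

lemma Lp_smooth:
  fixes f g :: "real^'n \<Rightarrow> complex"
  assumes r: "1 < r" and f: "f \<in> Lp_space (ennreal r)" and g: "g \<in> Lp_space (ennreal r)"
  defines "\<theta> \<equiv> min r 2" and "nrm \<equiv> Lp_real (ennreal r)"
  shows "nrm (\<lambda>x. f x + g x) powr \<theta> + nrm (\<lambda>x. f x - g x) powr \<theta>
    \<le> 2 * nrm f powr \<theta> + 2 * smooth_const r * nrm g powr \<theta>"
proof -
  have r0: "0 < r" and p0: "0 < ennreal r" using r by auto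
  note [measurable] = Lp_space_measurable[OF f] Lp_space_measurable[OF g]
  let ?P = "\<lambda>x. f x + g x" and ?M = "\<lambda>x. f x - g x"
  note P = Lp_triangle(1)[OF p0 f g] and M = Lp_diff[OF p0 f g]
  have add: "power_integral r ?P + power_integral r ?M = (\<integral>\<^sup>+x. ennreal (norm (f x + g x) powr r + norm (f x - g x) powr r) \<partial>lebesgue)"
    unfolding power_integral_def by (subst nn_integral_add[symmetric]) auto
  have addr: "power_integral r ?P + power_integral r ?M = ennreal (nrm ?P powr r + nrm ?M powr r)"
    unfolding Lp_real_powr[OF r0 P] Lp_real_powr[OF r0 M] nrm_def by simp
  show ?thesis
  proof (cases "r \<le> 2")
    case True
    have "ennreal (nrm ?P powr r + nrm ?M powr r) \<le> (\<integral>\<^sup>+x. 2 * ennreal (norm (f x) powr r) + 2 * ennreal (norm (g x) powr r) \<partial>lebesgue)"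
      unfolding addr[symmetric] add
    proof (rule nn_integral_mono)
      fix x
      have "ennreal (norm (f x + g x) powr r + norm (f x - g x) powr r) \<le> ennreal (2 * norm (f x) powr r + 2 * norm (g x) powr r)"
        using clarkson_pointwise[OF r True] by (rule ennreal_leI)
      also have "\<dots> = 2 * ennreal (norm (f x) powr r) + 2 * ennreal (norm (g x) powr r)"
        by (simp add: ennreal_mult)
      finally show "ennreal (norm (f x + g x) powr r + norm (f x - g x) powr r) \<le> 2 * ennreal (norm (f x) powr r) + 2 * ennreal (norm (g x) powr r)" .
    qed
    also have "\<dots> = 2 * power_integral r f + 2 * power_integral r g"
      unfolding power_integral_def by (simp add: nn_integral_add nn_integral_cmult)
    also have "\<dots> = ennreal (2 * nrm f powr r + 2 * nrm g powr r)"
      unfolding Lp_real_powr[OF r0 f] Lp_real_powr[OF r0 g] nrm_def by (simp add: ennreal_mult)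
    finally have "nrm ?P powr r + nrm ?M powr r \<le> 2 * nrm f powr r + 2 * nrm g powr r"
      by (subst (asm) ennreal_le_iff) auto
    also have "\<dots> \<le> 2 * nrm f powr r + 2 * smooth_const r * nrm g powr r"
      using smooth_const_ge_1[of r] by (simp add: mult_right_mono)
    finally show ?thesis using True by (simp add: \<theta>_def min_def)
  next
    case False
    define \<rho> where "\<rho> = r / 2"
    have \<rho>: "1 \<le> \<rho>" "0 < \<rho>" using False by (auto simp: \<rho>_def)
    let ?K = "smooth_const r"
    have K: "0 \<le> ?K" using smooth_const_ge_1[of r] by simp
    let ?f2 = "\<lambda>x. complex_of_real ((norm (f x))\<^sup>2)" and ?g2 = "\<lambda>x. complex_of_real (?K * (norm (g x))\<^sup>2)"
    have sq: "(z\<^sup>2) powr \<rho> = z powr r" if "0 \<le> z" for z :: real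
      using that by (cases "z = 0") (simp_all add: \<rho>_def powr_powr flip: powr_numeral)
    have "power_integral \<rho> ?f2 = power_integral r f" by (simp add: power_integral_def sq norm_power)
    then have f2: "?f2 \<in> Lp_space (ennreal \<rho>)" "Lp_real (ennreal \<rho>) ?f2 \<le> (nrm f)\<^sup>2"
      using Lp_real_finite_le[OF \<rho>(2), of ?f2 "(nrm f)\<^sup>2"] Lp_real_powr[OF r0 f] by (auto simp: sq nrm_def)
    have "power_integral \<rho> ?g2 = (\<integral>\<^sup>+x. ennreal (?K powr \<rho>) * ennreal (norm (g x) powr r) \<partial>lebesgue)"
      using K by (simp add: power_integral_def sq norm_power norm_mult powr_mult ennreal_mult)
    also have "\<dots> = ennreal (?K powr \<rho>) * power_integral r g" unfolding power_integral_def by (rule nn_integral_cmult) auto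
    also have "\<dots> = ennreal ((?K * (nrm g)\<^sup>2) powr \<rho>)"
      unfolding Lp_real_powr[OF r0 g] using K by (simp add: powr_mult sq nrm_def ennreal_mult)
    finally have g2: "?g2 \<in> Lp_space (ennreal \<rho>)" "Lp_real (ennreal \<rho>) ?g2 \<le> ?K * (nrm g)\<^sup>2"
      using Lp_real_finite_le[OF \<rho>(2), of ?g2 "?K * (nrm g)\<^sup>2"] K by auto
    let ?h = "\<lambda>x. ?f2 x + ?g2 x"
    have h: "?h \<in> Lp_space (ennreal \<rho>)" "Lp_real (ennreal \<rho>) ?h \<le> (nrm f)\<^sup>2 + ?K * (nrm g)\<^sup>2"
      using Lp_triangle_ge_1[OF \<rho>(1) f2(1) g2(1)] f2(2) g2(2) by auto
    have "ennreal (nrm ?P powr r + nrm ?M powr r) \<le> (\<integral>\<^sup>+x. 2 * ennreal (norm (?h x) powr \<rho>) \<partial>lebesgue)"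
      unfolding addr[symmetric] add
    proof (rule nn_integral_mono)
      fix x
      have "norm (?h x) = (norm (f x))\<^sup>2 + ?K * (norm (g x))\<^sup>2"
        using K by (simp add: norm_of_real flip: of_real_add of_real_power of_real_mult del: of_real_add of_real_power of_real_mult)
      then have "ennreal (norm (f x + g x) powr r + norm (f x - g x) powr r) \<le> ennreal (2 * norm (?h x) powr \<rho>)"
        using two_smooth_pointwise[of r "f x" "g x"] False by (intro ennreal_leI) (simp add: \<rho>_def)
      then show "ennreal (norm (f x + g x) powr r + norm (f x - g x) powr r) \<le> 2 * ennreal (norm (?h x) powr \<rho>)"
        by (simp add: ennreal_mult)
    qed
    also have "\<dots> = 2 * power_integral \<rho> ?h" unfolding power_integral_def by (rule nn_integral_cmult) measurable
    also have "\<dots> = ennreal (2 * Lp_real (ennreal \<rho>) ?h powr \<rho>)"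
      unfolding Lp_real_powr[OF \<rho>(2) h(1)] by (simp add: ennreal_mult)
    also have "\<dots> \<le> ennreal (2 * ((nrm f)\<^sup>2 + ?K * (nrm g)\<^sup>2) powr \<rho>)"
      using h(2) \<rho> by (intro ennreal_leI mult_left_mono powr_mono2) auto
    finally have le: "nrm ?P powr r + nrm ?M powr r \<le> 2 * ((nrm f)\<^sup>2 + ?K * (nrm g)\<^sup>2) powr \<rho>"
      by (subst (asm) ennreal_le_iff) auto
    have nn: "0 \<le> nrm w" for w by (simp add: nrm_def)
    have "(1 / 2 * (nrm ?P)\<^sup>2 + 1 / 2 * (nrm ?M)\<^sup>2) powr \<rho> \<le> 1 / 2 * ((nrm ?P)\<^sup>2) powr \<rho> + 1 / 2 * ((nrm ?M)\<^sup>2) powr \<rho>"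
      using \<rho> by (intro convex_combination_powr) auto
    also have "\<dots> \<le> ((nrm f)\<^sup>2 + ?K * (nrm g)\<^sup>2) powr \<rho>"
      using le nn by (simp add: sq)
    finally have "1 / 2 * (nrm ?P)\<^sup>2 + 1 / 2 * (nrm ?M)\<^sup>2 \<le> (nrm f)\<^sup>2 + ?K * (nrm g)\<^sup>2"
      using \<rho>(2) K powr_less_mono2[of \<rho> "(nrm f)\<^sup>2 + ?K * (nrm g)\<^sup>2"] by (smt (verit) zero_le_power2 mult_nonneg_nonneg)
    moreover have "nrm w powr \<theta> = (nrm w)\<^sup>2" for w
      using False nn by (simp add: \<theta>_def min_def powr_numeral)
    ultimately show ?thesis by (simp add: algebra_simps)
  qed
qed

lemma shift_series_is_marchaud_functional:
  fixes f :: "real^'n \<Rightarrow> complex"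
  assumes p: "0 < p" and f: "f \<in> Lp_space p"
  shows "marchaud_functional (triangle_exponent p) (\<lambda>a. Lp_real p (shift_series h f a)) (marchaud_exponent p) (smooth_const (enn2real p))"
proof (intro marchaud_functional.intro shift_series_is_shift_functional[OF p f])
  let ?q = "triangle_exponent p" and ?\<theta> = "marchaud_exponent p" and ?K = "smooth_const (enn2real p)"
  have cases: "?\<theta> = ?q \<or> (\<exists>r>1. p = ennreal r \<and> ?q = 1 \<and> ?\<theta> = min r 2)"
  proof (cases p)
    case (real r)
    then show ?thesis
    proof (cases "r \<le> 1")
      case True
      then show ?thesis using real by (auto simp: triangle_exponent_def marchaud_exponent_def ennreal_less_one_iff)
    next
      case False
      then have "1 < r \<and> p = ennreal r \<and> ?q = 1 \<and> ?\<theta> = min r 2"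
        using real by (auto simp: triangle_exponent_def marchaud_exponent_def ennreal_less_one_iff)
      then show ?thesis by blast
    qed
  next
    case top
    then show ?thesis by (simp add: triangle_exponent_def marchaud_exponent_def)
  qed
  show "marchaud_functional_axioms ?q (\<lambda>a. Lp_real p (shift_series h f a)) ?\<theta> ?K"
  proof
    show "?q \<le> ?\<theta>" using cases by auto
    show "0 \<le> ?K" using smooth_const_ge_1 order_trans zero_le_one by blast
    show "?\<theta> = ?q \<or> ?q = 1 \<and> (\<forall>a\<in>lq 1. \<forall>b\<in>lq 1.
      Lp_real p (shift_series h f (a + b)) powr ?\<theta> + Lp_real p (shift_series h f (a - b)) powr ?\<theta>
      \<le> 2 * Lp_real p (shift_series h f a) powr ?\<theta> + 2 * ?K * Lp_real p (shift_series h f b) powr ?\<theta>)"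
      using cases
    proof (elim disjE exE conjE)
      fix r assume r: "1 < r" "p = ennreal r" "?q = 1" "?\<theta> = min r 2"
      have "Lp_real p (shift_series h f (a + b)) powr ?\<theta> + Lp_real p (shift_series h f (a - b)) powr ?\<theta>
        \<le> 2 * Lp_real p (shift_series h f a) powr ?\<theta> + 2 * ?K * Lp_real p (shift_series h f b) powr ?\<theta>"
        if a: "a \<in> lq 1" and b: "b \<in> lq 1" for a b
      proof -
        have a': "a \<in> lq ?q" and b': "b \<in> lq ?q" using a b r by auto
        note La = shift_series_bounds(2)[OF p f a', of h] and Lb = shift_series_bounds(2)[OF p f b', of h]
        have m: "shift_series h f c \<in> borel_measurable lebesgue" for c
          by (rule shift_series_measurable[OF Lp_space_measurable[OF f]])
        have "AE x in lebesgue. shift_series h f (a + b) x = shift_series h f a x + shift_series h f b x"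
          using shift_series_linear[OF p f a' b', of h 1] by simp
        then have 1: "Lp_real p (shift_series h f (a + b)) = Lp_real p (\<lambda>x. shift_series h f a x + shift_series h f b x)"
          by (rule Lp_real_cong_AE(2)[OF m Lp_triangle(1)[OF p La Lb]])
        have "a + fps_const (- 1) * b = a - b" by (simp add: fps_eq_iff)
        then have "AE x in lebesgue. shift_series h f (a - b) x = shift_series h f a x - shift_series h f b x"
          using shift_series_linear[OF p f a' b', of h "- 1"] by simp
        then have 2: "Lp_real p (shift_series h f (a - b)) = Lp_real p (\<lambda>x. shift_series h f a x - shift_series h f b x)"
          by (rule Lp_real_cong_AE(2)[OF m Lp_diff[OF p La Lb]])
        show ?thesis
          unfolding 1 2 using Lp_smooth[OF r(1) La[unfolded r(2)] Lb[unfolded r(2)]] r by simp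
      qed
      with r show ?thesis by blast
    qed blast
  qed
qed

section \<open>From dyadic sums to integrals\<close>

lemma smoothness_orders_admissible:
  assumes "0 < p" "a \<in> smoothness_orders p"
  shows "admissible (triangle_exponent p) a"
proof -
  have "1 / triangle_exponent p - 1 = max (enn2real (1 / p) - 1) 0"
  proof (cases p)
    case (real r)
    with assms have r: "0 < r" by simp
    have e: "enn2real (1 / p) = 1 / r"
      using r real divide_ennreal[of 1 r] by (simp flip: ennreal_1)
    show ?thesis
    proof (cases "r < 1")
      case True
      then have "1 \<le> 1 / r" using r by simp
      then show ?thesis using e True real by (simp add: triangle_exponent_def ennreal_less_one_iff)
    next
      case False
      then have "1 / r \<le> 1" using r by simp
      then show ?thesis using e False real by (simp add: triangle_exponent_def ennreal_less_one_iff)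
    qed
  next
    case top
    then show ?thesis by (simp add: triangle_exponent_def)
  qed
  then show ?thesis using assms(2) by (auto simp: admissible_def smoothness_orders_def)
qed

lemma epowr_ennreal [simp]: "0 \<le> x \<Longrightarrow> ennreal x epowr a = ennreal (x powr a)"
  by (simp add: ennreal_powr_def)

lemma epowr_top [simp]: "top epowr a = top"
  by (simp add: ennreal_powr_def)

lemma epowr_mono: "0 < a \<Longrightarrow> x \<le> y \<Longrightarrow> x epowr a \<le> y epowr a"
  by (cases x; cases y) (auto simp: powr_mono2 top_unique)

lemma epowr_epowr: "0 < a \<Longrightarrow> (x epowr a) epowr (1 / a) = x"
  by (cases x) (auto simp: powr_powr)

lemma epowr_mult_ennreal: "0 < c \<Longrightarrow> (ennreal c * x) epowr a = ennreal (c powr a) * x epowr a"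
  by (cases x) (auto simp: powr_mult ennreal_mult_top simp flip: ennreal_mult)

lemma epowr_weight:
  assumes "0 < t" "0 < \<theta>"
  shows "((w / ennreal (t powr \<alpha>)) epowr \<theta>) / ennreal t = w epowr \<theta> * ennreal (t powr (- \<alpha> * \<theta> - 1))"
proof (cases w)
  case (real x)
  have "((w / ennreal (t powr \<alpha>)) epowr \<theta>) / ennreal t = ennreal ((x / t powr \<alpha>) powr \<theta> / t)"
    using real assms by (simp add: divide_ennreal)
  also have "(x / t powr \<alpha>) powr \<theta> / t = x powr \<theta> * t powr (- \<alpha> * \<theta> - 1)"
    using real assms by (simp add: powr_divide powr_powr powr_diff powr_minus field_simps)
  finally show ?thesis using real by (simp add: ennreal_mult)
next
  case top
  then show ?thesis using assms by (simp add: ennreal_top_divide ennreal_top_mult)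
qed

text \<open>On \<open>[2\<^sup>j \<delta>, 2\<^sup>j\<^sup>+\<^sup>1 \<delta>)\<close> the integrand is at least a constant comparable to the \<open>j\<close>-th summand, by
  monotonicity of \<open>W\<close>. The step function with these values lies below the
  integrand and is the only function to be integrated exactly.\<close>

lemma dyadic_sum_le_integral:
  fixes W :: "real \<Rightarrow> ennreal"
  assumes W: "\<And>s t. s \<le> t \<Longrightarrow> W s \<le> W t" and \<delta>: "0 < \<delta>" and \<theta>: "0 < \<theta>" and \<alpha>: "0 < \<alpha>"
    and S: "{\<delta>..<2 ^ k * \<delta>} \<subseteq> S"
  shows "(\<Sum>j<k. ennreal ((2 powr (- \<alpha> * \<theta>)) ^ j) * W (2 ^ j * \<delta>) epowr \<theta>)
    \<le> ennreal (2 powr (\<alpha> * \<theta> + 1) * \<delta> powr (\<alpha> * \<theta>)) *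
       (\<integral>\<^sup>+t\<in>S. ((W t / ennreal (t powr \<alpha>)) epowr \<theta>) / ennreal t \<partial>lborel)"
proof -
  define I where "I j = {2 ^ j * \<delta>..<2 ^ Suc j * \<delta>}" for j
  define c where "c j = W (2 ^ j * \<delta>) epowr \<theta> * ennreal ((2 ^ Suc j * \<delta>) powr (- \<alpha> * \<theta> - 1))" for j
  let ?g = "\<lambda>t. ((W t / ennreal (t powr \<alpha>)) epowr \<theta>) / ennreal t"
  have disj: "i \<le> j" if "t \<in> I i" "t \<in> I j" for i j t
  proof -
    have "2 ^ i * \<delta> < 2 ^ Suc j * \<delta>" using that unfolding I_def by auto
    then have "(2::real) ^ i < 2 ^ Suc j" using \<delta> by (simp only: mult_less_cancel_right_pos)
    then have "i < Suc j" by (rule power_less_imp_less_exp[rotated]) simp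
    then show ?thesis by simp
  qed
  have pt: "(\<Sum>j<k. c j * indicator (I j) t) \<le> ?g t * indicator S t" for t
  proof (cases "\<exists>i<k. t \<in> I i")
    case True
    then obtain i where i: "i < k" "t \<in> I i" by blast
    have "(\<Sum>j<k. c j * indicator (I j) t) = (\<Sum>j\<in>{i}. c j * indicator (I j) t)"
    proof (rule sum.mono_neutral_right)
      show "\<forall>j\<in>{..<k} - {i}. c j * indicator (I j) t = 0"
        using i disj by (auto simp: indicator_def intro: antisym)
    qed (use i in auto)
    also have "\<dots> = c i" using i by simp
    also have "\<dots> \<le> ?g t"
    proof -
      have t: "2 ^ i * \<delta> \<le> t" "t \<le> 2 ^ Suc i * \<delta>" using i(2) unfolding I_def by auto
      have t0: "0 < t" using t(1) \<delta> by (meson less_le_trans mult_pos_pos zero_less_power zero_less_numeral)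
      have "- \<alpha> * \<theta> - 1 \<le> 0" using mult_pos_pos[OF \<alpha> \<theta>] by simp
      then have "(2 ^ Suc i * \<delta>) powr (- \<alpha> * \<theta> - 1) \<le> t powr (- \<alpha> * \<theta> - 1)"
        using t0 t by (intro powr_mono2') auto
      then show ?thesis
        unfolding c_def epowr_weight[OF t0 \<theta>] using W[OF t(1)] \<theta>
        by (intro mult_mono epowr_mono ennreal_leI) auto
    qed
    also have "\<dots> = ?g t * indicator S t"
    proof -
      have "(2::real) ^ Suc i \<le> 2 ^ k" using i(1) by (intro power_increasing) auto
      then have "2 ^ Suc i * \<delta> \<le> 2 ^ k * \<delta>" using \<delta> by (intro mult_right_mono) auto
      moreover have "1 * \<delta> \<le> 2 ^ i * \<delta>" using \<delta> by (intro mult_right_mono) auto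
      ultimately have "t \<in> S" using S i(2) unfolding I_def by force
      then show ?thesis by simp
    qed
    finally show ?thesis .
  next
    case False
    then have "(\<Sum>j<k. c j * indicator (I j) t) = 0" by (intro sum.neutral) auto
    then show ?thesis by simp
  qed
  have "(\<Sum>j<k. c j * ennreal (2 ^ j * \<delta>)) = (\<Sum>j<k. \<integral>\<^sup>+t. c j * indicator (I j) t \<partial>lborel)"
    using \<delta> by (intro sum.cong) (auto simp: I_def nn_integral_cmult_indicator algebra_simps)
  also have "\<dots> = (\<integral>\<^sup>+t. (\<Sum>j<k. c j * indicator (I j) t) \<partial>lborel)"
    by (rule nn_integral_sum[symmetric]) (auto simp: I_def)
  also have "\<dots> \<le> (\<integral>\<^sup>+t\<in>S. ?g t \<partial>lborel)"
    by (rule nn_integral_mono) (rule pt)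
  finally have le: "(\<Sum>j<k. c j * ennreal (2 ^ j * \<delta>)) \<le> (\<integral>\<^sup>+t\<in>S. ?g t \<partial>lborel)" .
  let ?D = "2 powr (\<alpha> * \<theta> + 1) * \<delta> powr (\<alpha> * \<theta>)"
  have "ennreal ((2 powr (- \<alpha> * \<theta>)) ^ j) * W (2 ^ j * \<delta>) epowr \<theta> = ennreal ?D * (c j * ennreal (2 ^ j * \<delta>))" for j
  proof -
    have "?D * ((2 ^ Suc j * \<delta>) powr (- \<alpha> * \<theta> - 1) * (2 ^ j * \<delta>)) = (2 powr (- \<alpha> * \<theta>)) ^ j"
    proof -
      have e: "(2::real) ^ j = 2 powr real j" "(2::real) ^ Suc j = 2 powr (real j + 1)"
        by (simp_all add: powr_realpow[symmetric] add.commute del: power_Suc)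
      have "(2 powr (- \<alpha> * \<theta>)) ^ j = 2 powr (- \<alpha> * \<theta> * real j)"
        by (simp add: powr_realpow[symmetric] powr_powr)
      moreover have "?D * ((2 ^ Suc j * \<delta>) powr (- \<alpha> * \<theta> - 1) * (2 ^ j * \<delta>))
          = (2 powr (\<alpha> * \<theta> + 1) * 2 powr ((real j + 1) * (- \<alpha> * \<theta> - 1)) * 2 powr (real j))
            * (\<delta> powr (\<alpha> * \<theta>) * \<delta> powr (- \<alpha> * \<theta> - 1) * \<delta> powr 1)"
        using \<delta> unfolding e by (simp add: powr_mult powr_powr)
      moreover have "\<delta> powr (\<alpha> * \<theta>) * \<delta> powr (- \<alpha> * \<theta> - 1) * \<delta> powr 1 = 1"
        using \<delta> by (simp flip: powr_add)
      moreover have "2 powr (\<alpha> * \<theta> + 1) * 2 powr ((real j + 1) * (- \<alpha> * \<theta> - 1)) * 2 powr (real j) = 2 powr (- \<alpha> * \<theta> * real j)"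
        by (simp add: algebra_simps flip: powr_add)
      ultimately show ?thesis by (metis mult_1_right)
    qed
    then have "ennreal ((2 powr (- \<alpha> * \<theta>)) ^ j) = ennreal ?D * (ennreal ((2 ^ Suc j * \<delta>) powr (- \<alpha> * \<theta> - 1)) * ennreal (2 ^ j * \<delta>))"
      using \<delta> by (simp flip: ennreal_mult)
    then show ?thesis by (simp add: c_def ac_simps)
  qed
  then have "(\<Sum>j<k. ennreal ((2 powr (- \<alpha> * \<theta>)) ^ j) * W (2 ^ j * \<delta>) epowr \<theta>) = ennreal ?D * (\<Sum>j<k. c j * ennreal (2 ^ j * \<delta>))"
    by (simp add: sum_distrib_left)
  also have "\<dots> \<le> ennreal ?D * (\<integral>\<^sup>+t\<in>S. ?g t \<partial>lborel)" by (rule mult_left_mono[OF le]) simp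
  finally show ?thesis .
qed

lemma modulus_smoothness_mono: "s \<le> t \<Longrightarrow> modulus_smoothness \<alpha> p f s \<le> modulus_smoothness \<alpha> p f t"
  unfolding modulus_smoothness_def by (rule SUP_subset_mono) auto

lemma discrete_marchaud:
  fixes p :: ennreal
  assumes p: "0 < p" and \<alpha>: "\<alpha> \<in> smoothness_orders p" and \<gamma>: "0 < \<gamma>" and \<alpha>\<gamma>: "\<alpha> + \<gamma> \<in> smoothness_orders p"
  defines "\<theta> \<equiv> marchaud_exponent p"
  obtains C where "0 < C" "\<And>(f :: real^'n \<Rightarrow> complex) h \<delta> k. f \<in> Lp_space p \<Longrightarrow> norm h \<le> \<delta> \<Longrightarrow>
     Lp_norm p (frac_diff \<alpha> h f) epowr \<theta> \<le> ennreal C * (ennreal ((2 powr (- \<alpha> * \<theta>)) ^ k) * Lp_norm p f epowr \<theta>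
       + (\<Sum>j<k. ennreal ((2 powr (- \<alpha> * \<theta>)) ^ j) * modulus_smoothness (\<gamma> + \<alpha>) p f (2 ^ j * \<delta>) epowr \<theta>))"
proof -
  define q where "q = triangle_exponent p"
  define K where "K = smooth_const (enn2real p)"
  have q: "0 < q" "q \<le> 1" using triangle_exponent[OF p] by (auto simp: q_def)
  have adm: "admissible q \<alpha>" "admissible q (\<alpha> + \<gamma>)"
    using smoothness_orders_admissible[OF p] \<alpha> \<alpha>\<gamma> by (auto simp: q_def)
  have "\<theta> = q \<or> q = 1 \<and> 0 < \<theta>"
    using p by (cases p) (auto simp: \<theta>_def q_def marchaud_exponent_def triangle_exponent_def ennreal_less_one_iff)
  then have "marchaud_bound q \<theta> K \<alpha> (\<alpha> + \<gamma>)"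
    by (rule abstract_marchaud[OF q _ adm(1) \<gamma> adm(2)])
  then obtain C0 where C0: "0 \<le> C0" "\<And>N k. marchaud_functional q N \<theta> K \<Longrightarrow>
     dyad N \<theta> \<alpha> 0 \<le> C0 * ((2 powr (- \<alpha> * \<theta>)) ^ k * N 1 powr \<theta> + (\<Sum>j<k. (2 powr (- \<alpha> * \<theta>)) ^ j * dyad N \<theta> (\<alpha> + \<gamma>) j))"
    unfolding marchaud_bound_def by blast
  define C where "C = C0 + 1"
  have C: "0 < C" "C0 \<le> C" using C0 by (auto simp: C_def)
  let ?x = "2 powr (- \<alpha> * \<theta>)"
  show ?thesis
  proof (rule that[OF C(1)])
    fix f :: "real^'n \<Rightarrow> complex" and h :: "real^'n" and \<delta> :: real and k :: nat assume f: "f \<in> Lp_space p" and h: "norm h \<le> \<delta>"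
    define N where "N a = Lp_real p (shift_series h f a)" for a
    have mf: "marchaud_functional q N \<theta> K"
      unfolding q_def \<theta>_def K_def N_def using shift_series_is_marchaud_functional[OF p f] .
    interpret marchaud_functional q N \<theta> K by (rule mf)
    have dyad: "ennreal (dyad N \<theta> a j) = Lp_norm p (frac_diff a (2 ^ j *\<^sub>R h) f) epowr \<theta>" if "admissible q a" for a j
    proof -
      have "diff_symbol a \<in> lq (triangle_exponent p)" using diff_symbol_lq[OF q that] by (simp add: q_def)
      from Lp_norm_frac_diff[OF p f this, of "2 ^ j" h] show ?thesis
        by (simp add: dyad_def N_def)
    qed
    have N1: "ennreal (N 1 powr \<theta>) = Lp_norm p f epowr \<theta>"
      unfolding N_def shift_series_one[OF p f] Lp_norm_eq_real[OF f] by simp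
    have \<omega>: "ennreal (dyad N \<theta> (\<alpha> + \<gamma>) j) \<le> modulus_smoothness (\<gamma> + \<alpha>) p f (2 ^ j * \<delta>) epowr \<theta>" for j
      unfolding dyad[OF adm(2)] modulus_smoothness_def using h \<theta>_pos
      by (intro epowr_mono SUP_upper2[of "2 ^ j *\<^sub>R h"]) (auto simp: add.commute)
    have "Lp_norm p (frac_diff \<alpha> h f) epowr \<theta> = ennreal (dyad N \<theta> \<alpha> 0)"
      using dyad[OF adm(1), of 0] by simp
    also have "\<dots> \<le> ennreal (C * (?x ^ k * N 1 powr \<theta> + (\<Sum>j<k. ?x ^ j * dyad N \<theta> (\<alpha> + \<gamma>) j)))"
      by (rule ennreal_leI, rule order_trans[OF C0(2)[OF mf, of k]], intro mult_right_mono C)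
        (auto intro!: add_nonneg_nonneg sum_nonneg)
    also have "\<dots> = ennreal C * (ennreal (?x ^ k) * ennreal (N 1 powr \<theta>) + (\<Sum>j<k. ennreal (?x ^ j) * ennreal (dyad N \<theta> (\<alpha> + \<gamma>) j)))"
      using C by (simp add: ennreal_mult sum_nonneg flip: sum_ennreal)
    also have "\<dots> \<le> ennreal C * (ennreal (?x ^ k) * Lp_norm p f epowr \<theta>
       + (\<Sum>j<k. ennreal (?x ^ j) * modulus_smoothness (\<gamma> + \<alpha>) p f (2 ^ j * \<delta>) epowr \<theta>))"
      unfolding N1 by (intro mult_left_mono add_left_mono sum_mono \<omega>) auto
    finally show "Lp_norm p (frac_diff \<alpha> h f) epowr \<theta> \<le> ennreal C * (ennreal (?x ^ k) * Lp_norm p f epowr \<theta>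
       + (\<Sum>j<k. ennreal (?x ^ j) * modulus_smoothness (\<gamma> + \<alpha>) p f (2 ^ j * \<delta>) epowr \<theta>))" .
  qed
qed

lemma modulus_smoothness_le_from_power:
  fixes f :: "real^'n \<Rightarrow> complex"
  assumes "0 < \<theta>" "0 < D" "0 < \<delta>"
    and "\<And>h. norm h \<le> \<delta> \<Longrightarrow> Lp_norm p (frac_diff \<alpha> h f) epowr \<theta> \<le> ennreal (D * \<delta> powr (\<alpha> * \<theta>)) * J"
  shows "modulus_smoothness \<alpha> p f \<delta> \<le> ennreal (D powr (1 / \<theta>)) * ennreal (\<delta> powr \<alpha>) * J epowr (1 / \<theta>)"
  unfolding modulus_smoothness_def
proof (rule SUP_least)
  fix h :: "real^'n" assume "h \<in> {h. norm h \<le> \<delta>}"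
  then have "Lp_norm p (frac_diff \<alpha> h f) epowr \<theta> \<le> ennreal (D * \<delta> powr (\<alpha> * \<theta>)) * J"
    using assms by auto
  then have "(Lp_norm p (frac_diff \<alpha> h f) epowr \<theta>) epowr (1 / \<theta>) \<le> (ennreal (D * \<delta> powr (\<alpha> * \<theta>)) * J) epowr (1 / \<theta>)"
    using assms by (intro epowr_mono) auto
  also have "\<dots> = ennreal ((D * \<delta> powr (\<alpha> * \<theta>)) powr (1 / \<theta>)) * J epowr (1 / \<theta>)"
    using assms by (intro epowr_mult_ennreal) auto
  also have "(D * \<delta> powr (\<alpha> * \<theta>)) powr (1 / \<theta>) = D powr (1 / \<theta>) * \<delta> powr \<alpha>"
    using assms by (simp add: powr_mult powr_powr)
  also have "ennreal (D powr (1 / \<theta>) * \<delta> powr \<alpha>) = ennreal (D powr (1 / \<theta>)) * ennreal (\<delta> powr \<alpha>)"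
    by (simp add: ennreal_mult)
  finally show "Lp_norm p (frac_diff \<alpha> h f) \<le> ennreal (D powr (1 / \<theta>)) * ennreal (\<delta> powr \<alpha>) * J epowr (1 / \<theta>)"
    using assms by (simp add: epowr_epowr)
qed

theorem mainTheorem3:
  fixes p :: ennreal and \<alpha> \<gamma> \<theta> :: real
  assumes "0 < p"
    and "\<alpha> \<in> smoothness_orders p"
    and "0 < \<gamma>"
    and "\<alpha> + \<gamma> \<in> smoothness_orders p"
    and "\<theta> = marchaud_exponent p"
  shows
    "(\<exists>C::real. 0 < C \<and> (\<forall>f :: real^'n \<Rightarrow> complex. \<forall>\<delta>::real.
        f \<in> Lp_space p \<longrightarrow> 0 < \<delta> \<longrightarrow> \<delta> < 1 \<longrightarrow>
        modulus_smoothness \<alpha> p f \<delta> \<le>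
          ennreal C * ennreal (\<delta> powr \<alpha>) *
          ((\<integral>\<^sup>+t\<in>{\<delta>..1}. ((modulus_smoothness (\<gamma> + \<alpha>) p f t / ennreal (t powr \<alpha>)) epowr \<theta>)
              / ennreal t \<partial>lborel) + Lp_norm p f epowr \<theta>) epowr (1 / \<theta>)))
   \<and> (\<exists>C::real. 0 < C \<and> (\<forall>f :: real^'n \<Rightarrow> complex. \<forall>\<delta>::real.
        f \<in> Lp_space p \<longrightarrow> 0 < \<delta> \<longrightarrow> \<delta> < 1 \<longrightarrow>
        modulus_smoothness \<alpha> p f \<delta> \<le>
          ennreal C * ennreal (\<delta> powr \<alpha>) *
          (\<integral>\<^sup>+t\<in>{\<delta>..}. ((modulus_smoothness (\<gamma> + \<alpha>) p f t / ennreal (t powr \<alpha>)) epowr \<theta>)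
              / ennreal t \<partial>lborel) epowr (1 / \<theta>)))"
proof -
  let ?x = "2 powr (- \<alpha> * \<theta>)"
  obtain C where C: "0 < C" "\<And>(f :: real^'n \<Rightarrow> complex) h \<delta> k. f \<in> Lp_space p \<Longrightarrow> norm h \<le> \<delta> \<Longrightarrow>
     Lp_norm p (frac_diff \<alpha> h f) epowr \<theta> \<le> ennreal C * (ennreal (?x ^ k) * Lp_norm p f epowr \<theta>
       + (\<Sum>j<k. ennreal (?x ^ j) * modulus_smoothness (\<gamma> + \<alpha>) p f (2 ^ j * \<delta>) epowr \<theta>))"
    unfolding assms(5) by (rule discrete_marchaud[OF assms(1-4)]) blast
  have \<theta>: "0 < \<theta>"
    using assms(1) unfolding assms(5) marchaud_exponent_def by (cases p) auto
  have \<alpha>: "0 < \<alpha>"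
    by (rule admissible_pos[OF triangle_exponent[OF assms(1)] smoothness_orders_admissible[OF assms(1,2)]])
  define D where "D = C * 2 powr (\<alpha> * \<theta> + 1)"
  have D: "0 < D" using C by (simp add: D_def)
  let ?g = "\<lambda>f t. ((modulus_smoothness (\<gamma> + \<alpha>) p f t / ennreal (t powr \<alpha>)) epowr \<theta>) / ennreal t"
  have est: "Lp_norm p (frac_diff \<alpha> h f) epowr \<theta> \<le> ennreal (C * ?x ^ k) * Lp_norm p f epowr \<theta>
      + ennreal (D * \<delta> powr (\<alpha> * \<theta>)) * (\<integral>\<^sup>+t\<in>S. ?g f t \<partial>lborel)"
    if "f \<in> Lp_space p" "norm h \<le> \<delta>" "0 < \<delta>" "{\<delta>..<2 ^ k * \<delta>} \<subseteq> S" for f :: "real^'n \<Rightarrow> complex" and h :: "real^'n" and \<delta> k S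
  proof -
    note C(2)[OF that(1,2), of k]
    also have "ennreal C * (ennreal (?x ^ k) * Lp_norm p f epowr \<theta>
       + (\<Sum>j<k. ennreal (?x ^ j) * modulus_smoothness (\<gamma> + \<alpha>) p f (2 ^ j * \<delta>) epowr \<theta>))
      \<le> ennreal C * (ennreal (?x ^ k) * Lp_norm p f epowr \<theta>
       + ennreal (2 powr (\<alpha> * \<theta> + 1) * \<delta> powr (\<alpha> * \<theta>)) * (\<integral>\<^sup>+t\<in>S. ?g f t \<partial>lborel))"
      by (intro mult_left_mono add_left_mono dyadic_sum_le_integral modulus_smoothness_mono that \<theta> \<alpha>) auto
    also have "\<dots> = ennreal (C * ?x ^ k) * Lp_norm p f epowr \<theta>
      + ennreal (D * \<delta> powr (\<alpha> * \<theta>)) * (\<integral>\<^sup>+t\<in>S. ?g f t \<partial>lborel)"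
      using C(1) by (simp add: distrib_left D_def ennreal_mult mult.assoc)
    finally show ?thesis .
  qed
  show ?thesis
  proof (intro conjI exI[of _ "D powr (1 / \<theta>)"] allI impI)
    fix f :: "real^'n \<Rightarrow> complex" and \<delta> :: real
    assume f: "f \<in> Lp_space p" and \<delta>: "0 < \<delta>" "\<delta> < 1"
    let ?F = "Lp_norm p f epowr \<theta>" and ?J = "\<integral>\<^sup>+t\<in>{\<delta>..1}. ?g f t \<partial>lborel"
    obtain n where n: "1 / \<delta> < 2 ^ n" using real_arch_pow[of 2 "1 / \<delta>"] by auto
    \<comment> \<open>the largest \<open>k\<close> with \<open>2\<^sup>k \<delta> \<le> 1\<close>; then \<open>2\<^sup>-\<^sup>k \<le> 2 \<delta>\<close> turns the remainder into \<open>\<delta>\<^sup>\<alpha> \<parallel>f\<parallel>\<^sub>p\<close>\<close>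
    define m where "m = (LEAST n. 1 / \<delta> < 2 ^ n)"
    have m: "1 / \<delta> < 2 ^ m" unfolding m_def using n by (rule LeastI)
    have "m \<noteq> 0"
    proof
      assume "m = 0"
      then show False using m \<delta> by simp
    qed
    then obtain k where k: "m = Suc k" by (cases m) auto
    have "\<not> 1 / \<delta> < 2 ^ k" using not_less_Least[of k "\<lambda>n. 1 / \<delta> < 2 ^ n"] k by (simp add: m_def)
    then have k1: "2 ^ k * \<delta> \<le> 1" using \<delta> by (simp add: field_simps)
    have k2: "1 \<le> 2 * 2 ^ k * \<delta>" using m \<delta> k by (simp add: field_simps)
    have xk: "?x ^ k \<le> 2 powr (\<alpha> * \<theta>) * \<delta> powr (\<alpha> * \<theta>)"
    proof -
      have "1 \<le> (2 * 2 ^ k * \<delta>) powr (\<alpha> * \<theta>)" using k2 \<alpha> \<theta> by (intro ge_one_powr_ge_zero) auto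
      also have "\<dots> = (2 ^ k) powr (\<alpha> * \<theta>) * (2 powr (\<alpha> * \<theta>) * \<delta> powr (\<alpha> * \<theta>))"
        by (simp add: powr_mult)
      finally have "?x ^ k * 1 \<le> ?x ^ k * ((2 ^ k) powr (\<alpha> * \<theta>) * (2 powr (\<alpha> * \<theta>) * \<delta> powr (\<alpha> * \<theta>)))"
        by (intro mult_left_mono) auto
      moreover have e: "?x ^ k * (2 ^ k) powr (\<alpha> * \<theta>) = 1"
        by (simp add: powr_realpow[symmetric] powr_powr algebra_simps flip: powr_add)
      ultimately show ?thesis by (simp only: mult.assoc[symmetric] e mult_1_left mult_1_right)
    qed
    show "modulus_smoothness \<alpha> p f \<delta> \<le> ennreal (D powr (1 / \<theta>)) * ennreal (\<delta> powr \<alpha>) * (?J + ?F) epowr (1 / \<theta>)"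
    proof (rule modulus_smoothness_le_from_power[OF \<theta> D \<delta>(1)])
      fix h :: "real^'n" assume h: "norm h \<le> \<delta>"
      have "Lp_norm p (frac_diff \<alpha> h f) epowr \<theta> \<le> ennreal (C * ?x ^ k) * ?F + ennreal (D * \<delta> powr (\<alpha> * \<theta>)) * ?J"
        by (rule est[OF f h \<delta>(1)]) (use k1 in auto)
      also have "C * ?x ^ k \<le> D * \<delta> powr (\<alpha> * \<theta>)"
      proof -
        have "C * ?x ^ k \<le> C * (2 powr (\<alpha> * \<theta>) * \<delta> powr (\<alpha> * \<theta>))" using xk C(1) by simp
        also have "\<dots> \<le> C * (2 powr (\<alpha> * \<theta> + 1) * \<delta> powr (\<alpha> * \<theta>))"
          using C(1) by (intro mult_left_mono mult_right_mono powr_mono) auto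
        finally show ?thesis by (simp add: D_def mult.assoc)
      qed
      finally show "Lp_norm p (frac_diff \<alpha> h f) epowr \<theta> \<le> ennreal (D * \<delta> powr (\<alpha> * \<theta>)) * (?J + ?F)"
        by (simp add: distrib_left add.commute ennreal_leI mult_right_mono add_left_mono)
    qed
  next
    fix f :: "real^'n \<Rightarrow> complex" and \<delta> :: real
    assume f: "f \<in> Lp_space p" and \<delta>: "0 < \<delta>" "\<delta> < 1"
    let ?J = "\<integral>\<^sup>+t\<in>{\<delta>..}. ?g f t \<partial>lborel"
    have F: "Lp_norm p f epowr \<theta> = ennreal (Lp_real p f powr \<theta>)"
      unfolding Lp_norm_eq_real[OF f] by simp
    have "- \<alpha> * \<theta> < 0" using \<alpha> \<theta> by simp
    then have x: "?x < 1" using powr_less_mono[of "- \<alpha> * \<theta>" 0 2] by simp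
    show "modulus_smoothness \<alpha> p f \<delta> \<le> ennreal (D powr (1 / \<theta>)) * ennreal (\<delta> powr \<alpha>) * ?J epowr (1 / \<theta>)"
    proof (rule modulus_smoothness_le_from_power[OF \<theta> D \<delta>(1)])
      fix h :: "real^'n" assume h: "norm h \<le> \<delta>"
      show "Lp_norm p (frac_diff \<alpha> h f) epowr \<theta> \<le> ennreal (D * \<delta> powr (\<alpha> * \<theta>)) * ?J"
      \<comment> \<open>here \<open>k\<close> is unrestricted, and the remainder \<open>2\<^sup>-\<^sup>k\<^sup>\<alpha> \<parallel>f\<parallel>\<^sub>p\<close> is made arbitrarily small\<close>
      proof (rule ennreal_le_epsilon)
        fix e :: real assume e: "0 < e"
        have "(\<lambda>k. C * ?x ^ k * Lp_real p f powr \<theta>) \<longlonglongrightarrow> C * 0 * Lp_real p f powr \<theta>"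
          using x by (intro tendsto_intros LIMSEQ_realpow_zero) auto
        then have "\<forall>\<^sub>F k in sequentially. C * ?x ^ k * Lp_real p f powr \<theta> < e"
          using e by (intro order_tendstoD(2)) auto
        then obtain k where k: "C * ?x ^ k * Lp_real p f powr \<theta> < e"
          by (auto simp: eventually_sequentially)
        have "Lp_norm p (frac_diff \<alpha> h f) epowr \<theta> \<le> ennreal (C * ?x ^ k) * Lp_norm p f epowr \<theta> + ennreal (D * \<delta> powr (\<alpha> * \<theta>)) * ?J"
          by (rule est[OF f h \<delta>(1)]) auto
        also have "ennreal (C * ?x ^ k) * Lp_norm p f epowr \<theta> \<le> ennreal e"
          unfolding F using k C(1) by (simp add: ennreal_leI flip: ennreal_mult)
        finally show "Lp_norm p (frac_diff \<alpha> h f) epowr \<theta> \<le> ennreal (D * \<delta> powr (\<alpha> * \<theta>)) * ?J + ennreal e"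
          by (simp add: add.commute)
      qed
    qed
  qed (use D in auto)
qed

end
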